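(* If $k>1$ is an integer, the space $\mathscr Z^{(k)}$ (built from the couple $(\ell_\infty,\ell_1)$ at the base point $z=1/2$) does not contain complemented copies of $\ell_2$, i.e. it has no complemented subspace isomorphic to $\ell_2$.
   Context: Let $\mathbb S=\{z\in\mathbb C:0<\Re z<1\}$ and consider complex sequence spaces $\ell_\infty=\ell_\infty(\mathbb N)$, $\ell_1=\ell_1(\mathbb N)$. Let $\mathscr F$ be the Banach space of bounded analytic functions $F:\mathbb S\to\ell_\infty$ such that (1) $F$ extends to a $\sigma(\ell_\infty,\ell_1)$-continuous function on $\overline{\mathbb S}$, again denoted $F$; (2) $\|F\|_{\mathscr F}=\sup\{\|F(it)\|_\infty,\ \|F(1+it)\|_1: t\in\mathbb R\}<\infty$. For $n\ge1$, $$\mathscr Z^{(n)}=\Big\{(x_{n-1},\dots,x_0)\in(\ell_\infty)^n:\ \exists f\in\mathscr F,\ x_i=\tfrac{1}{i!}f^{(i)}(\tfrac12)\text{ for all }0\le i<n\Big\},$$ with norm the infimum of $\|f\|_{\mathscr F}$ over all such $f$. (Thus $\mathscr Z^{(1)}=\ell_2$ and $\mathscr Z^{(2)}$ is isomorphic to the Kalton–Peck space $Z_2$.) *)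

theory Defs
  imports "HOL-Analysis.Analysis"
begin

section \<open>Complex sequence spaces\<close>

text \<open>
  As \<^typ>\<open>nat\<close> is discrete, \<open>nat \<Rightarrow>\<^sub>C complex\<close> with its library norm is the complex Banach space
  of bounded sequences with the supremum norm.  The library makes it a real vector space only,
  so multiplication by complex scalars is added here.
\<close>

type_synonym linf = "nat \<Rightarrow>\<^sub>C complex"

definition cscale :: "complex \<Rightarrow> linf \<Rightarrow> linf" where
  "cscale c x = Bcontfun (\<lambda>n. c * x n)"

lemma apply_cscale [simp]: "apply_bcontfun (cscale c x) n = c * x n"
proof -
  obtain B where "\<And>n. norm (x n) \<le> B"
    using bounded_apply_bcontfun[of x] by (auto simp: bounded_iff)
  then have "\<And>n. norm (c * x n) \<le> norm c * B"
    by (simp add: norm_mult mult_left_mono)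
  then have "bounded (range (\<lambda>n. c * x n))"
    by (auto simp: bounded_iff)
  then have "(\<lambda>n. c * x n) \<in> bcontfun"
    by (simp add: bcontfun_def)
  then show ?thesis
    by (simp add: cscale_def Bcontfun_inverse)
qed

text \<open>The \<open>l\<^sub>1\<close>-norm is extended-valued: it is \<open>\<infinity>\<close> exactly off \<open>l\<^sub>1\<close>.\<close>

definition l1_norm :: "linf \<Rightarrow> ennreal" where
  "l1_norm x = (\<Sum>n. ennreal (cmod (x n)))"

definition l1 :: "linf set" where
  "l1 = {x. l1_norm x < \<infinity>}"

text \<open>The topology \<open>\<sigma>(l\<^sub>\<infinity>, l\<^sub>1)\<close> for the bilinear pairing \<open>(x, y) \<mapsto> \<Sum>n. x n * y n\<close>.\<close>

definition pairing :: "linf \<Rightarrow> linf \<Rightarrow> complex" where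
  "pairing x y = (\<Sum>n. x n * y n)"

definition weak_star_topology :: "linf topology" where
  "weak_star_topology =
     topology_generated_by {{x. pairing x y \<in> U} | y U. y \<in> l1 \<and> open U}"


section \<open>Analytic functions with values in \<open>l\<^sub>\<infinity>\<close>\<close>

definition has_cderiv :: "(complex \<Rightarrow> linf) \<Rightarrow> linf \<Rightarrow> complex \<Rightarrow> bool" where
  "has_cderiv F D z \<longleftrightarrow> (F has_derivative (\<lambda>h. cscale h D)) (at z)"

definition cderiv :: "(complex \<Rightarrow> linf) \<Rightarrow> complex \<Rightarrow> linf" where
  "cderiv F z = (SOME D. has_cderiv F D z)"

text \<open>Only used for open \<open>A\<close>, where norm-analyticity is complex differentiability at each point.\<close>

definition analytic_linf :: "(complex \<Rightarrow> linf) \<Rightarrow> complex set \<Rightarrow> bool" where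
  "analytic_linf F A \<longleftrightarrow> (\<forall>z\<in>A. \<exists>D. has_cderiv F D z)"

definition strip :: "complex set" where
  "strip = {z. 0 < Re z \<and> Re z < 1}"

definition F_norm :: "(complex \<Rightarrow> linf) \<Rightarrow> ennreal" where
  "F_norm F = (SUP t::real. max (ennreal (norm (F (\<i> * of_real t))))
                                (l1_norm (F (1 + \<i> * of_real t))))"

text \<open>
  An element of \<open>F_space\<close> is a total function of which only the restriction to the
  closed strip matters; it stands for the function on the open strip together with its extension.
\<close>

definition F_space :: "(complex \<Rightarrow> linf) set" where
  "F_space = {F. analytic_linf F strip \<and> bounded (F ` strip) \<and>
                 continuous_map (top_of_set (closure strip)) weak_star_topology F \<and>
                 F_norm F < \<infinity>}"


section \<open>Complex normed spaces on a carrier\<close>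

record 'a complex_normed =
  cn_carrier :: "'a set"
  cn_add :: "'a \<Rightarrow> 'a \<Rightarrow> 'a"
  cn_scale :: "complex \<Rightarrow> 'a \<Rightarrow> 'a"
  cn_norm :: "'a \<Rightarrow> real"

definition bounded_clinear_map ::
    "'a complex_normed \<Rightarrow> 'b complex_normed \<Rightarrow> ('a \<Rightarrow> 'b) \<Rightarrow> bool" where
  "bounded_clinear_map X Y T \<longleftrightarrow>
     T \<in> cn_carrier X \<rightarrow> cn_carrier Y \<and>
     (\<forall>x\<in>cn_carrier X. \<forall>y\<in>cn_carrier X. T (cn_add X x y) = cn_add Y (T x) (T y)) \<and>
     (\<forall>c. \<forall>x\<in>cn_carrier X. T (cn_scale X c x) = cn_scale Y c (T x)) \<and>
     (\<exists>K. \<forall>x\<in>cn_carrier X. cn_norm Y (T x) \<le> K * cn_norm X x)"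

definition isomorphic_normed :: "'a complex_normed \<Rightarrow> 'b complex_normed \<Rightarrow> bool" where
  "isomorphic_normed X Y \<longleftrightarrow>
     (\<exists>T S. bounded_clinear_map X Y T \<and> bounded_clinear_map Y X S \<and>
            (\<forall>x\<in>cn_carrier X. S (T x) = x) \<and> (\<forall>y\<in>cn_carrier Y. T (S y) = y))"

text \<open>The range of a bounded linear projection is automatically a closed linear subspace.\<close>

definition complemented_subspace :: "'a set \<Rightarrow> 'a complex_normed \<Rightarrow> bool" where
  "complemented_subspace M X \<longleftrightarrow>
     (\<exists>P. bounded_clinear_map X X P \<and> (\<forall>x\<in>cn_carrier X. P (P x) = P x) \<and>
          P ` cn_carrier X = M)"

definition subspace_of :: "'a set \<Rightarrow> 'a complex_normed \<Rightarrow> 'a complex_normed" where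
  "subspace_of M X = X\<lparr>cn_carrier := M\<rparr>"

definition ell2 :: "linf complex_normed" where
  "ell2 = \<lparr>cn_carrier = {x :: linf. summable (\<lambda>n. (cmod (x n))\<^sup>2)},
           cn_add = (+),
           cn_scale = cscale,
           cn_norm = (\<lambda>x :: linf. sqrt (\<Sum>n. (cmod (x n))\<^sup>2))\<rparr>"


section \<open>The Rochberg spaces\<close>

text \<open>
  A tuple \<open>(x\<^bsub>n-1\<^esub>, \<dots>, x\<^sub>0)\<close> is the sequence \<open>x\<close> with \<open>x i = x\<^sub>i\<close> for \<open>i < n\<close>
  and \<open>x i = 0\<close> for \<open>i \<ge> n\<close>.
\<close>

definition Z_representatives :: "nat \<Rightarrow> (nat \<Rightarrow> linf) \<Rightarrow> (complex \<Rightarrow> linf) set" where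
  "Z_representatives n x =
     {f \<in> F_space. \<forall>i<n. x i = (1 / fact i) *\<^sub>R (cderiv ^^ i) f (1/2)}"

definition Z_space :: "nat \<Rightarrow> (nat \<Rightarrow> linf) complex_normed" where
  "Z_space n = \<lparr>cn_carrier = {x. (\<forall>i\<ge>n. x i = 0) \<and> Z_representatives n x \<noteq> {}},
                cn_add = (\<lambda>x y i. x i + y i),
                cn_scale = (\<lambda>c x i. cscale c (x i)),
                cn_norm = (\<lambda>x. enn2real (INF f\<in>Z_representatives n x. F_norm f))\<rparr>"

end

theory Submission
  imports Defs "HOL-Complex_Analysis.Complex_Analysis"
begin

text \<open>
  A projection of \<open>Z\<^sup>(\<^sup>k\<^sup>)\<close> onto a copy of \<open>l\<^sub>2\<close> yields vectors \<open>x\<^sub>n\<close> with an upper \<open>2\<close>-estimate (the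
  images of the unit vectors) and functionals \<open>f\<^sub>n\<close> with \<open>f\<^sub>n(x\<^sub>n) = 1\<close> and
  \<open>\<Sum>n. |f\<^sub>n(x)|\<^sup>2 \<le> K\<^sup>2 \<parallel>x\<parallel>\<^sup>2\<close>.  These two estimates are incompatible with the logarithms that are
  built into \<open>Z\<^sup>(\<^sup>k\<^sup>)\<close> for \<open>k > 1\<close>.

  The logarithms appear as follows.  If \<open>Y\<^sub>1, \<dots>, Y\<^sub>N\<close> are disjointly supported functions in the unit
  ball of the Calderon space, then \<open>N\<^bsup>-z\<^esup> (Y\<^sub>1 + \<dots> + Y\<^sub>N)\<close> is again in the unit ball
  (\<open>calderon_block_sum\<close>): on the left edge the sup norm does not see the number of blocks, and on the
  right edge \<open>|N\<^bsup>-z\<^esup>| = 1/N\<close>.  With \<open>w = z - 1/2\<close> one has \<open>N\<^bsup>-z\<^esup> = N\<^bsup>-1/2\<^esup> exp (- w ln N)\<close>, so the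
  Taylor coefficients of this function at \<open>1/2\<close> are those of the sum of the blocks, normalized as in
  \<open>l\<^sub>2\<close>, plus shifted copies multiplied by powers of \<open>ln N\<close>.  Random signs in front of the blocks
  isolate diagonal terms, and there are two consequences.

  \<^item> Evaluating the \<open>f\<^sub>n\<close> on signed block sums gives, for every bounded sequence of disjoint
    blocks \<open>Y\<^sub>n\<close>, a polynomial in \<open>ln N\<close> with coefficients \<open>f\<^sub>n(w\<^sup>j Y\<^sub>n)\<close>, up to factorials and signs, that
    is bounded independently of \<open>N\<close> for almost all \<open>n\<close>.  Hence \<open>f\<^sub>n(w Y\<^sub>n) \<rightarrow> 0\<close>
    (\<open>shifted_blocks_tend_to_0\<close>).

  \<^item> For \<open>F\<close>, \<open>G\<close> in the Calderon space, \<open>\<Sum>j. F\<^sub>j(z) G\<^sub>j(1 - z)\<close> is a bounded analytic function on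
    the strip, so its first Taylor coefficient is a bounded form.  Pairing \<open>\<pm>x\<^sub>1 \<pm> \<dots> \<pm> x\<^sub>N\<close>,
    whose norm is at most of order \<open>N\<^bsup>1/2\<^esup>\<close>, with signed block sums of Calderon extremals gives, up to bounded
    terms and after division by \<open>N\<^bsup>1/2\<^esup>\<close>, a quantity at least \<open>ln N\<close> times the mean of the squared \<open>l\<^sub>2\<close>-norms of the values of \<open>x\<^sub>n\<close> on the blocks.  Hence these values tend to
    \<open>0\<close> (\<open>block_values_tend_to_0\<close>).

  Finitely supported tuples are dense in \<open>Z\<^sup>(\<^sup>k\<^sup>)\<close> (\<open>tail_small\<close>), so a gliding hump gives disjoint
  finite sets \<open>A\<^sub>n\<close> such that \<open>f\<^sub>n\<close> of the part of \<open>x\<^sub>n\<close> on \<open>A\<^sub>n\<close> does not tend to \<open>0\<close>.  But this part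
  is the extremal lift of its value at \<open>1/2\<close>, which is small by the second consequence, plus \<open>w\<close>
  times a bounded block, on which \<open>f\<^sub>n\<close> is small by the first one (\<open>blocks_tend_to_0\<close>).

  Functions in the Calderon space are handled as families of scalar functions, one for each
  coordinate, and elements of \<open>Z\<^sup>(\<^sup>k\<^sup>)\<close> as such families modulo \<open>w\<^sup>k\<close>.
\<close>

section \<open>The maximum principle on the strip\<close>

definition cstrip :: "complex set" where
  "cstrip = {z. 0 \<le> Re z \<and> Re z \<le> 1}"

lemma strip_subset_cstrip: "strip \<subseteq> cstrip"
  by (auto simp: strip_def cstrip_def)

lemma open_strip: "open strip"
proof -
  have "strip = {z. 0 < Re z} \<inter> {z. Re z < 1}" by (auto simp: strip_def)
  then show ?thesis
    using open_Int[OF open_halfspace_Re_gt[of 0] open_halfspace_Re_lt[of 1]] by simp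
qed

lemma closed_cstrip: "closed cstrip"
proof -
  have "cstrip = {z. 0 \<le> Re z} \<inter> {z. Re z \<le> 1}" by (auto simp: cstrip_def)
  then show ?thesis
    using closed_Int[OF closed_halfspace_Re_ge[of 0] closed_halfspace_Re_le[of 1]] by simp
qed

lemma closure_strip: "closure strip = cstrip"
proof
  show "closure strip \<subseteq> cstrip"
    by (rule closure_minimal[OF strip_subset_cstrip closed_cstrip])
  show "cstrip \<subseteq> closure strip"
  proof
    fix z assume z: "z \<in> cstrip"
    define p where "p n = z + of_real (inverse (real (Suc n))) * (1/2 - z)" for n
    have "p n \<in> strip" for n
    proof -
      define s where "s = inverse (real (Suc n))"
      have s: "0 < s" "s \<le> 1" by (auto simp: s_def field_simps)
      have "p n = z + of_real s * (1/2 - z)" unfolding p_def s_def ..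
      then have *: "Re (p n) = (1 - s) * Re z + s / 2"
        by (simp add: left_diff_distrib right_diff_distrib)
      have "0 \<le> (1 - s) * Re z" "(1 - s) * Re z \<le> 1 - s"
        using z s by (auto simp: cstrip_def mult_left_le)
      then show ?thesis using s unfolding strip_def mem_Collect_eq * by linarith
    qed
    moreover have "p \<longlonglongrightarrow> z + of_real 0 * (1/2 - z)"
      unfolding p_def by (intro tendsto_intros LIMSEQ_inverse_real_of_nat)
    ultimately show "z \<in> closure strip"
      unfolding closure_sequential by (metis add.right_neutral mult_zero_left of_real_0)
  qed
qed

lemma half_in_strip [simp]: "1/2 \<in> strip"
  by (simp add: strip_def)

lemma half_in_cstrip [simp]: "1/2 \<in> cstrip"
  by (simp add: cstrip_def)

lemma cball_half_subset_cstrip: "cball (1/2) (1/2) \<subseteq> cstrip"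
proof
  fix z :: complex assume "z \<in> cball (1/2) (1/2)"
  then have "cmod (1/2 - z) \<le> 1/2" by (simp add: dist_norm)
  then have "\<bar>1/2 - Re z\<bar> \<le> 1/2"
    using abs_Re_le_cmod[of "1/2 - z"] by simp
  then show "z \<in> cstrip" unfolding cstrip_def mem_Collect_eq abs_le_iff by linarith
qed

lemma ball_half_subset_strip: "ball (1/2) (1/2) \<subseteq> strip"
proof
  fix z :: complex assume "z \<in> ball (1/2) (1/2)"
  then have "cmod (1/2 - z) < 1/2" by (simp add: dist_norm)
  then have "\<bar>1/2 - Re z\<bar> < 1/2"
    using abs_Re_le_cmod[of "1/2 - z"] by simp
  then show "z \<in> strip" unfolding strip_def mem_Collect_eq abs_less_iff by linarith
qed

text \<open>
  Cauchy's inequality on the disc of radius \<open>1/2\<close> about \<open>1/2\<close>, the largest one inside the closed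
  strip; the factor \<open>2\<close> is the inverse radius.
\<close>

lemma deriv_bound_half:
  assumes "f holomorphic_on strip" "continuous_on cstrip f"
    and "\<And>z. z \<in> cstrip \<Longrightarrow> cmod (f z) \<le> B"
  shows "cmod (deriv f (1/2)) \<le> 2 * B"
proof -
  have "norm ((deriv ^^ 1) f (1/2)) \<le> fact 1 * B / (1/2)^1"
  proof (rule Cauchy_inequality)
    show "f holomorphic_on ball (1/2) (1/2)"
      by (rule holomorphic_on_subset[OF assms(1) ball_half_subset_strip])
    show "continuous_on (cball (1/2) (1/2)) f"
      by (rule continuous_on_subset[OF assms(2) cball_half_subset_cstrip])
    fix x :: complex assume "norm (1/2 - x) = 1/2"
    then have "x \<in> cball (1/2) (1/2)" by (simp add: dist_norm)
    then show "norm (f x) \<le> B" using assms(3) cball_half_subset_cstrip by blast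
  qed simp
  then show ?thesis by simp
qed

text \<open>
  Phragmen--Lindelof: division by \<open>1 + \<delta> z\<close>, whose modulus is at least \<open>1\<close> on the strip and grows
  with \<open>Im z\<close>, makes the function small on the horizontal edges of a tall rectangle.  There the
  ordinary maximum modulus principle applies; then \<open>\<delta>\<close> tends to \<open>0\<close>.
\<close>

lemma strip_maximum_principle:
  assumes hol: "f holomorphic_on strip" and cont: "continuous_on cstrip f"
    and bdd: "\<And>z. z \<in> cstrip \<Longrightarrow> cmod (f z) \<le> B"
    and left: "\<And>t. cmod (f (\<i> * of_real t)) \<le> C"
    and right: "\<And>t. cmod (f (1 + \<i> * of_real t)) \<le> C"
    and z: "z \<in> cstrip"
  shows "cmod (f z) \<le> C"
proof -
  have key: "cmod (f z) \<le> C' * cmod (1 + of_real \<delta> * z)" if "\<delta> > 0" "C' > C" for \<delta> C'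
  proof -
    have C0: "0 \<le> C" using order_trans[OF norm_ge_zero left] .
    have B0: "0 \<le> B" using order_trans[OF norm_ge_zero bdd[OF z]] .
    define T where "T = max (\<bar>Im z\<bar> + 1) (B / (\<delta> * C'))"
    have T: "T \<ge> \<bar>Im z\<bar> + 1" "T \<ge> B / (\<delta> * C')" by (auto simp: T_def)
    define S where "S = cbox (Complex 0 (-T)) (Complex 1 T)"
    have Sm: "y \<in> S \<longleftrightarrow> 0 \<le> Re y \<and> Re y \<le> 1 \<and> -T \<le> Im y \<and> Im y \<le> T" for y
      by (auto simp: S_def in_cbox_complex_iff)
    have intS: "interior S = box (Complex 0 (-T)) (Complex 1 T)" by (simp add: S_def)
    have int: "y \<in> interior S \<longleftrightarrow> 0 < Re y \<and> Re y < 1 \<and> -T < Im y \<and> Im y < T" for y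
      by (auto simp: intS in_box_complex_iff)
    have ge: "1 \<le> cmod (1 + of_real \<delta> * y)" "\<delta> * \<bar>Im y\<bar> \<le> cmod (1 + of_real \<delta> * y)"
      if "y \<in> cstrip" for y
    proof -
      have "0 \<le> \<delta> * Re y" using that \<open>\<delta> > 0\<close> by (simp add: cstrip_def)
      then show "1 \<le> cmod (1 + of_real \<delta> * y)"
        using complex_Re_le_cmod[of "1 + of_real \<delta> * y"] by simp
      show "\<delta> * \<bar>Im y\<bar> \<le> cmod (1 + of_real \<delta> * y)"
        using abs_Im_le_cmod[of "1 + of_real \<delta> * y"] \<open>\<delta> > 0\<close> by (simp add: abs_mult)
    qed
    have nz: "1 + of_real \<delta> * y \<noteq> 0" if "y \<in> cstrip" for y
      using ge(1)[OF that] by auto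
    have sub: "S \<subseteq> cstrip" "interior S \<subseteq> strip"
      using Sm int by (auto simp: cstrip_def strip_def)
    have "cmod (f z / (1 + of_real \<delta> * z)) \<le> C'"
    proof (rule maximum_modulus_frontier[where S = S and f = "\<lambda>y. f y / (1 + of_real \<delta> * y)"])
      show "(\<lambda>y. f y / (1 + of_real \<delta> * y)) holomorphic_on interior S"
        using sub strip_subset_cstrip nz
        by (intro holomorphic_intros holomorphic_on_subset[OF hol]) auto
      have "closure S = S" by (simp add: S_def)
      then show "continuous_on (closure S) (\<lambda>y. f y / (1 + of_real \<delta> * y))"
        using sub nz by (intro continuous_intros continuous_on_subset[OF cont]) auto
      show "bounded S" by (simp add: S_def)
      have "-T \<le> Im z" "Im z \<le> T" using T(1) by linarith+
      then show "z \<in> S" using z Sm unfolding cstrip_def by blast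
      fix y assume "y \<in> frontier S"
      then have y: "y \<in> S" "y \<notin> interior S" using \<open>closure S = S\<close> by (auto simp: frontier_def)
      then have ys: "y \<in> cstrip" using sub by auto
      have m1: "1 \<le> cmod (1 + of_real \<delta> * y)" by (rule ge(1)[OF ys])
      have "cmod (f y) \<le> C' * cmod (1 + of_real \<delta> * y)"
      proof (cases "Re y = 0 \<or> Re y = 1")
        case True
        have "y = \<i> * of_real (Im y) \<or> y = 1 + \<i> * of_real (Im y)"
          using True by (auto simp: complex_eq_iff)
        then have "cmod (f y) \<le> C" using left[of "Im y"] right[of "Im y"] by auto
        also have "\<dots> \<le> C' * 1" using that by simp
        also have "\<dots> \<le> C' * cmod (1 + of_real \<delta> * y)"
          using m1 C0 that by (intro mult_left_mono) auto
        finally show ?thesis .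
      next
        case False
        moreover have "0 \<le> Re y" "Re y \<le> 1" "-T \<le> Im y" "Im y \<le> T"
          using y(1) Sm by auto
        moreover have "\<not> (0 < Re y \<and> Re y < 1 \<and> -T < Im y \<and> Im y < T)"
          using y(2) int by simp
        ultimately have "\<bar>Im y\<bar> = T" by linarith
        then have "\<delta> * T \<le> cmod (1 + of_real \<delta> * y)" using ge(2)[OF ys] by simp
        moreover have "B \<le> C' * (\<delta> * T)"
          using T(2) that C0 by (simp add: pos_divide_le_eq mult.commute mult.left_commute)
        moreover have "C' * (\<delta> * T) \<le> C' * cmod (1 + of_real \<delta> * y)"
          using calculation(1) C0 that by (intro mult_left_mono) auto
        ultimately show ?thesis using bdd[OF ys] by linarith
      qed
      then show "cmod (f y / (1 + of_real \<delta> * y)) \<le> C'"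
        using m1 by (subst norm_divide, subst pos_divide_le_eq) auto
    qed
    then show ?thesis
      using ge(1)[OF z] by (subst (asm) norm_divide, subst (asm) pos_divide_le_eq) auto
  qed
  have "cmod (f z) \<le> C'" if "C' > C" for C'
  proof (rule tendsto_lowerbound)
    have "(\<lambda>n. C' * cmod (1 + of_real (inverse (real (Suc n))) * z))
            \<longlonglongrightarrow> C' * cmod (1 + of_real 0 * z)"
      by (intro tendsto_intros LIMSEQ_inverse_real_of_nat)
    then show "(\<lambda>n. C' * cmod (1 + of_real (inverse (real (Suc n))) * z)) \<longlonglongrightarrow> C'"
      by simp
    show "\<forall>\<^sub>F n in sequentially. cmod (f z) \<le> C' * cmod (1 + of_real (inverse (real (Suc n))) * z)"
      by (intro always_eventually allI key that) simp
  qed simp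
  then show ?thesis by (rule dense_ge)
qed


section \<open>Zeros at the base point\<close>

text \<open>
  A zero of order at least \<open>k\<close> at the base point, expressed by divisibility in the ring of
  holomorphic functions on the strip.  In this form sums and products need no Leibniz rule.
\<close>

definition vanishes :: "nat \<Rightarrow> (complex \<Rightarrow> complex) \<Rightarrow> bool" where
  "vanishes k f \<longleftrightarrow> (\<exists>h. h holomorphic_on strip \<and> (\<forall>z\<in>strip. f z = (z - 1/2) ^ k * h z))"

lemma vanishesI:
  "h holomorphic_on strip \<Longrightarrow> (\<And>z. z \<in> strip \<Longrightarrow> f z = (z - 1/2) ^ k * h z) \<Longrightarrow> vanishes k f"
  by (auto simp: vanishes_def)

lemma vanishes_zero [simp]: "vanishes k (\<lambda>z. 0)"
  by (rule vanishesI[of "\<lambda>z. 0"]) auto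

lemma vanishes_cong: "vanishes k f \<Longrightarrow> (\<And>z. z \<in> strip \<Longrightarrow> f z = g z) \<Longrightarrow> vanishes k g"
  by (auto simp: vanishes_def)

lemma vanishes_add: "vanishes k f \<Longrightarrow> vanishes k g \<Longrightarrow> vanishes k (\<lambda>z. f z + g z)"
  unfolding vanishes_def
  by (elim exE conjE, rename_tac h1 h2, rule_tac x = "\<lambda>z. h1 z + h2 z" in exI)
     (auto intro!: holomorphic_intros simp: algebra_simps)

lemma vanishes_mult:
  "vanishes k f \<Longrightarrow> vanishes l g \<Longrightarrow> vanishes (k + l) (\<lambda>z. f z * g z)"
  unfolding vanishes_def
  by (elim exE conjE, rename_tac h1 h2, rule_tac x = "\<lambda>z. h1 z * h2 z" in exI)
     (auto intro!: holomorphic_intros simp: algebra_simps power_add)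

lemma vanishes_0_iff: "vanishes 0 f \<longleftrightarrow> f holomorphic_on strip"
  unfolding vanishes_def by (auto intro: holomorphic_transform)

lemma vanishes_mult_hol: "vanishes k f \<Longrightarrow> g holomorphic_on strip \<Longrightarrow> vanishes k (\<lambda>z. g z * f z)"
  using vanishes_mult[of 0 g k f] by (simp add: vanishes_0_iff)

lemma vanishes_cmult: "vanishes k f \<Longrightarrow> vanishes k (\<lambda>z. c * f z)"
  by (rule vanishes_mult_hol) (auto intro: holomorphic_intros)

lemma vanishes_uminus: "vanishes k f \<Longrightarrow> vanishes k (\<lambda>z. - f z)"
  using vanishes_cmult[of k f "-1"] by simp

lemma vanishes_diff: "vanishes k f \<Longrightarrow> vanishes k g \<Longrightarrow> vanishes k (\<lambda>z. f z - g z)"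
  using vanishes_add[of k f "\<lambda>z. - g z"] by (simp add: vanishes_uminus)

lemma vanishes_sum: "(\<And>i. i \<in> A \<Longrightarrow> vanishes k (f i)) \<Longrightarrow> vanishes k (\<lambda>z. \<Sum>i\<in>A. f i z)"
  by (induction A rule: infinite_finite_induct) (auto intro: vanishes_add)

lemma vanishes_power: "vanishes k f \<Longrightarrow> vanishes (n * k) (\<lambda>z. f z ^ n)"
proof (induction n)
  case 0
  then show ?case by (simp add: vanishes_0_iff)
qed (simp add: vanishes_mult)

lemma vanishes_mono:
  assumes "vanishes k f" "l \<le> k" shows "vanishes l f"
proof -
  have "vanishes (k - l) (\<lambda>z. (z - 1/2) ^ (k - l))"
    by (rule vanishesI[of "\<lambda>z. 1"]) auto
  obtain h where h: "h holomorphic_on strip" "\<And>z. z \<in> strip \<Longrightarrow> f z = (z - 1/2) ^ k * h z"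
    using assms(1) by (auto simp: vanishes_def)
  show ?thesis
  proof (rule vanishesI)
    show "(\<lambda>z. (z - 1/2) ^ (k - l) * h z) holomorphic_on strip"
      by (intro holomorphic_intros h)
    fix z assume "z \<in> strip"
    then show "f z = (z - 1/2) ^ l * ((z - 1/2) ^ (k - l) * h z)"
      using h(2) assms(2) by (simp flip: power_add mult.assoc)
  qed
qed

lemma vanishes_ident: "vanishes 1 (\<lambda>z. z - 1/2)"
  by (rule vanishesI[of "\<lambda>z. 1"]) auto

lemma vanishes_1I:
  assumes "f holomorphic_on strip" "f (1/2) = 0"
  shows "vanishes 1 f"
proof (rule vanishesI)
  show "(\<lambda>z. if z = 1/2 then deriv f (1/2) else (f z - f (1/2)) / (z - 1/2)) holomorphic_on strip"
    by (rule pole_lemma_open[OF assms(1) open_strip])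
  show "f z = (z - 1/2) ^ 1 *
      (if z = 1/2 then deriv f (1/2) else (f z - f (1/2)) / (z - 1/2))" for z
  proof (cases "z = 1/2")
    case True
    show ?thesis unfolding True using assms(2) by simp
  qed (use assms(2) in simp)
qed

text \<open>
  By the Leibniz rule, since \<open>(z - 1/2)\<^sup>k\<close> has no nonzero derivative of order less than \<open>k\<close> at \<open>1/2\<close>.
  With the next lemma, this makes divisibility by \<open>(z - 1/2)\<^sup>k\<close> the same as the vanishing of the Taylor
  coefficients that define \<open>Z\<^sup>(\<^sup>k\<^sup>)\<close>.
\<close>

lemma vanishes_higher_deriv:
  assumes "vanishes k f" and "i < k"
  shows "(deriv ^^ i) f (1/2) = 0"
proof -
  obtain h where h: "h holomorphic_on strip" "\<And>z. z \<in> strip \<Longrightarrow> f z = (z - 1/2) ^ k * h z"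
    using assms(1) by (auto simp: vanishes_def)
  have "(deriv ^^ i) f (1/2) = (deriv ^^ i) (\<lambda>z. (z - 1/2) ^ k * h z) (1/2)"
  proof (rule higher_deriv_cong_ev)
    show "\<forall>\<^sub>F x in nhds (1/2). f x = (x - 1/2) ^ k * h x"
      using open_strip half_in_strip h(2) by (auto simp: eventually_nhds)
  qed simp
  also have "\<dots> = (\<Sum>j=0..i. of_nat (i choose j) * (deriv ^^ j) (\<lambda>z. (z - 1/2) ^ k) (1/2)
                       * (deriv ^^ (i - j)) h (1/2))"
    by (rule higher_deriv_mult[OF _ h(1) open_strip half_in_strip]) (intro holomorphic_intros)
  also have "\<dots> = 0"
    using assms(2) by (intro sum.neutral) (auto simp: higher_deriv_power)
  finally show ?thesis .
qed

lemma higher_deriv_vanishes: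
  assumes "f holomorphic_on strip" "\<And>i. i < k \<Longrightarrow> (deriv ^^ i) f (1/2) = 0"
  shows "vanishes k f"
  using assms(2)
proof (induction k)
  case 0
  then show ?case using assms(1) by (simp add: vanishes_0_iff)
next
  case (Suc k)
  then have "vanishes k f" by simp
  then obtain h where h: "h holomorphic_on strip" "\<And>z. z \<in> strip \<Longrightarrow> f z = (z - 1/2) ^ k * h z"
    by (auto simp: vanishes_def)
  have "0 = (deriv ^^ k) f (1/2)" using Suc.prems[of k] by simp
  also have "\<dots> = (deriv ^^ k) (\<lambda>z. (z - 1/2) ^ k * h z) (1/2)"
  proof (rule higher_deriv_cong_ev)
    show "\<forall>\<^sub>F x in nhds (1/2). f x = (x - 1/2) ^ k * h x"
      using open_strip half_in_strip h(2) by (auto simp: eventually_nhds)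
  qed simp
  also have "\<dots> = (\<Sum>j=0..k. of_nat (k choose j) * (deriv ^^ j) (\<lambda>z. (z - 1/2) ^ k) (1/2)
                       * (deriv ^^ (k - j)) h (1/2))"
    by (rule higher_deriv_mult[OF _ h(1) open_strip half_in_strip]) (intro holomorphic_intros)
  also have "\<dots> = (\<Sum>j\<in>{k}. of_nat (k choose j) * (deriv ^^ j) (\<lambda>z. (z - 1/2) ^ k) (1/2)
                       * (deriv ^^ (k - j)) h (1/2))"
    by (rule sum.mono_neutral_right) (auto simp: higher_deriv_power)
  also have "\<dots> = pochhammer 1 k * h (1/2)"
    by (simp add: higher_deriv_power)
  finally have "h (1/2) = 0" by (simp add: pochhammer_fact[symmetric])
  then have "vanishes 1 h" using h(1) by (rule vanishes_1I[rotated])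
  moreover have "vanishes k (\<lambda>z. (z - 1/2) ^ k)"
    by (rule vanishesI[of "\<lambda>z. 1"]) auto
  ultimately have "vanishes (k + 1) (\<lambda>z. (z - 1/2) ^ k * h z)"
    by (intro vanishes_mult)
  then show ?case using h(2) by (simp add: vanishes_cong)
qed

text \<open>
  The remainder for \<open>k + 1\<close> has derivative \<open>c\<close> times the remainder for \<open>k\<close>, so its derivatives of
  order less than \<open>k + 1\<close> all reduce to values at \<open>1/2\<close>, which are \<open>0\<close>.
\<close>

lemma vanishes_exp_remainder:
  "vanishes k (\<lambda>z. exp (c * (z - 1/2)) - (\<Sum>j<k. c ^ j / fact j * (z - 1/2) ^ j))"
    (is "vanishes k (?r k)")
proof (rule higher_deriv_vanishes)
  show "?r k holomorphic_on strip" by (intro holomorphic_intros) auto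
  have ders: "deriv (?r (Suc m)) = (\<lambda>z. c * ?r m z)" for m
  proof
    fix z
    have "((\<lambda>z. \<Sum>j<Suc m. c ^ j / fact j * (z - 1/2) ^ j) has_field_derivative
           (\<Sum>j<Suc m. c ^ j / fact j * (of_nat j * (z - 1/2) ^ (j - 1)))) (at z)"
    proof (rule DERIV_sum)
      fix j
      have "((\<lambda>z. (z - 1/2) ^ j) has_field_derivative of_nat j * (z - 1/2) ^ (j - 1)) (at z)"
        by (auto intro!: derivative_eq_intros)
      then show "((\<lambda>z. c ^ j / fact j * (z - 1/2) ^ j) has_field_derivative
           c ^ j / fact j * (of_nat j * (z - 1/2) ^ (j - 1))) (at z)"
        by (rule DERIV_cmult)
    qed
    also have "(\<Sum>j<Suc m. c ^ j / fact j * (of_nat j * (z - 1/2) ^ (j - 1))) =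
        (\<Sum>j<m. c ^ Suc j / fact (Suc j) * (of_nat (Suc j) * (z - 1/2) ^ j))"
      by (subst sum.lessThan_Suc_shift) 
        (simp only: of_nat_0 mult_zero_left mult_zero_right add_0 diff_Suc_1)
    also have "\<dots> = c * (\<Sum>j<m. c ^ j / fact j * (z - 1/2) ^ j)"
      unfolding sum_distrib_left
    proof (rule sum.cong[OF refl])
      fix j
      have "fact (Suc j) = (of_nat (Suc j) * fact j :: complex)" "(of_nat (Suc j) :: complex) \<noteq> 0"
        by (rule fact_Suc, rule of_nat_neq_0)
      then show "c ^ Suc j / fact (Suc j) * (of_nat (Suc j) * (z - 1/2) ^ j) =
            c * (c ^ j / fact j * (z - 1/2) ^ j)"
        by (simp del: of_nat_Suc fact_Suc)
    qed
    finally have "((\<lambda>z. \<Sum>j<Suc m. c ^ j / fact j * (z - 1/2) ^ j) has_field_derivative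
           c * (\<Sum>j<m. c ^ j / fact j * (z - 1/2) ^ j)) (at z)" .
    from DERIV_diff[OF _ this, of "\<lambda>z. exp (c * (z - 1/2))"]
    have "((\<lambda>z. exp (c * (z - 1/2))) has_field_derivative c * exp (c * (z - 1/2))) (at z) \<Longrightarrow>
        (?r (Suc m) has_field_derivative c * ?r m z) (at z)"
      by (simp only: right_diff_distrib)
    moreover have "((\<lambda>z. exp (c * (z - 1/2))) has_field_derivative c * exp (c * (z - 1/2))) (at z)"
      by (auto intro!: derivative_eq_intros)
    ultimately have "(?r (Suc m) has_field_derivative c * ?r m z) (at z)"
      by blast
    then show "deriv (?r (Suc m)) z = c * ?r m z" by (rule DERIV_imp_deriv)
  qed
  show "(deriv ^^ i) (?r k) (1/2) = 0" if "i < k" for i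
    using that
  proof (induction i arbitrary: k)
    case 0
    then obtain m where m: "k = Suc m" by (cases k) auto
    have "(\<Sum>j<k. c ^ j / fact j * (1/2 - 1/2) ^ j) = 1"
      unfolding m by (subst sum.lessThan_Suc_shift) (simp del: sum.lessThan_Suc)
    then show ?case by simp
  next
    case (Suc i)
    then obtain m where m: "k = Suc m" "i < m" by (cases k) auto
    have "(deriv ^^ Suc i) (?r k) (1/2) = (deriv ^^ i) (deriv (?r (Suc m))) (1/2)"
      unfolding m(1) funpow_Suc_right o_apply ..
    also have "\<dots> = (deriv ^^ i) (\<lambda>z. c * ?r m z) (1/2)" by (simp only: ders)
    also have "\<dots> = c * (deriv ^^ i) (?r m) (1/2)"
      by (rule higher_deriv_cmult[where A = UNIV]) (auto intro!: holomorphic_intros)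
    finally show ?case using Suc.IH[OF m(2)] by simp
  qed
qed


section \<open>The Calderon space in coordinates\<close>

definition multiplier :: "(complex \<Rightarrow> complex) \<Rightarrow> real \<Rightarrow> bool" where
  "multiplier b B \<longleftrightarrow> b holomorphic_on strip \<and> continuous_on cstrip b \<and>
     (\<forall>z\<in>cstrip. cmod (b z) \<le> B)"

text \<open>
  Membership in the ball of radius \<open>C\<close> of the Calderon space, written in coordinates.  Bounding
  all finite sums on the right edge expresses the \<open>l\<^sub>1\<close>-norm without questions of summability.
  For bounded families the interior bound follows from those on the edges (\<open>calderonI\<close>); it is included so
  that the closure properties below do not need the maximum principle again.
\<close>

definition calderon :: "(nat \<Rightarrow> complex \<Rightarrow> complex) \<Rightarrow> real \<Rightarrow> bool" where
  "calderon F C \<longleftrightarrow> (\<forall>j. multiplier (F j) C) \<and>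
     (\<forall>t A. finite A \<longrightarrow> (\<Sum>j\<in>A. cmod (F j (1 + \<i> * of_real t))) \<le> C)"

lemma multiplierD:
  assumes "multiplier b B"
  shows "b holomorphic_on strip" "continuous_on cstrip b" "\<And>z. z \<in> cstrip \<Longrightarrow> cmod (b z) \<le> B"
  using assms by (auto simp: multiplier_def)

lemma calderonD:
  assumes "calderon F C"
  shows "multiplier (F j) C" "F j holomorphic_on strip" "continuous_on cstrip (F j)"
    "\<And>z. z \<in> cstrip \<Longrightarrow> cmod (F j z) \<le> C"
    "\<And>A t. finite A \<Longrightarrow> (\<Sum>j\<in>A. cmod (F j (1 + \<i> * of_real t))) \<le> C"
  using assms by (auto simp: calderon_def multiplier_def)

lemma edges_in_cstrip [simp]: "\<i> * of_real t \<in> cstrip" "1 + \<i> * of_real t \<in> cstrip"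
  by (auto simp: cstrip_def)

lemma multiplier_nonneg: "multiplier b B \<Longrightarrow> 0 \<le> B"
  using order_trans[OF norm_ge_zero multiplierD(3)[OF _ half_in_cstrip]] .

lemma calderon_nonneg: "calderon F C \<Longrightarrow> 0 \<le> C"
  using calderonD(1) multiplier_nonneg by blast

lemma calderonI:
  assumes "\<And>j. F j holomorphic_on strip" "\<And>j. continuous_on cstrip (F j)"
    and "\<And>j z. z \<in> cstrip \<Longrightarrow> cmod (F j z) \<le> B"
    and "\<And>j t. cmod (F j (\<i> * of_real t)) \<le> C"
    and right: "\<And>A t. finite A \<Longrightarrow> (\<Sum>j\<in>A. cmod (F j (1 + \<i> * of_real t))) \<le> C"
  shows "calderon F C"
proof -
  have "cmod (F j (1 + \<i> * of_real t)) \<le> C" for j t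
    using right[of "{j}" t] by simp
  then show ?thesis
    using strip_maximum_principle[OF assms(1,2,3,4)] assms(1,2) right
    by (auto simp: calderon_def multiplier_def)
qed

lemma multiplier_mult:
  assumes "multiplier a A" "multiplier b B"
  shows "multiplier (\<lambda>z. a z * b z) (A * B)"
  using multiplierD[OF assms(1)] multiplierD[OF assms(2)] multiplier_nonneg[OF assms(1)]
  by (auto simp: multiplier_def norm_mult intro!: holomorphic_intros continuous_intros mult_mono)

lemma multiplier_const: "multiplier (\<lambda>z. c) (cmod c)"
  by (auto simp: multiplier_def)

lemma multiplier_power: "multiplier a A \<Longrightarrow> multiplier (\<lambda>z. a z ^ n) (A ^ n)"
  by (induction n) (use multiplier_const[of 1] in \<open>auto intro: multiplier_mult\<close>)

lemma calderon_mono: "calderon F C \<Longrightarrow> C \<le> D \<Longrightarrow> calderon F D"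
  unfolding calderon_def multiplier_def by (meson order_trans)

lemma calderon_add:
  assumes "calderon F C" "calderon G D"
  shows "calderon (\<lambda>j z. F j z + G j z) (C + D)"
  unfolding calderon_def multiplier_def
proof (intro conjI allI ballI impI)
  note F = calderonD[OF assms(1)] and G = calderonD[OF assms(2)]
  fix j show "(\<lambda>z. F j z + G j z) holomorphic_on strip" by (intro holomorphic_intros F G)
  show "continuous_on cstrip (\<lambda>z. F j z + G j z)" by (intro continuous_intros F G)
  show "cmod (F j z + G j z) \<le> C + D" if "z \<in> cstrip" for z
    using F(4)[OF that] G(4)[OF that] norm_triangle_le add_mono by metis
  fix t and A :: "nat set" assume "finite A"
  have "(\<Sum>j\<in>A. cmod (F j (1 + \<i> * of_real t) + G j (1 + \<i> * of_real t)))
      \<le> (\<Sum>j\<in>A. cmod (F j (1 + \<i> * of_real t)) + cmod (G j (1 + \<i> * of_real t)))"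
    by (intro sum_mono norm_triangle_ineq)
  also have "\<dots> \<le> C + D" using F(5) G(5) \<open>finite A\<close> by (simp add: sum.distrib add_mono)
  finally show "(\<Sum>j\<in>A. cmod (F j (1 + \<i> * of_real t) + G j (1 + \<i> * of_real t))) \<le> C + D" .
qed

lemma calderon_mult:
  assumes "multiplier b B" "calderon F C"
  shows "calderon (\<lambda>j z. b z * F j z) (B * C)"
  unfolding calderon_def
proof (intro conjI allI impI)
  show "multiplier (\<lambda>z. b z * F j z) (B * C)" for j
    by (rule multiplier_mult[OF assms(1) calderonD(1)[OF assms(2)]])
  fix t and A :: "nat set" assume A: "finite A"
  have "(\<Sum>j\<in>A. cmod (b (1 + \<i> * of_real t) * F j (1 + \<i> * of_real t)))
      = cmod (b (1 + \<i> * of_real t)) * (\<Sum>j\<in>A. cmod (F j (1 + \<i> * of_real t)))"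
    by (simp add: norm_mult sum_distrib_left)
  also have "\<dots> \<le> B * C"
    using multiplierD(3)[OF assms(1)] calderonD(5)[OF assms(2) A] multiplier_nonneg[OF assms(1)]
    by (intro mult_mono sum_nonneg) auto
  finally show "(\<Sum>j\<in>A. cmod (b (1 + \<i> * of_real t) * F j (1 + \<i> * of_real t))) \<le> B * C" .
qed

lemma calderon_cmult: "calderon F C \<Longrightarrow> calderon (\<lambda>j z. c * F j z) (cmod c * C)"
  by (rule calderon_mult[OF multiplier_const])

lemma calderon_zero [simp]: "calderon (\<lambda>j z. 0) 0"
  by (auto simp: calderon_def multiplier_def)

lemma calderon_diff:
  assumes "calderon F C" "calderon G D"
  shows "calderon (\<lambda>j z. F j z - G j z) (C + D)"
  using calderon_add[OF assms(1) calderon_cmult[OF assms(2), of "-1"]] by simp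

lemma calderon_sum:
  assumes "\<And>i. i \<in> E \<Longrightarrow> calderon (F i) (C i)"
  shows "calderon (\<lambda>j z. \<Sum>i\<in>E. F i j z) (\<Sum>i\<in>E. C i)"
  using assms by (induction E rule: infinite_finite_induct) (auto intro: calderon_add)

definition restr :: "nat set \<Rightarrow> (nat \<Rightarrow> complex \<Rightarrow> complex) \<Rightarrow> nat \<Rightarrow> complex \<Rightarrow> complex" where
  "restr A F j z = (if j \<in> A then F j z else 0)"

lemma restr_in: "j \<in> A \<Longrightarrow> restr A F j = F j"
  and restr_out: "j \<notin> A \<Longrightarrow> restr A F j = (\<lambda>z. 0)"
  by (auto simp: restr_def)

lemma calderon_restr:
  assumes "calderon F C" shows "calderon (restr A F) C"
  unfolding calderon_def
proof (intro conjI allI impI)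
  note F = calderonD[OF assms] and C = calderon_nonneg[OF assms]
  show "multiplier (restr A F j) C" for j
    using F(1) C by (cases "j \<in> A") (auto simp: restr_in restr_out multiplier_def)
  fix t and B :: "nat set" assume "finite B"
  have "(\<Sum>j\<in>B. cmod (restr A F j (1 + \<i> * of_real t))) \<le> (\<Sum>j\<in>B. cmod (F j (1 + \<i> * of_real t)))"
    by (intro sum_mono) (simp add: restr_def)
  also have "\<dots> \<le> C" by (rule F(5)[OF \<open>finite B\<close>])
  finally show "(\<Sum>j\<in>B. cmod (restr A F j (1 + \<i> * of_real t))) \<le> C" .
qed

definition unit_at :: "nat \<Rightarrow> (complex \<Rightarrow> complex) \<Rightarrow> nat \<Rightarrow> complex \<Rightarrow> complex" where
  "unit_at m f j z = (if j = m then f z else 0)"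

lemma calderon_unit_at:
  assumes "multiplier f C" shows "calderon (unit_at m f) C"
  unfolding calderon_def
proof (intro conjI allI impI)
  have C: "0 \<le> C" by (rule multiplier_nonneg[OF assms])
  show "multiplier (unit_at m f j) C" for j
    using assms C by (cases "j = m") (auto simp: unit_at_def[abs_def] multiplier_def)
  fix t and A :: "nat set" assume "finite A"
  have "(\<Sum>j\<in>A. cmod (unit_at m f j (1 + \<i> * of_real t)))
      = (if m \<in> A then cmod (f (1 + \<i> * of_real t)) else 0)"
    using \<open>finite A\<close> by (simp add: unit_at_def if_distrib[of cmod] sum.delta cong: if_cong)
  also have "\<dots> \<le> C" using multiplierD(3)[OF assms] C by auto
  finally show "(\<Sum>j\<in>A. cmod (unit_at m f j (1 + \<i> * of_real t))) \<le> C" .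
qed

definition congruent_mod :: "nat \<Rightarrow> (nat \<Rightarrow> complex \<Rightarrow> complex) \<Rightarrow> (nat \<Rightarrow> complex \<Rightarrow> complex) \<Rightarrow> bool" where
  "congruent_mod k F G \<longleftrightarrow> (\<forall>j. vanishes k (\<lambda>z. F j z - G j z))"


section \<open>The pairing of a point with its reflection\<close>

lemma reflect_cstrip: "z \<in> cstrip \<Longrightarrow> 1 - z \<in> cstrip"
  and reflect_strip: "z \<in> strip \<Longrightarrow> 1 - z \<in> strip"
  by (auto simp: cstrip_def strip_def)

text \<open>
  The reflection \<open>z \<mapsto> 1 - z\<close> exchanges the two edges.  On each of them one factor is
  bounded in \<open>l\<^sub>\<infinity>\<close> and the other in \<open>l\<^sub>1\<close>, so the maximum principle bounds the sum by \<open>C * D\<close>,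
  independently of the number of coordinates.  This underlies the self-duality of the spaces \<open>Z\<^sup>(\<^sup>n\<^sup>)\<close>.
\<close>

lemma multiplier_pairing:
  assumes F: "calderon F C" and G: "calderon G D" and A: "finite A"
  shows "multiplier (\<lambda>z. \<Sum>j\<in>A. F j z * G j (1 - z)) (C * D)"
proof -
  note F' = calderonD[OF F] and G' = calderonD[OF G]
  have G_hol: "(\<lambda>z. G j (1 - z)) holomorphic_on strip" for j
  proof -
    have "(G j \<circ> (\<lambda>z. 1 - z)) holomorphic_on strip"
      by (rule holomorphic_on_compose_gen[OF _ G'(2)])
         (intro holomorphic_intros, use reflect_strip in blast)
    then show ?thesis by (simp add: o_def)
  qed
  have G_cont: "continuous_on cstrip (\<lambda>z. G j (1 - z))" for j
    by (rule continuous_on_compose2[OF G'(3)]) (auto intro!: continuous_intros reflect_cstrip)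
  have hol: "(\<lambda>z. \<Sum>j\<in>A. F j z * G j (1 - z)) holomorphic_on strip"
    by (intro holomorphic_intros F' G_hol)
  have cont: "continuous_on cstrip (\<lambda>z. \<Sum>j\<in>A. F j z * G j (1 - z))"
    by (intro continuous_intros F' G_cont)
  have prod_bound: "cmod (F j z * G j (1 - z)) \<le> C * D" if "z \<in> cstrip" for j z
    using F'(4)[OF that] G'(4)[OF reflect_cstrip[OF that]] calderon_nonneg[OF F]
    unfolding norm_mult by (intro mult_mono) auto
  have "cmod (\<Sum>j\<in>A. F j z * G j (1 - z)) \<le> C * D" if z: "z \<in> cstrip" for z
  proof (rule strip_maximum_principle[OF hol cont _ _ _ z])
    show "cmod (\<Sum>j\<in>A. F j z * G j (1 - z)) \<le> real (card A) * (C * D)" if "z \<in> cstrip" for z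
      by (rule sum_norm_bound[OF prod_bound[OF that]])
    fix t
    have e: "1 - \<i> * of_real t = 1 + \<i> * of_real (-t)"
            "1 - (1 + \<i> * of_real t) = \<i> * of_real (-t)" by simp_all
    have "cmod (\<Sum>j\<in>A. F j (\<i> * of_real t) * G j (1 - \<i> * of_real t))
        \<le> (\<Sum>j\<in>A. C * cmod (G j (1 + \<i> * of_real (-t))))"
      unfolding e
      by (intro order_trans[OF norm_sum] sum_mono)
         (auto simp: norm_mult intro!: mult_right_mono F'(4) simp del: of_real_minus)
    also have "\<dots> \<le> C * D"
      unfolding sum_distrib_left[symmetric]
      by (intro mult_left_mono G'(5) A calderon_nonneg[OF F])
    finally show "cmod (\<Sum>j\<in>A. F j (\<i> * of_real t) * G j (1 - \<i> * of_real t)) \<le> C * D" .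
    have "cmod (\<Sum>j\<in>A. F j (1 + \<i> * of_real t) * G j (1 - (1 + \<i> * of_real t)))
        \<le> (\<Sum>j\<in>A. cmod (F j (1 + \<i> * of_real t)) * D)"
      unfolding e
      by (intro order_trans[OF norm_sum] sum_mono)
         (auto simp: norm_mult intro!: mult_left_mono G'(4) simp del: of_real_minus)
    also have "\<dots> \<le> C * D"
      unfolding sum_distrib_right[symmetric]
      by (intro mult_right_mono F'(5) A calderon_nonneg[OF G])
    finally show "cmod (\<Sum>j\<in>A. F j (1 + \<i> * of_real t) * G j (1 - (1 + \<i> * of_real t))) \<le> C * D" .
  qed
  then show ?thesis using hol cont by (simp add: multiplier_def)
qed

text \<open>
  The first Taylor coefficient of the pairing at \<open>1/2\<close>; the sign comes from \<open>1 - z\<close>.  It is the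
  symplectic form of the Kalton--Peck space.
\<close>

lemma pairing_deriv_bound:
  assumes F: "calderon F C" and G: "calderon G D" and A: "finite A"
  shows "cmod (\<Sum>j\<in>A. deriv (F j) (1/2) * G j (1/2) - F j (1/2) * deriv (G j) (1/2)) \<le> 2 * (C * D)"
proof -
  have dF: "(F j has_field_derivative deriv (F j) (1/2)) (at (1/2))" for j
    by (rule holomorphic_derivI[OF calderonD(2)[OF F] open_strip half_in_strip])
  have dG: "(G j has_field_derivative deriv (G j) (1/2)) (at (1 - 1/2))" for j
    using holomorphic_derivI[OF calderonD(2)[OF G] open_strip half_in_strip] by simp
  have dG': "((\<lambda>z. G j (1 - z)) has_field_derivative deriv (G j) (1/2) * (-1)) (at (1/2))" for j
    by (rule DERIV_chain2[where f = "G j" and g = "\<lambda>z. 1 - z", OF dG])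
       (auto intro!: derivative_eq_intros)
  have "((\<lambda>z. \<Sum>j\<in>A. F j z * G j (1 - z)) has_field_derivative
     (\<Sum>j\<in>A. deriv (F j) (1/2) * G j (1 - 1/2) + deriv (G j) (1/2) * (-1) * F j (1/2))) (at (1/2))"
    by (intro DERIV_sum DERIV_mult dF dG')
  then have "deriv (\<lambda>z. \<Sum>j\<in>A. F j z * G j (1 - z)) (1/2)
     = (\<Sum>j\<in>A. deriv (F j) (1/2) * G j (1 - 1/2) + deriv (G j) (1/2) * (-1) * F j (1/2))"
    by (rule DERIV_imp_deriv)
  also have "\<dots> = (\<Sum>j\<in>A. deriv (F j) (1/2) * G j (1/2) - F j (1/2) * deriv (G j) (1/2))"
    by (intro sum.cong) auto
  finally show ?thesis
    using deriv_bound_half[OF multiplierD[OF multiplier_pairing[OF assms]]] by simp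
qed


section \<open>Extremal families and the value at the base point\<close>

text \<open>
  Calderon's extremal function \<open>u\<^sub>j (|u\<^sub>j| / c)\<^bsup>2z-1\<^esup>\<close> for the couple \<open>(l\<^sub>\<infinity>, l\<^sub>1)\<close>.  The scale \<open>c\<close> is
  only required to dominate the \<open>l\<^sub>2\<close>-norm of \<open>u\<close>, so that it can be chosen positive when \<open>u = 0\<close>.
\<close>

definition extremal :: "real \<Rightarrow> (nat \<Rightarrow> complex) \<Rightarrow> nat \<Rightarrow> complex \<Rightarrow> complex" where
  "extremal c u j z = (if u j = 0 then 0 else u j * exp (of_real (ln (cmod (u j) / c)) * (2 * z - 1)))"

lemma extremal_half [simp]: "extremal c u j (1/2) = u j"
  by (simp add: extremal_def)

lemma extremal_eq_0: "u j = 0 \<Longrightarrow> extremal c u j = (\<lambda>z. 0)"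
  by (auto simp: extremal_def)

lemma cmod_extremal:
  assumes "c > 0"
  shows "cmod (extremal c u j z) = cmod (u j) * (cmod (u j) / c) powr (2 * Re z - 1)"
  using assms by (auto simp: extremal_def norm_mult powr_def)

lemma cmod_extremal_right:
  "c > 0 \<Longrightarrow> cmod (extremal c u j (1 + \<i> * of_real t)) = (cmod (u j))\<^sup>2 / c"
  by (simp add: cmod_extremal power2_eq_square)

text \<open>
  The modulus is \<open>c\<close> on the left edge wherever \<open>u j \<noteq> 0\<close>, and \<open>|u j|\<^sup>2 / c\<close> on the right edge, where
  the sum is at most \<open>c\<close>.
\<close>

lemma calderon_extremal:
  assumes c: "c > 0" and u: "\<And>A. finite A \<Longrightarrow> (\<Sum>j\<in>A. (cmod (u j))\<^sup>2) \<le> c\<^sup>2"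
  shows "calderon (extremal c u) c"
proof (rule calderonI)
  have le: "cmod (u j) \<le> c" for j
    using u[of "{j}"] c by (simp add: power_mono_iff)
  show "extremal c u j holomorphic_on strip" for j
    unfolding extremal_def[abs_def] by (cases "u j = 0") (auto intro!: holomorphic_intros)
  show "continuous_on cstrip (extremal c u j)" for j
    unfolding extremal_def[abs_def] by (cases "u j = 0") (auto intro!: continuous_intros)
  show "cmod (extremal c u j z) \<le> c" if "z \<in> cstrip" for j z
  proof (cases "u j = 0")
    case True
    then show ?thesis using c by (simp add: extremal_eq_0)
  next
    case False
    then have "(cmod (u j) / c) powr (2 * Re z - 1) \<le> (cmod (u j) / c) powr (-1)"
      using that le[of j] c by (intro powr_mono') (auto simp: cstrip_def)
    then have "cmod (extremal c u j z) \<le> cmod (u j) * (cmod (u j) / c) powr (-1)"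
      unfolding cmod_extremal[OF c] by (intro mult_left_mono) auto
    also have "\<dots> = c" using False c by (simp add: powr_minus abs_of_pos[OF c])
    finally show ?thesis .
  qed
  then show "cmod (extremal c u j (\<i> * of_real t)) \<le> c" for j t by simp
  fix A :: "nat set" and t assume "finite A"
  have "(\<Sum>j\<in>A. cmod (extremal c u j (1 + \<i> * of_real t))) = (\<Sum>j\<in>A. (cmod (u j))\<^sup>2) / c"
    by (simp add: cmod_extremal_right[OF c] sum_divide_distrib)
  also have "\<dots> \<le> c\<^sup>2 / c" using c u[OF \<open>finite A\<close>] by (intro divide_right_mono) auto
  also have "\<dots> = c" using c by (simp add: power2_eq_square)
  finally show "(\<Sum>j\<in>A. cmod (extremal c u j (1 + \<i> * of_real t))) \<le> c" .
qed

text \<open>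
  The interpolation space at \<open>1/2\<close> embeds in \<open>l\<^sub>2\<close> with norm one: pair the family with the extremal
  family of the conjugate of its value, cut down to \<open>A\<close>.
\<close>

lemma calderon_value_l2:
  assumes F: "calderon F C" and A: "finite A"
  shows "(\<Sum>j\<in>A. (cmod (F j (1/2)))\<^sup>2) \<le> C\<^sup>2"
proof -
  define s where "s = sqrt (\<Sum>j\<in>A. (cmod (F j (1/2)))\<^sup>2)"
  have s0: "0 \<le> s" by (simp add: s_def sum_nonneg)
  have s2: "s\<^sup>2 = (\<Sum>j\<in>A. (cmod (F j (1/2)))\<^sup>2)" by (simp add: s_def sum_nonneg)
  have "s \<le> C"
  proof (cases "s = 0")
    case True
    then show ?thesis using calderon_nonneg[OF F] by simp
  next
    case False
    then have pos: "s > 0" using s0 by simp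
    define u where "u j = (if j \<in> A then cnj (F j (1/2)) else 0)" for j
    have "calderon (extremal s u) s"
    proof (rule calderon_extremal[OF pos])
      fix B :: "nat set" assume "finite B"
      have "(\<Sum>j\<in>B. (cmod (u j))\<^sup>2) = (\<Sum>j\<in>B \<inter> A. (cmod (F j (1/2)))\<^sup>2)"
        using \<open>finite B\<close> by (intro sum.mono_neutral_cong_right) (auto simp: u_def)
      also have "\<dots> \<le> s\<^sup>2" unfolding s2 using A by (intro sum_mono2) auto
      finally show "(\<Sum>j\<in>B. (cmod (u j))\<^sup>2) \<le> s\<^sup>2" .
    qed
    from multiplierD(3)[OF multiplier_pairing[OF F this A] half_in_cstrip]
    have "cmod (\<Sum>j\<in>A. F j (1/2) * u j) \<le> C * s" by simp
    also have "(\<Sum>j\<in>A. F j (1/2) * u j) = of_real (s\<^sup>2)"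
      unfolding s2 of_real_sum by (intro sum.cong) (auto simp: u_def complex_norm_square simp flip: of_real_power)
    finally show ?thesis using pos by (simp add: power2_eq_square norm_mult)
  qed
  then show ?thesis using s0 s2 by (metis power_mono)
qed


section \<open>Division and a bounded local coordinate\<close>

text \<open>
  The point \<open>1/2\<close> has distance \<open>1/2\<close> from both edges, so the quotient at most doubles there; near
  the removable singularity a crude bound suffices for the maximum principle.
\<close>

lemma calderon_divide:
  assumes F: "calderon F C" and zero: "\<And>j. F j (1/2) = 0"
  obtains G where "calderon G (2 * C)" "\<And>j z. z \<in> cstrip \<Longrightarrow> F j z = (z - 1/2) * G j z"
proof
  define G where "G j z = (if z = 1/2 then deriv (F j) (1/2) else F j z / (z - 1/2))" for j z
  note F' = calderonD[OF F]
  have hol: "G j holomorphic_on strip" for j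
    using pole_lemma_open[OF F'(2)[of j] open_strip, of "1/2"] unfolding G_def[abs_def] zero diff_0_right .
  have eq: "F j z = (z - 1/2) * G j z" for j z
  proof (cases "z = 1/2")
    case True
    show ?thesis unfolding True using zero by simp
  qed (simp add: G_def)
  have cont: "continuous_on cstrip (G j)" for j
  proof -
    have a: "continuous_on (cstrip - {1/2}) (G j)"
    proof (rule continuous_on_eq)
      show "continuous_on (cstrip - {1/2}) (\<lambda>z. F j z / (z - 1/2))"
        by (intro continuous_intros continuous_on_subset[OF F'(3)]) auto
    qed (auto simp: G_def)
    have b: "continuous_on strip (G j)" by (rule holomorphic_on_imp_continuous_on[OF hol])
    show ?thesis
      unfolding continuous_on_eq_continuous_within
    proof
      fix z assume z: "z \<in> cstrip"
      show "continuous (at z within cstrip) (G j)"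
      proof (cases "z = 1/2")
        case True
        then have "isCont (G j) z" using b open_strip half_in_strip continuous_on_eq_continuous_at by metis
        then show ?thesis by (rule continuous_at_imp_continuous_within)
      next
        case False
        then have "continuous (at z within cstrip - {1/2}) (G j)"
          using a z by (auto simp: continuous_on_eq_continuous_within)
        moreover have "at z within cstrip = at z within (cstrip - {1/2})"
          by (rule at_within_nhd[of z "- {1/2}"]) (use False in auto)
        ultimately show ?thesis by simp
      qed
    qed
  qed
  have C0: "0 \<le> C" by (rule calderon_nonneg[OF F])
  have off: "cmod (G j z) \<le> C / r" if "z \<in> cstrip" "cmod (z - 1/2) \<ge> r" "r > 0" for j z r
  proof -
    have "cmod (G j z) * cmod (z - 1/2) \<le> C"
      using F'(4)[OF that(1), of j] unfolding eq norm_mult by (simp add: mult.commute)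
    moreover have "cmod (G j z) * r \<le> cmod (G j z) * cmod (z - 1/2)"
      using that by (intro mult_left_mono) auto
    ultimately show ?thesis using that(3) by (simp add: pos_le_divide_eq)
  qed
  show "calderon G (2 * C)"
  proof (rule calderonI[OF hol cont])
    show "cmod (G j z) \<le> 4 * C" if z: "z \<in> cstrip" for j z
    proof (cases "cmod (z - 1/2) \<ge> 1/4")
      case True
      then show ?thesis using off[OF z, of "1/4" j] by simp
    next
      case False
      have sub: "cball (1/2) (1/4) \<subseteq> strip"
        using ball_half_subset_strip by (auto simp: subset_iff dist_norm)
      show ?thesis
      proof (rule maximum_modulus_frontier[of "G j" "cball (1/2) (1/4)"])
        show "G j holomorphic_on interior (cball (1/2) (1/4))"
          using sub interior_subset by (intro holomorphic_on_subset[OF hol]) blast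
        show "continuous_on (closure (cball (1/2) (1/4))) (G j)"
          using sub strip_subset_cstrip by (intro continuous_on_subset[OF cont]) auto
        show "z \<in> cball (1/2) (1/4)" using False by (simp add: dist_norm norm_minus_commute)
        fix y :: complex assume "y \<in> frontier (cball (1/2) (1/4))"
        then have y: "cmod (y - 1/2) = 1/4" by (simp add: dist_norm norm_minus_commute)
        then have "y \<in> cball (1/2) (1/4)" by (simp add: dist_norm norm_minus_commute)
        then have "y \<in> cstrip" using sub strip_subset_cstrip by blast
        then show "cmod (G j y) \<le> 4 * C" using off[of y "1/4" j] y by simp
      qed simp
    qed
    have edge: "1/2 \<le> cmod (z - 1/2)" if "Re z = 0 \<or> Re z = 1" for z
      using abs_Re_le_cmod[of "z - 1/2"] that by auto
    show "cmod (G j (\<i> * of_real t)) \<le> 2 * C" for j t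
      using off[of "\<i> * of_real t" "1/2" j] edge[of "\<i> * of_real t"] by simp
    fix A :: "nat set" and t assume A: "finite A"
    define z where "z = 1 + \<i> * of_real t"
    have z: "z \<in> cstrip" "1/2 \<le> cmod (z - 1/2)" using edge[of z] by (simp_all add: z_def)
    have "(\<Sum>j\<in>A. cmod (G j z)) \<le> (\<Sum>j\<in>A. 2 * cmod (F j z))"
    proof (rule sum_mono)
      fix j
      have "1/2 * cmod (G j z) \<le> cmod (z - 1/2) * cmod (G j z)"
        by (intro mult_right_mono z) auto
      then show "cmod (G j z) \<le> 2 * cmod (F j z)" unfolding eq norm_mult by simp
    qed
    also have "\<dots> \<le> 2 * C" unfolding sum_distrib_left[symmetric] z_def using F'(5)[OF A] by simp
    finally show "(\<Sum>j\<in>A. cmod (G j (1 + \<i> * of_real t))) \<le> 2 * C" by (simp add: z_def)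
  qed
  show "F j z = (z - 1/2) * G j z" for j z by (rule eq)
qed

text \<open>
  The function \<open>z - 1/2\<close> is unbounded on the strip and so does not multiply the Calderon space into
  itself.  This function is bounded and has the same Taylor expansion at \<open>1/2\<close> up to order \<open>k\<close>:
  the Cayley quotient \<open>(z - 1/2) / (z + 1/2)\<close> has a simple zero at \<open>1/2\<close> and tends to \<open>1\<close> at infinity
  fast enough for the product to remain bounded.
\<close>

definition local_coord :: "nat \<Rightarrow> complex \<Rightarrow> complex" where
  "local_coord k z = (z - 1/2) * (1 - ((z - 1/2) / (z + 1/2)) ^ k)"

lemma plus_half_nonzero: "z \<in> cstrip \<Longrightarrow> z + 1/2 \<noteq> 0"
  by (auto simp: cstrip_def complex_eq_iff)

lemma cayley_le_1:
  assumes "z \<in> cstrip" shows "cmod ((z - 1/2) / (z + 1/2)) \<le> 1"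
proof -
  have "(cmod (z - 1/2))\<^sup>2 \<le> (cmod (z + 1/2))\<^sup>2"
    unfolding cmod_power2 using assms by (simp add: cstrip_def power2_eq_square algebra_simps)
  then have "cmod (z - 1/2) \<le> cmod (z + 1/2)" by (simp add: power_mono_iff)
  then show ?thesis
    using plus_half_nonzero[OF assms] by (simp add: norm_divide)
qed

text \<open>
  With \<open>p\<close> the Cayley quotient, \<open>(z - 1/2) * (1 - p) = p\<close>, and the rest of \<open>1 - p\<^sup>k\<close> is a
  geometric sum.  All terms have modulus at most \<open>1\<close>.
\<close>

lemma local_coord_eq:
  assumes "z \<in> cstrip"
  shows "local_coord k z = ((z - 1/2) / (z + 1/2)) * (\<Sum>i<k. ((z - 1/2) / (z + 1/2)) ^ i)"
proof -
  define p where "p = (z - 1/2) / (z + 1/2)"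
  have "(z - 1/2) * (1 - p) = p"
  proof -
    define y where "y = z + 1/2"
    have y: "y \<noteq> 0" "z - 1/2 = y - 1"
      using plus_half_nonzero[OF assms] by (auto simp: y_def)
    then show ?thesis unfolding p_def y_def[symmetric] y(2) by (simp add: field_simps)
  qed
  then show ?thesis
    unfolding local_coord_def p_def[symmetric] one_diff_power_eq by (simp flip: mult.assoc)
qed

lemma multiplier_local_coord: "multiplier (local_coord k) (real k)"
  unfolding multiplier_def
proof (intro conjI ballI)
  have nz: "z + 1/2 \<noteq> 0" if "z \<in> strip" for z
    using that plus_half_nonzero strip_subset_cstrip by blast
  show "local_coord k holomorphic_on strip"
    unfolding local_coord_def[abs_def] by (intro holomorphic_intros) (rule nz)
  show "continuous_on cstrip (local_coord k)"
    unfolding local_coord_def[abs_def]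
    by (intro continuous_intros) (use plus_half_nonzero in blast)
  fix z assume z: "z \<in> cstrip"
  define p where "p = (z - 1/2) / (z + 1/2)"
  have p: "cmod p \<le> 1" unfolding p_def by (rule cayley_le_1[OF z])
  have "cmod (\<Sum>i<k. p ^ i) \<le> real (card {..<k}) * 1"
    by (rule sum_norm_bound) (use p in \<open>auto simp: norm_power power_le_one\<close>)
  then have "cmod p * cmod (\<Sum>i<k. p ^ i) \<le> 1 * real k"
    using p by (intro mult_mono) auto
  then show "cmod (local_coord k z) \<le> real k"
    unfolding local_coord_eq[OF z] p_def[symmetric] by (simp add: norm_mult)
qed

lemma vanishes_local_coord_diff: "vanishes (Suc k) (\<lambda>z. (z - 1/2) - local_coord k z)"
proof (rule vanishesI)
  have nz: "z + 1/2 \<noteq> 0" if "z \<in> strip" for z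
    using that plus_half_nonzero strip_subset_cstrip by blast
  show "(\<lambda>z. 1 / (z + 1/2) ^ k) holomorphic_on strip"
    by (intro holomorphic_intros) (use nz in auto)
  show "(z - 1/2) - local_coord k z = (z - 1/2) ^ Suc k * (1 / (z + 1/2) ^ k)" if "z \<in> strip" for z
    by (simp add: local_coord_def right_diff_distrib power_divide)
qed

lemma vanishes_local_coord: "vanishes 1 (local_coord k)"
  using vanishes_diff[OF vanishes_ident vanishes_mono[OF vanishes_local_coord_diff[of k], of 1]]
  by simp


section \<open>Approximation by finitely supported tuples\<close>

lemma l2_tail:
  fixes f :: "nat \<Rightarrow> real"
  assumes nonneg: "\<And>j. 0 \<le> f j" and bdd: "\<And>A. finite A \<Longrightarrow> sum f A \<le> B" and "\<delta> > 0"
  obtains M where "\<And>A. finite A \<Longrightarrow> A \<subseteq> {M..} \<Longrightarrow> sum f A \<le> \<delta>"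
proof -
  have "summable f" by (rule summableI_nonneg_bounded[of _ B]) (use nonneg bdd in auto)
  then obtain M where M: "\<And>m n. m \<ge> M \<Longrightarrow> norm (sum f {m..<n}) < \<delta>"
    using \<open>\<delta> > 0\<close> unfolding summable_Cauchy by blast
  have "sum f A \<le> \<delta>" if A: "finite A" "A \<subseteq> {M..}" for A
  proof -
    have "A \<subseteq> {M..<Suc (Max A)}" using A by (auto simp: less_Suc_eq_le)
    then have "sum f A \<le> sum f {M..<Suc (Max A)}" using nonneg by (intro sum_mono2) auto
    also have "norm (sum f {M..<Suc (Max A)}) < \<delta>" by (rule M) simp
    then have "sum f {M..<Suc (Max A)} \<le> \<delta>" unfolding real_norm_def by linarith
    finally show ?thesis .
  qed
  then show ?thesis by (rule that)
qed

text \<open>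
  A multiplier that is indistinguishable from \<open>1\<close> at the base point to order \<open>k\<close> and yet small on
  the left edge, at the price of a large bound \<open>B\<close> elsewhere.  It is \<open>1 - (1 - a)\<^sup>k\<close> for the function
  \<open>a = \<eta>\<^bsup>1-2z\<^esup>\<close>, which has modulus \<open>\<eta>\<close> on the left edge and takes the value \<open>1\<close> at \<open>1/2\<close>.
\<close>

lemma vanishing_flattener:
  assumes "0 < \<eta>" "\<eta> \<le> 1"
  obtains b B where "multiplier b B" "vanishes k (\<lambda>z. 1 - b z)"
    "\<And>t. cmod (b (\<i> * of_real t)) \<le> \<eta> * (real k * 2 ^ k)"
proof
  define a :: "complex \<Rightarrow> complex" where "a z = exp (of_real (- ln \<eta>) * (2 * (z - 1/2)))" for z
  define b where "b z = 1 - (1 - a z) ^ k" for z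
  \<comment> \<open>On the closed strip \<open>a\<close> has modulus at most \<open>1 / \<eta>\<close>.\<close>
  define B where "B = 1 + (1 + 1 / \<eta>) ^ k"
  have ca: "cmod (a z) = \<eta> powr (1 - 2 * Re z)" for z
    using assms by (simp add: a_def powr_def algebra_simps)
  have a_le: "cmod (a z) \<le> 1 / \<eta>" if "z \<in> cstrip" for z
  proof -
    have "\<eta> powr (1 - 2 * Re z) \<le> \<eta> powr (-1)"
      using that assms by (intro powr_mono') (auto simp: cstrip_def)
    then show ?thesis using assms by (simp add: ca powr_minus divide_inverse)
  qed
  show "multiplier b B"
    unfolding multiplier_def
  proof (intro conjI ballI)
    show "b holomorphic_on strip" unfolding b_def[abs_def] a_def by (intro holomorphic_intros)
    show "continuous_on cstrip b" unfolding b_def[abs_def] a_def by (intro continuous_intros)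
    fix z assume "z \<in> cstrip"
    then have "cmod (1 - a z) \<le> 1 + 1 / \<eta>"
      using norm_triangle_ineq4[of 1 "a z"] a_le[of z] by simp
    then have "cmod ((1 - a z) ^ k) \<le> (1 + 1 / \<eta>) ^ k" by (simp add: norm_power power_mono)
    then show "cmod (b z) \<le> B"
      unfolding b_def B_def using norm_triangle_ineq4[of 1 "(1 - a z) ^ k"] by simp
  qed
  have "vanishes 1 (\<lambda>z. 1 - a z)"
    by (rule vanishes_1I) (auto simp: a_def intro!: holomorphic_intros)
  from vanishes_power[OF this, of k] show "vanishes k (\<lambda>z. 1 - b z)"
    by (simp add: b_def)
  fix t
  define z where "z = \<i> * of_real t"
  have az: "cmod (a z) = \<eta>" using assms by (simp add: ca z_def)
  have "cmod (1 - a z) \<le> 2" using norm_triangle_ineq4[of 1 "a z"] az assms by simp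
  then have "cmod ((1 - a z) ^ i) \<le> 2 ^ k" if "i < k" for i
    unfolding norm_power
    by (rule order_trans[OF power_mono power_increasing]) (use that in auto)
  then have "cmod (\<Sum>i<k. (1 - a z) ^ i) \<le> real (card {..<k}) * 2 ^ k"
    by (intro sum_norm_bound) auto
  then have "\<eta> * cmod (\<Sum>i<k. (1 - a z) ^ i) \<le> \<eta> * (real k * 2 ^ k)"
    using assms by (intro mult_left_mono) auto
  moreover have "b z = a z * (\<Sum>i<k. (1 - a z) ^ i)"
    unfolding b_def one_diff_power_eq by simp
  ultimately show "cmod (b (\<i> * of_real t)) \<le> \<eta> * (real k * 2 ^ k)"
    unfolding z_def[symmetric] by (simp add: norm_mult az)
qed

text \<open>
  The sup norm of a tail of an extremal family on the left edge need not decrease.  Multiplication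
  by a flattener makes it small there without changing the Taylor coefficients.  The large constant
  on the right edge is harmless: there the moduli \<open>|u j|\<^sup>2 / c\<close> do not depend on \<open>t\<close>, so their tails
  are small uniformly.
\<close>

lemma extremal_tail_small:
  assumes c: "c > 0" and u: "\<And>A. finite A \<Longrightarrow> (\<Sum>j\<in>A. (cmod (u j))\<^sup>2) \<le> c\<^sup>2" and "\<epsilon> > 0"
  obtains M where "\<And>m. m \<ge> M \<Longrightarrow>
    \<exists>G. calderon G \<epsilon> \<and> congruent_mod k (restr {m..} (extremal c u)) G"
proof -
  have cal: "calderon (extremal c u) c" by (rule calderon_extremal[OF c u])
  \<comment> \<open>Chosen so that the flattener times \<open>c\<close> is at most \<open>\<epsilon>\<close> on the left edge; the \<open>+ 1\<close> covers \<open>k = 0\<close>.\<close>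
  define \<eta> where "\<eta> = min 1 (\<epsilon> / (c * (real k * 2 ^ k + 1)))"
  have den: "0 < c * (real k * 2 ^ k + 1)" using c by (intro mult_pos_pos add_nonneg_pos) auto
  have \<eta>: "0 < \<eta>" "\<eta> \<le> 1" "\<eta> \<le> \<epsilon> / (c * (real k * 2 ^ k + 1))"
    using den \<open>\<epsilon> > 0\<close> by (auto simp: \<eta>_def)
  obtain b B where b: "multiplier b B" "vanishes k (\<lambda>z. 1 - b z)"
    "\<And>t. cmod (b (\<i> * of_real t)) \<le> \<eta> * (real k * 2 ^ k)"
    using vanishing_flattener[OF \<eta>(1,2), of k] by blast
  have B0: "0 \<le> B" by (rule multiplier_nonneg[OF b(1)])
  have left: "cmod (b (\<i> * of_real t)) * c \<le> \<epsilon>" for t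
  proof -
    have "cmod (b (\<i> * of_real t)) * c \<le> \<eta> * (real k * 2 ^ k) * c"
      using b(3)[of t] c by (intro mult_right_mono) auto
    also have "\<dots> \<le> \<eta> * (c * (real k * 2 ^ k + 1))"
      using \<eta>(1) c by (simp add: algebra_simps)
    also have "\<dots> \<le> \<epsilon>" using \<eta>(3) den by (simp add: pos_le_divide_eq)
    finally show ?thesis .
  qed
  have "0 < c * \<epsilon> / (B + 1)" using c \<open>\<epsilon> > 0\<close> B0 by simp
  then obtain M where M: "\<And>A. finite A \<Longrightarrow> A \<subseteq> {M..} \<Longrightarrow>
      (\<Sum>j\<in>A. (cmod (u j))\<^sup>2) \<le> c * \<epsilon> / (B + 1)"
    using l2_tail[of "\<lambda>j. (cmod (u j))\<^sup>2" "c\<^sup>2"] u by auto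
  have "\<exists>G. calderon G \<epsilon> \<and> congruent_mod k (restr {m..} (extremal c u)) G" if "m \<ge> M" for m
  proof (intro exI conjI)
    let ?L = "restr {m..} (extremal c u)"
    note L = calderon_restr[OF cal, of "{m..}"]
    note bL = calderonD[OF calderon_mult[OF b(1) L]]
    show "calderon (\<lambda>j z. b z * ?L j z) \<epsilon>"
    proof (rule calderonI[OF bL(2,3,4)])
      fix t
      show "cmod (b (\<i> * of_real t) * ?L j (\<i> * of_real t)) \<le> \<epsilon>" for j
      proof -
        have "cmod (?L j (\<i> * of_real t)) \<le> c" by (rule calderonD(4)[OF L]) simp
        then have "cmod (b (\<i> * of_real t)) * cmod (?L j (\<i> * of_real t)) \<le> cmod (b (\<i> * of_real t)) * c"
          by (intro mult_left_mono) auto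
        then show ?thesis using left[of t] by (simp add: norm_mult)
      qed
      fix A :: "nat set" assume "finite A"
      define z where "z = 1 + \<i> * of_real t"
      have "(\<Sum>j\<in>A. cmod (b z * ?L j z)) = cmod (b z) * (\<Sum>j\<in>A. cmod (?L j z))"
        by (simp add: norm_mult sum_distrib_left)
      also have "(\<Sum>j\<in>A. cmod (?L j z)) = (\<Sum>j\<in>A \<inter> {m..}. (cmod (u j))\<^sup>2 / c)"
        using \<open>finite A\<close>
        by (intro sum.mono_neutral_cong_right) (auto simp: restr_def z_def cmod_extremal_right[OF c])
      also have "\<dots> = (\<Sum>j\<in>A \<inter> {m..}. (cmod (u j))\<^sup>2) / c"
        by (simp add: sum_divide_distrib)
      also have "\<dots> \<le> (c * \<epsilon> / (B + 1)) / c"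
        using \<open>finite A\<close> \<open>m \<ge> M\<close> c by (intro divide_right_mono M) auto
      also have "\<dots> = \<epsilon> / (B + 1)" using c by simp
      finally have "(\<Sum>j\<in>A. cmod (b z * ?L j z)) \<le> cmod (b z) * (\<epsilon> / (B + 1))"
        by (simp add: mult_left_mono)
      also have "\<dots> \<le> B * (\<epsilon> / (B + 1))"
        using multiplierD(3)[OF b(1)] B0 \<open>\<epsilon> > 0\<close> by (intro mult_right_mono) (auto simp: z_def)
      also have "\<dots> \<le> \<epsilon>" using B0 \<open>\<epsilon> > 0\<close> by (simp add: pos_divide_le_eq algebra_simps)
      finally show "(\<Sum>j\<in>A. cmod (b (1 + \<i> * of_real t) * ?L j (1 + \<i> * of_real t))) \<le> \<epsilon>"
        by (simp add: z_def)
    qed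
    show "congruent_mod k ?L (\<lambda>j z. b z * ?L j z)"
      unfolding congruent_mod_def
    proof
      fix j
      from vanishes_mult_hol[OF b(2) calderonD(2)[OF L, of j]]
      show "vanishes k (\<lambda>z. ?L j z - b z * ?L j z)"
        by (simp add: algebra_simps)
    qed
  qed
  then show ?thesis by (rule that)
qed

text \<open>
  The exact sequence \<open>0 \<rightarrow> Z\<^sup>(\<^sup>k\<^sup>-\<^sup>1\<^sup>) \<rightarrow> Z\<^sup>(\<^sup>k\<^sup>) \<rightarrow> l\<^sub>2 \<rightarrow> 0\<close>: the extremal family lifts the value in \<open>l\<^sub>2\<close>, and
  what remains is divisible by \<open>z - 1/2\<close>.
\<close>

lemma split_off_value:
  assumes F: "calderon F C" and c: "c > 0"
    and u: "\<And>A. finite A \<Longrightarrow> (\<Sum>j\<in>A. (cmod (F j (1/2)))\<^sup>2) \<le> c\<^sup>2"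
  obtains G where "calderon G (2 * (C + c))"
    "\<And>j z. z \<in> cstrip \<Longrightarrow> F j z = extremal c (\<lambda>j. F j (1/2)) j z + (z - 1/2) * G j z"
proof -
  have L: "calderon (extremal c (\<lambda>j. F j (1/2))) c" by (rule calderon_extremal[OF c u])
  show thesis
  proof (rule calderon_divide[OF calderon_diff[OF F L]])
    show "F j (1/2) - extremal c (\<lambda>j. F j (1/2)) j (1/2) = 0" for j by simp
  next
    fix G assume G: "calderon G (2 * (C + c))"
      "\<And>j z. z \<in> cstrip \<Longrightarrow> F j z - extremal c (\<lambda>j. F j (1/2)) j z = (z - 1/2) * G j z"
    show thesis
    proof (rule that[OF G(1)])
      fix j z assume "z \<in> cstrip"
      from G(2)[OF this, of j]
      show "F j z = extremal c (\<lambda>j. F j (1/2)) j z + (z - 1/2) * G j z"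
        unfolding diff_eq_eq by (simp only: add.commute)
    qed
  qed
qed

text \<open>
  Density of the finitely supported tuples in \<open>Z\<^sup>(\<^sup>k\<^sup>)\<close>.  Splitting off the value reduces the order \<open>k\<close>
  by one; the extremal part has small tails, and the induction hypothesis applies to the quotient
  by \<open>z - 1/2\<close>.
\<close>

lemma tail_small:
  assumes "calderon F C" "\<epsilon> > 0"
  shows "\<exists>M. \<forall>m\<ge>M. \<exists>G. calderon G \<epsilon> \<and> congruent_mod k (restr {m..} F) G"
  using assms
proof (induction k arbitrary: F C \<epsilon>)
  case 0
  have "calderon (\<lambda>j z. 0) \<epsilon>" using calderon_mono[OF calderon_zero] \<open>\<epsilon> > 0\<close> by simp
  moreover have "congruent_mod 0 (restr {m..} F) (\<lambda>j z. 0)" for m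
    using calderonD(2)[OF calderon_restr[OF 0(1)]] by (simp add: congruent_mod_def vanishes_0_iff)
  ultimately show ?case by blast
next
  case (Suc k)
  note F = Suc.prems(1)
  \<comment> \<open>The summand \<open>1\<close> makes the scale positive when \<open>C = 0\<close>.\<close>
  define c where "c = C + 1"
  have C0: "0 \<le> C" by (rule calderon_nonneg[OF F])
  then have c: "c > 0" by (simp add: c_def)
  let ?u = "\<lambda>j. F j (1/2)"
  have u: "(\<Sum>j\<in>A. (cmod (?u j))\<^sup>2) \<le> c\<^sup>2" if "finite A" for A
    by (rule order_trans[OF calderon_value_l2[OF F that] power_mono]) (use C0 in \<open>auto simp: c_def\<close>)
  obtain G where G: "calderon G (2 * (C + c))"
    "\<And>j z. z \<in> cstrip \<Longrightarrow> F j z = extremal c ?u j z + (z - 1/2) * G j z"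
    using split_off_value[OF F c u] by blast
  define \<epsilon>' where "\<epsilon>' = \<epsilon> / (2 * real (Suc k))"
  have \<epsilon>': "\<epsilon>' > 0" using Suc.prems(2) by (simp add: \<epsilon>'_def)
  obtain M1 where M1: "\<And>m. m \<ge> M1 \<Longrightarrow>
      \<exists>H. calderon H \<epsilon>' \<and> congruent_mod k (restr {m..} G) H"
    using Suc.IH[OF G(1) \<epsilon>'] by blast
  obtain M2 where M2: "\<And>m. m \<ge> M2 \<Longrightarrow>
      \<exists>H. calderon H (\<epsilon>/2) \<and> congruent_mod (Suc k) (restr {m..} (extremal c ?u)) H"
    using extremal_tail_small[OF c u, of "\<epsilon>/2" "Suc k"] Suc.prems(2) by auto
  have "\<exists>H. calderon H \<epsilon> \<and> congruent_mod (Suc k) (restr {m..} F) H" if m: "m \<ge> max M1 M2" for m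
  proof -
    obtain H1 where H1: "calderon H1 \<epsilon>'" "congruent_mod k (restr {m..} G) H1"
      using M1[of m] m by auto
    obtain H2 where H2: "calderon H2 (\<epsilon>/2)" "congruent_mod (Suc k) (restr {m..} (extremal c ?u)) H2"
      using M2[of m] m by auto
    let ?g = "local_coord (Suc k)"
    have "calderon (\<lambda>j z. H2 j z + ?g z * H1 j z) (\<epsilon>/2 + real (Suc k) * \<epsilon>')"
      by (intro calderon_add H2 calderon_mult[OF multiplier_local_coord H1(1)])
    also have "\<epsilon>/2 + real (Suc k) * \<epsilon>' = \<epsilon>"
      by (simp add: \<epsilon>'_def divide_simps del: of_nat_Suc)
    finally have cal: "calderon (\<lambda>j z. H2 j z + ?g z * H1 j z) \<epsilon>" .
    have "congruent_mod (Suc k) (restr {m..} F) (\<lambda>j z. H2 j z + ?g z * H1 j z)"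
      unfolding congruent_mod_def
    proof
      fix j
      let ?R = "restr {m..} G j" and ?L = "restr {m..} (extremal c ?u) j"
      have "vanishes (1 + k) (\<lambda>z. (z - 1/2) * (?R z - H1 j z))"
        by (intro vanishes_mult vanishes_ident) (use H1(2) in \<open>simp add: congruent_mod_def\<close>)
      moreover have "vanishes (Suc k) (\<lambda>z. H1 j z * ((z - 1/2) - ?g z))"
        by (intro vanishes_mult_hol vanishes_mono[OF vanishes_local_coord_diff] calderonD(2)[OF H1(1)])
           simp
      moreover have "vanishes (Suc k) (\<lambda>z. ?L z - H2 j z)"
        using H2(2) by (simp add: congruent_mod_def)
      ultimately have "vanishes (Suc k) (\<lambda>z. (?L z - H2 j z) +
          ((z - 1/2) * (?R z - H1 j z) + H1 j z * ((z - 1/2) - ?g z)))"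
        by (intro vanishes_add) auto
      then show "vanishes (Suc k) (\<lambda>z. restr {m..} F j z - (H2 j z + ?g z * H1 j z))"
      proof (rule vanishes_cong)
        fix z assume "z \<in> strip"
        then have z: "z \<in> cstrip" using strip_subset_cstrip by blast
        show "(?L z - H2 j z) + ((z - 1/2) * (?R z - H1 j z) + H1 j z * ((z - 1/2) - ?g z))
            = restr {m..} F j z - (H2 j z + ?g z * H1 j z)"
          unfolding restr_def using G(2)[OF z, of j] by (simp add: algebra_simps)
      qed
    qed
    then show ?thesis using cal by blast
  qed
  then show ?case by blast
qed


section \<open>Signs and logarithms\<close>

text \<open>
  Averaging over signs kills the terms off the diagonal, so some choice of signs does not decrease
  the diagonal sum.  The signs are found greedily: a new index contributes, apart from its diagonal
  term, a multiple of its own sign.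
\<close>

lemma exists_signs:
  fixes D :: "'a \<Rightarrow> 'a \<Rightarrow> real"
  assumes "finite E"
  shows "\<exists>\<epsilon>. (\<forall>i. \<epsilon> i = 1 \<or> \<epsilon> i = -1) \<and> (\<Sum>i\<in>E. D i i) \<le> (\<Sum>i\<in>E. \<Sum>j\<in>E. \<epsilon> i * \<epsilon> j * D i j)"
  using assms
proof (induction E)
  case empty
  have "\<forall>i :: 'a. (1 :: real) = 1 \<or> (1 :: real) = -1" by simp
  then show ?case by (intro exI[of _ "\<lambda>_. 1"]) simp
next
  case (insert x E)
  then obtain \<epsilon> where \<epsilon>: "\<forall>i. \<epsilon> i = 1 \<or> \<epsilon> i = -1"
    "(\<Sum>i\<in>E. D i i) \<le> (\<Sum>i\<in>E. \<Sum>j\<in>E. \<epsilon> i * \<epsilon> j * D i j)" by blast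
  define T where "T = (\<Sum>i\<in>E. \<epsilon> i * (D x i + D i x))"
  define s :: real where "s = (if T \<ge> 0 then 1 else -1)"
  have s: "s * T \<ge> 0" "s * s = 1" "s = 1 \<or> s = -1" by (auto simp: s_def)
  define \<epsilon>' where "\<epsilon>' = \<epsilon>(x := s)"
  have eq: "\<epsilon>' x = s" "\<And>i. i \<in> E \<Longrightarrow> \<epsilon>' i = \<epsilon> i" using insert(2) by (auto simp: \<epsilon>'_def)
  have "(\<Sum>i\<in>insert x E. \<Sum>j\<in>insert x E. \<epsilon>' i * \<epsilon>' j * D i j)
      = s * s * D x x + (\<Sum>j\<in>E. s * \<epsilon> j * D x j)
        + (\<Sum>i\<in>E. \<epsilon> i * s * D i x + (\<Sum>j\<in>E. \<epsilon> i * \<epsilon> j * D i j))"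
    using insert(1,2) by (simp add: eq cong: sum.cong)
  also have "\<dots> = D x x + s * T + (\<Sum>i\<in>E. \<Sum>j\<in>E. \<epsilon> i * \<epsilon> j * D i j)"
    unfolding T_def s(2) sum_distrib_left sum.distrib
    by (simp add: algebra_simps sum.distrib)
  finally have "(\<Sum>i\<in>insert x E. D i i) \<le> (\<Sum>i\<in>insert x E. \<Sum>j\<in>insert x E. \<epsilon>' i * \<epsilon>' j * D i j)"
    using \<epsilon>(2) s(1) insert(1,2) by simp
  moreover have "\<forall>i. \<epsilon>' i = 1 \<or> \<epsilon>' i = -1" using \<epsilon>(1) s(3) by (simp add: \<epsilon>'_def)
  ultimately show ?case by blast
qed

text \<open>
  The exceptional set has fewer than \<open>N\<close> elements.  This converts averages over \<open>N\<close> arbitrary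
  indices into statements about almost all indices.
\<close>

lemma eventually_if_hits_all_large_sets:
  assumes "\<And>E. finite E \<Longrightarrow> card E = N \<Longrightarrow> \<exists>n\<in>E. P n"
  shows "eventually P sequentially"
proof -
  have "finite {n. \<not> P n}"
  proof (rule ccontr)
    assume "infinite {n. \<not> P n}"
    then obtain E where "E \<subseteq> {n. \<not> P n}" "finite E" "card E = N"
      using infinite_arbitrarily_large by blast
    then show False using assms by blast
  qed
  then show ?thesis by (simp add: eventually_cofinite flip: cofinite_eq_sequentially)
qed

lemma exists_large_ln: "\<exists>N::nat. N > 0 \<and> R \<le> ln (real N)"
proof -
  obtain N where N: "exp R \<le> real N" using real_arch_simple by blast
  then have "0 < real N" using exp_gt_zero[of R] by linarith
  then have "R \<le> ln (real N)" using N ln_ge_iff by blast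
  then show ?thesis using \<open>0 < real N\<close> by auto
qed

text \<open>
  For each fixed \<open>N\<close> the polynomial with coefficients \<open>c n j / j!\<close> is bounded by \<open>B\<close> at \<open>- ln N\<close> for almost all \<open>n\<close>,
  while \<open>B\<close> does not depend on \<open>N\<close>.  Descending induction on \<open>j\<close>: once the higher coefficients are
  negligible, \<open>(ln N)\<^sup>j |c n j|\<close> is bounded by a multiple of \<open>(ln N)\<^bsup>j-1\<^esup>\<close>, and \<open>ln N\<close> may be as large
  as desired.For \<open>j = 0\<close> there is no such gain.
\<close>

lemma coefficients_tend_to_0:
  fixes c :: "nat \<Rightarrow> nat \<Rightarrow> complex"
  assumes bdd: "\<And>n j. j < k \<Longrightarrow> cmod (c n j) \<le> B"
    and hit: "\<And>N. N > 0 \<Longrightarrow>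
      \<forall>\<^sub>F n in sequentially. cmod (\<Sum>j<k. (- of_real (ln (real N))) ^ j / fact j * c n j) \<le> B"
    and j: "1 \<le> j" "j < k"
  shows "(\<lambda>n. c n j) \<longlonglongrightarrow> 0"
  using j
proof (induction "k - j" arbitrary: j rule: less_induct)
  case less
  have B0: "0 \<le> B" using order_trans[OF norm_ge_zero bdd[OF less.prems(2)]] .
  show ?case
  proof (rule tendstoI)
    fix \<epsilon> :: real assume "\<epsilon> > 0"
    \<comment> \<open>The three terms of \<open>B + k B + 1\<close> bound the full sum, the part below \<open>j\<close> and the part above \<open>j\<close>.\<close>
    define R where "R = max 1 (fact j * (B + real k * B + 1) / \<epsilon> + 1)"
    obtain N where N: "N > 0" "R \<le> ln (real N)" using exists_large_ln by blast
    define t where "t = ln (real N)"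
    have t: "t \<ge> 1" "fact j * (B + real k * B + 1) / \<epsilon> < t"
      using N(2) by (auto simp: R_def t_def)
    define a where "a i = (- complex_of_real t) ^ i / fact i" for i
    have na: "cmod (a i) = t ^ i / fact i" for i
      using t by (simp add: a_def norm_divide norm_power)
    have "(\<lambda>n. \<Sum>i\<in>{Suc j..<k}. a i * c n i) \<longlonglongrightarrow> (\<Sum>i\<in>{Suc j..<k}. a i * 0)"
      by (intro tendsto_sum tendsto_mult tendsto_const less.hyps) (use less.prems in auto)
    then have "\<forall>\<^sub>F n in sequentially. dist (\<Sum>i\<in>{Suc j..<k}. a i * c n i) 0 < 1"
      by (intro tendstoD) auto
    then show "\<forall>\<^sub>F n in sequentially. dist (c n j) 0 < \<epsilon>"
      using hit[OF N(1)]
    proof eventually_elim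
      case (elim n)
      have split: "(\<Sum>i<k. a i * c n i)
          = (\<Sum>i<j. a i * c n i) + a j * c n j + (\<Sum>i\<in>{Suc j..<k}. a i * c n i)"
      proof -
        have "(\<Sum>i<k. a i * c n i) = (\<Sum>i\<in>{..<Suc j} \<union> {Suc j..<k}. a i * c n i)"
          using less.prems by (intro sum.cong) auto
        also have "\<dots> = (\<Sum>i<Suc j. a i * c n i) + (\<Sum>i\<in>{Suc j..<k}. a i * c n i)"
          by (rule sum.union_disjoint) auto
        finally show ?thesis by simp
      qed
      have low: "cmod (\<Sum>i<j. a i * c n i) \<le> real k * B * t ^ (j - 1)"
      proof -
        have "cmod (\<Sum>i<j. a i * c n i) \<le> real (card {..<j}) * (t ^ (j - 1) * B)"
        proof (rule sum_norm_bound)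
          fix i assume i: "i \<in> {..<j}"
          have "cmod (a i) \<le> t ^ i" unfolding na using t mult_left_mono[of 1 "fact i" "t ^ i"]
            by (simp add: divide_le_eq fact_ge_1)
          also have "t ^ i \<le> t ^ (j - 1)" using t i by (intro power_increasing) auto
          finally show "cmod (a i * c n i) \<le> t ^ (j - 1) * B"
            unfolding norm_mult using bdd[of i n] i less.prems t by (intro mult_mono) auto
        qed
        also have "\<dots> \<le> real k * (t ^ (j - 1) * B)"
          using less.prems t B0 by (intro mult_right_mono) auto
        finally show ?thesis by (simp add: mult.commute mult.left_commute)
      qed
      have "cmod (a j * c n j) \<le> cmod (\<Sum>i<k. a i * c n i) + cmod (\<Sum>i<j. a i * c n i)
          + cmod (\<Sum>i\<in>{Suc j..<k}. a i * c n i)"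
      proof -
        have "a j * c n j = (\<Sum>i<k. a i * c n i) - (\<Sum>i<j. a i * c n i) - (\<Sum>i\<in>{Suc j..<k}. a i * c n i)"
          using split by simp
        then have "cmod (a j * c n j) = cmod ((\<Sum>i<k. a i * c n i) - (\<Sum>i<j. a i * c n i)
            - (\<Sum>i\<in>{Suc j..<k}. a i * c n i))" by (rule arg_cong)
        then show ?thesis
          using norm_triangle_ineq4[of "(\<Sum>i<k. a i * c n i) - (\<Sum>i<j. a i * c n i)"
              "\<Sum>i\<in>{Suc j..<k}. a i * c n i"]
            norm_triangle_ineq4[of "\<Sum>i<k. a i * c n i" "\<Sum>i<j. a i * c n i"]
          by linarith
      qed
      also have "\<dots> \<le> B + real k * B * t ^ (j - 1) + 1"
        using elim low by (simp add: a_def t_def)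
      also have "\<dots> \<le> (B + real k * B + 1) * t ^ (j - 1)"
        using t B0 one_le_power[of t "j - 1"] mult_left_mono[of 1 "t ^ (j - 1)" "B + 1"]
        by (simp add: algebra_simps)
      finally have "fact j * (t ^ j / fact j * cmod (c n j)) \<le> fact j * ((B + real k * B + 1) * t ^ (j - 1))"
        unfolding norm_mult na by (intro mult_left_mono) auto
      then have "t ^ j * cmod (c n j) \<le> fact j * (B + real k * B + 1) * t ^ (j - 1)"
        by (simp add: mult.assoc)
      also have "\<dots> < \<epsilon> * t * t ^ (j - 1)"
        using t \<open>\<epsilon> > 0\<close> by (intro mult_strict_right_mono) (auto simp: divide_less_eq mult.commute)
      also have "\<dots> = t ^ j * \<epsilon>"
        using less.prems by (cases j) auto
      finally show "dist (c n j) 0 < \<epsilon>" using t by simp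
    qed
  qed
qed


section \<open>Sums of disjoint blocks\<close>

text \<open>
  The factor \<open>N\<^bsup>-z\<^esup>\<close> has modulus \<open>1\<close> on the left edge, where disjointly supported blocks do not
  add up in the sup norm, and modulus \<open>1/N\<close> on the right edge, where \<open>N\<close> blocks add up to at most
  \<open>N * D\<close>.  At the base point it equals \<open>N\<^bsup>-1/2\<^esup>\<close>, and its Taylor expansion there brings in the
  powers of \<open>ln N\<close> on which the whole argument rests.
\<close>

lemma calderon_block_sum:
  assumes Y: "\<And>i. i \<in> E \<Longrightarrow> calderon (Y i) D"
    and supp: "\<And>i j. j \<notin> A i \<Longrightarrow> Y i j = (\<lambda>z. 0)"
    and disj: "disjoint_family A"
    and E: "finite E" "E \<noteq> {}"
    and \<epsilon>: "\<And>i. cmod (\<epsilon> i) \<le> 1"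
  shows "calderon (\<lambda>j z. \<Sum>i\<in>E. \<epsilon> i * (exp (- of_real (ln (real (card E))) * z) * Y i j z)) D"
proof -
  define N where "N = real (card E)"
  have N: "N \<ge> 1" using E by (simp add: N_def Suc_le_eq card_gt_0_iff)
  note Y' = calderonD[OF Y]
  obtain i0 where "i0 \<in> E" using E by blast
  then have D0: "0 \<le> D" using calderon_nonneg[OF Y] by blast
  have ce: "cmod (exp (- of_real (ln N) * z)) = N powr (- Re z)" for z
    using N by (simp add: powr_def)
  have coord: "cmod (\<Sum>i\<in>E. \<epsilon> i * (e * Y i j z)) \<le> cmod e * D" if "z \<in> cstrip" for j z e
  proof (cases "\<exists>i0\<in>E. j \<in> A i0")
    case True
    then obtain i0 where i0: "i0 \<in> E" "j \<in> A i0" by blast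
    have "Y i j z = 0" if "i \<noteq> i0" for i
    proof -
      have "j \<notin> A i" using disj i0(2) that unfolding disjoint_family_on_def by blast
      then show ?thesis by (simp add: supp)
    qed
    then have "(\<Sum>i\<in>E. \<epsilon> i * (e * Y i j z)) = (\<Sum>i\<in>{i0}. \<epsilon> i * (e * Y i j z))"
      using i0 E by (intro sum.mono_neutral_right) auto
    then have "cmod (\<Sum>i\<in>E. \<epsilon> i * (e * Y i j z)) = cmod (\<epsilon> i0) * (cmod e * cmod (Y i0 j z))"
      by (simp add: norm_mult)
    also have "\<dots> \<le> 1 * (cmod e * D)"
      using Y'(4)[OF i0(1) that, of j] \<epsilon>[of i0] by (intro mult_mono) auto
    finally show ?thesis by simp
  next
    case False
    then have "Y i j z = 0" if "i \<in> E" for i using supp that by simp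
    then have "(\<Sum>i\<in>E. \<epsilon> i * (e * Y i j z)) = 0" by (intro sum.neutral) auto
    then show ?thesis using D0 by simp
  qed
  show ?thesis
    unfolding N_def[symmetric]
  proof (rule calderonI)
    show "(\<lambda>z. \<Sum>i\<in>E. \<epsilon> i * (exp (- of_real (ln N) * z) * Y i j z)) holomorphic_on strip" for j
      by (intro holomorphic_intros Y')
    show "continuous_on cstrip (\<lambda>z. \<Sum>i\<in>E. \<epsilon> i * (exp (- of_real (ln N) * z) * Y i j z))" for j
      by (intro continuous_intros Y')
    show le: "cmod (\<Sum>i\<in>E. \<epsilon> i * (exp (- of_real (ln N) * z) * Y i j z)) \<le> D" if "z \<in> cstrip" for j z
    proof -
      have "N powr (- Re z) \<le> N powr 0"
        using N that by (intro powr_mono) (auto simp: cstrip_def)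
      then have "cmod (exp (- of_real (ln N) * z)) * D \<le> 1 * D"
        unfolding ce using N D0 by (intro mult_right_mono) auto
      then show ?thesis using coord[OF that, of "exp (- of_real (ln N) * z)" j] by simp
    qed
    then show "cmod (\<Sum>i\<in>E. \<epsilon> i * (exp (- of_real (ln N) * (\<i> * of_real t)) * Y i j (\<i> * of_real t))) \<le> D" for j t
      by simp
    fix B :: "nat set" and t assume B: "finite B"
    define z where "z = 1 + \<i> * of_real t"
    define e where "e = exp (- of_real (ln N) * z)"
    have e: "cmod e = 1 / N" unfolding e_def ce using N by (simp add: z_def powr_minus divide_inverse)
    have "(\<Sum>j\<in>B. cmod (\<Sum>i\<in>E. \<epsilon> i * (e * Y i j z))) \<le> (\<Sum>j\<in>B. \<Sum>i\<in>E. 1 * (cmod e * cmod (Y i j z)))"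
      by (intro sum_mono order_trans[OF norm_sum])
         (unfold norm_mult, intro mult_right_mono \<epsilon>, simp)
    also have "\<dots> = (\<Sum>i\<in>E. cmod e * (\<Sum>j\<in>B. cmod (Y i j z)))"
      by (subst sum.swap) (simp add: sum_distrib_left)
    also have "\<dots> \<le> (\<Sum>i\<in>E. cmod e * D)"
      unfolding z_def by (intro sum_mono mult_left_mono Y'(5) B) auto
    also have "\<dots> = D" using N by (simp add: e N_def)
    finally show "(\<Sum>j\<in>B. cmod (\<Sum>i\<in>E. \<epsilon> i * (exp (- of_real (ln N) * (1 + \<i> * of_real t))
        * Y i j (1 + \<i> * of_real t)))) \<le> D"
      by (simp add: e_def z_def)
  qed
qed


section \<open>Operators into l2\<close>

text \<open>
  The coordinates of a bounded linear operator from \<open>Z\<^sup>(\<^sup>k\<^sup>)\<close> to \<open>l\<^sub>2\<close>, lifted to the Calderon space: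
  \<open>l2_bound\<close> is the boundedness, and \<open>cong\<close> says that the lift depends on the Taylor tuple only.
\<close>

locale hilbert_coordinates =
  fixes k :: nat and \<Psi> :: "nat \<Rightarrow> (nat \<Rightarrow> complex \<Rightarrow> complex) \<Rightarrow> complex" and K :: real
  assumes add: "\<And>n. calderon F C \<Longrightarrow> calderon G D \<Longrightarrow> \<Psi> n (\<lambda>j z. F j z + G j z) = \<Psi> n F + \<Psi> n G"
    and cmult: "\<And>n. calderon F C \<Longrightarrow> \<Psi> n (\<lambda>j z. c * F j z) = c * \<Psi> n F"
    and l2_bound: "calderon F C \<Longrightarrow> finite E \<Longrightarrow> (\<Sum>n\<in>E. (cmod (\<Psi> n F))\<^sup>2) \<le> (K * C)\<^sup>2"
    and cong: "\<And>n. calderon F C \<Longrightarrow> calderon G D \<Longrightarrow> congruent_mod k F G \<Longrightarrow> \<Psi> n F = \<Psi> n G"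
    and K_nonneg: "0 \<le> K"
begin

lemma zero: "\<Psi> n (\<lambda>j z. 0) = 0"
  using cmult[OF calderon_zero, of n 0] by simp

lemma sum_eq:
  assumes "\<And>i. i \<in> E \<Longrightarrow> calderon (F i) (C i)"
  shows "\<Psi> n (\<lambda>j z. \<Sum>i\<in>E. F i j z) = (\<Sum>i\<in>E. \<Psi> n (F i))"
  using assms
proof (induction E rule: infinite_finite_induct)
  case (insert x E)
  have "\<Psi> n (\<lambda>j z. F x j z + (\<Sum>i\<in>E. F i j z)) = \<Psi> n (F x) + \<Psi> n (\<lambda>j z. \<Sum>i\<in>E. F i j z)"
  proof (rule add)
    show "calderon (F x) (C x)" using insert.prems by simp
    show "calderon (\<lambda>j z. \<Sum>i\<in>E. F i j z) (\<Sum>i\<in>E. C i)"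
      by (rule calderon_sum) (use insert.prems in simp)
  qed
  then show ?case using insert by simp
qed (simp_all add: zero)

lemma bound:
  assumes "calderon F C" shows "cmod (\<Psi> n F) \<le> K * C"
proof -
  have "(cmod (\<Psi> n F))\<^sup>2 \<le> (K * C)\<^sup>2" using l2_bound[OF assms, of "{n}"] by simp
  then show ?thesis
    by (rule power2_le_imp_le) (simp add: K_nonneg calderon_nonneg[OF assms])
qed

lemma tendsto_0:
  assumes "calderon F C" shows "(\<lambda>n. \<Psi> n F) \<longlonglongrightarrow> 0"
proof -
  have "summable (\<lambda>n. (cmod (\<Psi> n F))\<^sup>2)"
    by (rule summableI_nonneg_bounded[of _ "(K * C)\<^sup>2"]) (use l2_bound[OF assms] in auto)
  then have "(\<lambda>n. (cmod (\<Psi> n F))\<^sup>2) \<longlonglongrightarrow> 0" by (rule summable_LIMSEQ_zero)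
  then have "(\<lambda>n. sqrt ((cmod (\<Psi> n F))\<^sup>2)) \<longlonglongrightarrow> sqrt 0" by (rule tendsto_real_sqrt)
  then show ?thesis by (simp add: tendsto_norm_zero_iff)
qed

lemma congruent_unit_at:
  "vanishes k (\<lambda>z. f z - h z) \<Longrightarrow> congruent_mod k (unit_at m f) (unit_at m h)"
  unfolding congruent_mod_def
proof
  fix j assume "vanishes k (\<lambda>z. f z - h z)"
  then show "vanishes k (\<lambda>z. unit_at m f j z - unit_at m h j z)"
    by (cases "j = m") (simp_all add: unit_at_def)
qed

text \<open>
  On families supported at one coordinate the functionals factor through the \<open>k\<close>-dimensional space
  of Taylor polynomials, so pointwise convergence to \<open>0\<close> is uniform on bounded sets.  The induction
  on \<open>i\<close> peels off one Taylor coefficient at a time: it starts from multiples of the \<open>k\<close>-th power of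
  the local coordinate, where the functionals vanish.
\<close>

lemma single_coordinate_bound:
  assumes "i \<le> k"
  shows "\<exists>\<delta>. \<delta> \<longlonglongrightarrow> 0 \<and> (\<forall>n f C. multiplier f C \<longrightarrow>
     cmod (\<Psi> n (unit_at m (\<lambda>z. local_coord k z ^ (k - i) * f z))) \<le> C * \<delta> n)"
  using assms
proof (induction i)
  case 0
  have "\<Psi> n (unit_at m (\<lambda>z. local_coord k z ^ k * f z)) = 0" if f: "multiplier f C" for n f C
  proof -
    have "vanishes (k * 1) (\<lambda>z. local_coord k z ^ k)"
      by (rule vanishes_power[OF vanishes_local_coord])
    then have "vanishes k (\<lambda>z. f z * local_coord k z ^ k)"
      by (intro vanishes_mult_hol multiplierD(1)[OF f]) simp
    then have "vanishes k (\<lambda>z. local_coord k z ^ k * f z - (\<lambda>z. 0) z)" by (simp add: mult.commute)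
    from congruent_unit_at[OF this, of m]
    have "\<Psi> n (unit_at m (\<lambda>z. local_coord k z ^ k * f z)) = \<Psi> n (unit_at m (\<lambda>z. 0))"
      by (rule cong[OF calderon_unit_at[OF multiplier_mult[OF multiplier_power[OF multiplier_local_coord] f]]
            calderon_unit_at[OF multiplier_const]])
    also have "unit_at m (\<lambda>z. 0) = (\<lambda>j z. 0)" by (simp add: unit_at_def fun_eq_iff)
    finally show ?thesis by (simp add: zero)
  qed
  then show ?case by (intro exI[of _ "\<lambda>_. 0"]) auto
next
  case (Suc i)
  then obtain \<delta> where \<delta>: "\<delta> \<longlonglongrightarrow> 0" and \<delta>_bound: "\<And>n f C. multiplier f C \<Longrightarrow>
     cmod (\<Psi> n (unit_at m (\<lambda>z. local_coord k z ^ (k - i) * f z))) \<le> C * \<delta> n" by auto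
  define p where "p = k - Suc i"
  have p: "k - i = Suc p" using Suc.prems by (simp add: p_def)
  let ?g = "local_coord k"
  define \<delta>' where "\<delta>' n = cmod (\<Psi> n (unit_at m (\<lambda>z. ?g z ^ p))) + 4 * \<delta> n" for n
  have gp: "multiplier (\<lambda>z. ?g z ^ q) (real k ^ q)" for q
    by (rule multiplier_power[OF multiplier_local_coord])
  have "\<delta>' \<longlonglongrightarrow> 0 + 4 * 0"
    unfolding \<delta>'_def
    by (intro tendsto_add tendsto_mult tendsto_const \<delta> tendsto_norm_zero
        tendsto_0[OF calderon_unit_at[OF gp]])
  moreover have "cmod (\<Psi> n (unit_at m (\<lambda>z. ?g z ^ p * f z))) \<le> C * \<delta>' n" if f: "multiplier f C" for n f C
  proof -
    note f' = multiplierD[OF f]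
    have f_half: "cmod (f (1/2)) \<le> C" by (rule f'(3)) simp
    have "multiplier (\<lambda>z. f z - f (1/2)) (2 * C)"
      unfolding multiplier_def
    proof (intro conjI ballI)
      show "(\<lambda>z. f z - f (1/2)) holomorphic_on strip" by (intro holomorphic_intros f')
      show "continuous_on cstrip (\<lambda>z. f z - f (1/2))" by (intro continuous_intros f')
      show "cmod (f z - f (1/2)) \<le> 2 * C" if "z \<in> cstrip" for z
        using norm_triangle_ineq4[of "f z" "f (1/2)"] f'(3)[OF that] f_half by linarith
    qed
    then obtain H where H: "calderon H (2 * (2 * C))"
      "\<And>j z. z \<in> cstrip \<Longrightarrow> unit_at m (\<lambda>z. f z - f (1/2)) j z = (z - 1/2) * H j z"
      by (rule calderon_divide[OF calderon_unit_at]) (auto simp: unit_at_def)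
    define h where "h = H m"
    have h: "multiplier h (4 * C)" using calderonD(1)[OF H(1), of m] by (simp add: h_def)
    have fh: "f z = f (1/2) + (z - 1/2) * h z" if "z \<in> cstrip" for z
      using H(2)[OF that, of m] by (simp add: unit_at_def h_def algebra_simps)
    have van: "vanishes k (\<lambda>z. ?g z ^ p * f z - (f (1/2) * ?g z ^ p + ?g z ^ Suc p * h z))"
    proof (rule vanishes_cong)
      show "vanishes k (\<lambda>z. (?g z ^ p * h z) * ((z - 1/2) - ?g z))"
        by (intro vanishes_mult_hol vanishes_mono[OF vanishes_local_coord_diff]
            multiplierD(1)[OF multiplier_mult[OF gp h]]) simp
      fix z assume "z \<in> strip"
      then have "z \<in> cstrip" using strip_subset_cstrip by blast
      from fh[OF this]
      show "(?g z ^ p * h z) * ((z - 1/2) - ?g z) = ?g z ^ p * f z - (f (1/2) * ?g z ^ p + ?g z ^ Suc p * h z)"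
        by (subst \<open>f z = _\<close>) (simp add: algebra_simps)
    qed
    have c1: "calderon (unit_at m (\<lambda>z. ?g z ^ p)) (real k ^ p)"
      by (rule calderon_unit_at[OF gp])
    have c2: "calderon (unit_at m (\<lambda>z. ?g z ^ Suc p * h z)) (real k ^ Suc p * (4 * C))"
      by (rule calderon_unit_at[OF multiplier_mult[OF gp h]])
    have c0: "calderon (unit_at m (\<lambda>z. ?g z ^ p * f z)) (real k ^ p * C)"
      by (rule calderon_unit_at[OF multiplier_mult[OF gp f]])
    have eq: "unit_at m (\<lambda>z. f (1/2) * ?g z ^ p + ?g z ^ Suc p * h z)
        = (\<lambda>j z. f (1/2) * unit_at m (\<lambda>z. ?g z ^ p) j z + unit_at m (\<lambda>z. ?g z ^ Suc p * h z) j z)"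
      by (simp add: unit_at_def fun_eq_iff)
    have cal: "calderon (unit_at m (\<lambda>z. f (1/2) * ?g z ^ p + ?g z ^ Suc p * h z))
        (cmod (f (1/2)) * real k ^ p + real k ^ Suc p * (4 * C))"
      unfolding eq by (rule calderon_add[OF calderon_cmult[OF c1] c2])
    have "\<Psi> n (unit_at m (\<lambda>z. ?g z ^ p * f z))
        = \<Psi> n (unit_at m (\<lambda>z. f (1/2) * ?g z ^ p + ?g z ^ Suc p * h z))"
      by (rule cong[OF c0 cal congruent_unit_at[OF van]])
    also have "\<dots> = f (1/2) * \<Psi> n (unit_at m (\<lambda>z. ?g z ^ p)) + \<Psi> n (unit_at m (\<lambda>z. ?g z ^ Suc p * h z))"
      unfolding eq add[OF calderon_cmult[OF c1] c2] cmult[OF c1] ..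
    also have "cmod \<dots> \<le> C * cmod (\<Psi> n (unit_at m (\<lambda>z. ?g z ^ p))) + (4 * C) * \<delta> n"
      using \<delta>_bound[OF h, of n] f_half unfolding p
      by (intro norm_triangle_le add_mono) (auto simp: norm_mult intro!: mult_right_mono)
    finally show ?thesis by (simp add: \<delta>'_def algebra_simps)
  qed
  ultimately show ?case unfolding p_def[symmetric] by auto
qed

lemma head_tendsto_0:
  assumes H: "\<And>n. calderon (H n) C"
  shows "(\<lambda>n. \<Psi> n (restr {..<m} (H n))) \<longlonglongrightarrow> 0"
proof -
  have "(\<lambda>n. \<Psi> n (unit_at j (H n j))) \<longlonglongrightarrow> 0" for j
  proof -
    obtain \<delta> where \<delta>: "\<delta> \<longlonglongrightarrow> 0" "\<And>n f C. multiplier f C \<Longrightarrow>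
      cmod (\<Psi> n (unit_at j (\<lambda>z. local_coord k z ^ (k - k) * f z))) \<le> C * \<delta> n"
      using single_coordinate_bound[of k j] by auto
    show ?thesis
    proof (rule Lim_null_comparison)
      show "(\<lambda>n. C * \<delta> n) \<longlonglongrightarrow> 0" using tendsto_mult_left[OF \<delta>(1), of C] by simp
      show "\<forall>\<^sub>F n in sequentially. norm (\<Psi> n (unit_at j (H n j))) \<le> C * \<delta> n"
        using \<delta>(2)[OF calderonD(1)[OF H]] by simp
    qed
  qed
  then have "(\<lambda>n. \<Sum>j<m. \<Psi> n (unit_at j (H n j))) \<longlonglongrightarrow> (\<Sum>j<m. 0)" by (intro tendsto_sum)
  moreover have "\<Psi> n (restr {..<m} (H n)) = (\<Sum>j<m. \<Psi> n (unit_at j (H n j)))" for n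
  proof -
    have "restr {..<m} (H n) = (\<lambda>j z. \<Sum>i<m. unit_at i (H n i) j z)"
      by (auto simp: restr_def unit_at_def fun_eq_iff sum.delta)
    then show ?thesis
      by (simp only:) (rule sum_eq, rule calderon_unit_at[OF calderonD(1)[OF H]])
  qed
  ultimately show ?thesis by simp
qed

lemma tail_tendsto_0:
  assumes F: "calderon F C"
  shows "(\<lambda>m. \<Psi> n (restr {m..} F)) \<longlonglongrightarrow> 0"
proof (rule tendstoI)
  fix e :: real assume "e > 0"
  define \<epsilon> where "\<epsilon> = e / 2 / (K + 1)"
  have \<epsilon>: "\<epsilon> > 0" using \<open>e > 0\<close> K_nonneg by (simp add: \<epsilon>_def)
  have Ke: "K * \<epsilon> < e"
  proof -
    have "K + 1 \<noteq> 0" using K_nonneg by linarith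
    then have "(K + 1) * \<epsilon> = e / 2"
      unfolding \<epsilon>_def by (subst times_divide_eq_right) (rule nonzero_mult_div_cancel_left)
    then have "K * \<epsilon> + \<epsilon> = e / 2" by (simp add: distrib_right)
    then show ?thesis using \<epsilon> \<open>e > 0\<close> by linarith
  qed
  obtain M where M: "\<And>m. m \<ge> M \<Longrightarrow> \<exists>G. calderon G \<epsilon> \<and> congruent_mod k (restr {m..} F) G"
    using tail_small[OF F \<epsilon>] by blast
  have "dist (\<Psi> n (restr {m..} F)) 0 < e" if m: "m \<ge> M" for m
  proof -
    obtain G where G: "calderon G \<epsilon>" "congruent_mod k (restr {m..} F) G" using M[OF m] by blast
    have "\<Psi> n (restr {m..} F) = \<Psi> n G" by (rule cong[OF calderon_restr[OF F] G])
    then show ?thesis using bound[OF G(1), of n] Ke by simp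
  qed
  then show "\<forall>\<^sub>F m in sequentially. dist (\<Psi> n (restr {m..} F)) 0 < e"
    by (auto simp: eventually_sequentially)
qed

text \<open>
  The functionals are applied to a signed block sum.  Its Taylor tuple is \<open>N\<^bsup>-1/2\<^esup>\<close> times the signed sum of
  the tuples of \<open>Q i\<close>, the blocks multiplied by the exponential polynomial of degree less than \<open>k\<close> in the
  local coordinate.  For suitable signs the diagonal terms survive, so the mean of
  \<open>|\<Psi> n (Q n)|\<^sup>2\<close> over \<open>E\<close> is at most \<open>(K * D)\<^sup>2\<close>.
\<close>

lemma diagonal_average_bound:
  assumes Y: "\<And>i. calderon (Y i) D" and supp: "\<And>i j. j \<notin> A i \<Longrightarrow> Y i j = (\<lambda>z. 0)"
    and disj: "disjoint_family A" and E: "finite E" "E \<noteq> {}"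
  shows "\<exists>n\<in>E. cmod (\<Sum>j<k. (- of_real (ln (real (card E)))) ^ j / fact j *
            \<Psi> n (\<lambda>m z. local_coord k z ^ j * Y n m z)) \<le> K * D"
proof -
  let ?g = "local_coord k"
  define N where "N = real (card E)"
  have N: "N \<ge> 1" using E by (simp add: N_def Suc_le_eq card_gt_0_iff)
  define t where "t = - complex_of_real (ln N)"
  define r where "r = 1 / sqrt N"
  have r: "r > 0" "r\<^sup>2 * N = 1" using N by (auto simp: r_def power_divide)
  have gp: "multiplier (\<lambda>z. ?g z ^ q) (real k ^ q)" for q
    by (rule multiplier_power[OF multiplier_local_coord])
  have exp_split: "exp (t * z) = of_real r * exp (t * (z - 1/2))" for z
  proof -
    have "exp (t * (1/2)) = complex_of_real (exp (- ln (sqrt N)))"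
      using N by (simp add: t_def ln_sqrt flip: exp_of_real)
    also have "\<dots> = of_real r" using N by (simp add: r_def exp_minus inverse_eq_divide)
    finally have h: "exp (t * (1/2)) = of_real r" .
    have "exp (t * z) = exp (t * (1/2) + t * (z - 1/2))" by (simp add: algebra_simps)
    then show ?thesis unfolding exp_add h .
  qed
  have D0: "0 \<le> D" using calderon_nonneg[OF Y] by blast
  define Q where "Q i j z = (\<Sum>q<k. t ^ q / fact q * (?g z ^ q * Y i j z))" for i j z
  define CQ where "CQ = (\<Sum>q<k. cmod (t ^ q / fact q) * (real k ^ q * D))"
  have cQ: "calderon (Q i) CQ" for i
    unfolding Q_def[abs_def] CQ_def by (intro calderon_sum calderon_cmult calderon_mult gp Y)
  have PQ: "\<Psi> n (Q i) = (\<Sum>q<k. t ^ q / fact q * \<Psi> n (\<lambda>j z. ?g z ^ q * Y i j z))" for n i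
    unfolding Q_def[abs_def]
    by (subst sum_eq[OF calderon_cmult[OF calderon_mult[OF gp Y]]])
       (intro sum.cong refl cmult[OF calderon_mult[OF gp Y]])
  have van: "vanishes k (\<lambda>z. exp (t * (z - 1/2)) * Y i j z - Q i j z)" for i j
  proof -
    \<comment> \<open>Powers of the local coordinate may replace those of \<open>z - 1/2\<close>, since the two agree to order \<open>k\<close>.\<close>
    have "vanishes k (\<lambda>z. (z - 1/2) ^ q - ?g z ^ q)" for q
    proof -
      have "vanishes k (\<lambda>z. (\<Sum>p<q. ?g z ^ (q - Suc p) * (z - 1/2) ^ p) * ((z - 1/2) - ?g z))"
      proof (intro vanishes_mult_hol vanishes_mono[OF vanishes_local_coord_diff])
        show "(\<lambda>z. \<Sum>p<q. ?g z ^ (q - Suc p) * (z - 1/2) ^ p) holomorphic_on strip"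
          by (intro holomorphic_intros multiplierD(1)[OF multiplier_local_coord])
      qed simp
      then show ?thesis unfolding power_diff_sumr2 by (simp add: mult.commute)
    qed
    then have "vanishes k (\<lambda>z. (\<Sum>q<k. t ^ q / fact q * ((z - 1/2) ^ q - ?g z ^ q)))"
      by (intro vanishes_sum vanishes_cmult)
    from vanishes_add[OF vanishes_exp_remainder[of k t] this]
    have "vanishes k (\<lambda>z. exp (t * (z - 1/2)) - (\<Sum>q<k. t ^ q / fact q * ?g z ^ q))"
    proof (rule vanishes_cong)
      fix z
      have "(\<Sum>q<k. t ^ q / fact q * ((z - 1/2) ^ q - ?g z ^ q))
          = (\<Sum>q<k. t ^ q / fact q * (z - 1/2) ^ q) - (\<Sum>q<k. t ^ q / fact q * ?g z ^ q)"
        by (simp only: right_diff_distrib sum_subtractf)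
      then show "exp (t * (z - 1/2)) - (\<Sum>q<k. t ^ q / fact q * (z - 1/2) ^ q)
            + (\<Sum>q<k. t ^ q / fact q * ((z - 1/2) ^ q - ?g z ^ q))
          = exp (t * (z - 1/2)) - (\<Sum>q<k. t ^ q / fact q * ?g z ^ q)"
        by simp
    qed
    from vanishes_mult_hol[OF this calderonD(2)[OF Y]]
    show ?thesis
    proof (rule vanishes_cong)
      fix z
      have "Q i j z = Y i j z * (\<Sum>q<k. t ^ q / fact q * ?g z ^ q)"
        unfolding Q_def sum_distrib_left by (intro sum.cong refl) (simp add: mult_ac)
      then show "Y i j z * (exp (t * (z - 1/2)) - (\<Sum>q<k. t ^ q / fact q * ?g z ^ q))
          = exp (t * (z - 1/2)) * Y i j z - Q i j z"
        by (simp only: right_diff_distrib mult.commute)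
    qed
  qed
  define M where "M n i i' = Re (\<Psi> n (Q i) * cnj (\<Psi> n (Q i')))" for n i i'
  obtain \<epsilon> :: "nat \<Rightarrow> real" where \<epsilon>: "\<And>i. \<epsilon> i = 1 \<or> \<epsilon> i = -1"
    "(\<Sum>i\<in>E. \<Sum>n\<in>E. M n i i) \<le> (\<Sum>i\<in>E. \<Sum>i'\<in>E. \<epsilon> i * \<epsilon> i' * (\<Sum>n\<in>E. M n i i'))"
    using exists_signs[OF E(1), of "\<lambda>i i'. \<Sum>n\<in>E. M n i i'"] by blast
  define G where "G j z = (\<Sum>i\<in>E. of_real (\<epsilon> i) * (exp (t * z) * Y i j z))" for j z
  have "cmod (of_real (\<epsilon> i)) \<le> 1" for i using \<epsilon>(1)[of i] by auto
  from calderon_block_sum[OF Y supp disj E this]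
  have cG: "calderon G D" by (simp add: G_def[abs_def] t_def N_def)
  have \<Psi>G: "\<Psi> n G = of_real r * (\<Sum>i\<in>E. of_real (\<epsilon> i) * \<Psi> n (Q i))" for n
  proof -
    have cS: "calderon (\<lambda>j z. \<Sum>i\<in>E. of_real (\<epsilon> i) * Q i j z) (\<Sum>i\<in>E. cmod (of_real (\<epsilon> i)) * CQ)"
      by (intro calderon_sum calderon_cmult cQ)
    have "congruent_mod k G (\<lambda>j z. of_real r * (\<Sum>i\<in>E. of_real (\<epsilon> i) * Q i j z))"
      unfolding congruent_mod_def
    proof
      fix j
      have "vanishes k (\<lambda>z. \<Sum>i\<in>E. (of_real r * of_real (\<epsilon> i)) *
              (exp (t * (z - 1/2)) * Y i j z - Q i j z))"
        by (intro vanishes_sum vanishes_cmult van)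
      then show "vanishes k (\<lambda>z. G j z - of_real r * (\<Sum>i\<in>E. of_real (\<epsilon> i) * Q i j z))"
      proof (rule vanishes_cong)
        fix z
        show "(\<Sum>i\<in>E. (of_real r * of_real (\<epsilon> i)) * (exp (t * (z - 1/2)) * Y i j z - Q i j z))
            = G j z - of_real r * (\<Sum>i\<in>E. of_real (\<epsilon> i) * Q i j z)"
          unfolding G_def exp_split[of z] sum_distrib_left sum_subtractf[symmetric]
          by (intro sum.cong refl) (simp only: right_diff_distrib mult_ac)
      qed
    qed
    from cong[OF cG calderon_cmult[OF cS] this, of n]
    show ?thesis
      by (simp add: cmult[OF cS] sum_eq[OF calderon_cmult[OF cQ]] cmult[OF cQ])
  qed
  have "(\<Sum>n\<in>E. (cmod (\<Psi> n (Q n)))\<^sup>2) \<le> (\<Sum>i\<in>E. \<Sum>n\<in>E. M n i i)"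
  proof (rule sum_mono)
    fix i assume "i \<in> E"
    have M0: "M n i i = (cmod (\<Psi> n (Q i)))\<^sup>2" for n
      by (simp add: M_def flip: complex_norm_square)
    show "(cmod (\<Psi> i (Q i)))\<^sup>2 \<le> (\<Sum>n\<in>E. M n i i)"
      unfolding M0 by (rule member_le_sum[OF \<open>i \<in> E\<close> _ E(1)]) simp
  qed
  also have "\<dots> \<le> (\<Sum>i\<in>E. \<Sum>i'\<in>E. \<epsilon> i * \<epsilon> i' * (\<Sum>n\<in>E. M n i i'))" by (rule \<epsilon>(2))
  also have "\<dots> = (\<Sum>n\<in>E. \<Sum>i\<in>E. \<Sum>i'\<in>E. \<epsilon> i * \<epsilon> i' * M n i i')"
    unfolding sum_distrib_left by (subst sum.swap[of _ E E], subst (2) sum.swap[of _ E E]) simp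
  also have "\<dots> = (\<Sum>n\<in>E. (cmod (\<Sum>i\<in>E. of_real (\<epsilon> i) * \<Psi> n (Q i)))\<^sup>2)"
  proof (rule sum.cong[OF refl])
    fix n
    define S where "S = (\<Sum>i\<in>E. of_real (\<epsilon> i) * \<Psi> n (Q i))"
    have "(cmod S)\<^sup>2 = Re (S * cnj S)" by (simp flip: complex_norm_square)
    also have "\<dots> = (\<Sum>i\<in>E. \<Sum>i'\<in>E. \<epsilon> i * \<epsilon> i' * M n i i')"
      unfolding S_def cnj_sum sum_product Re_sum M_def
      by (intro sum.cong refl) (simp add: algebra_simps)
    finally show "(\<Sum>i\<in>E. \<Sum>i'\<in>E. \<epsilon> i * \<epsilon> i' * M n i i') = (cmod S)\<^sup>2" ..
  qed
  also have "\<dots> = N * (\<Sum>n\<in>E. (cmod (\<Psi> n G))\<^sup>2)"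
  proof -
    have "(cmod (\<Psi> n G))\<^sup>2 = r\<^sup>2 * (cmod (\<Sum>i\<in>E. of_real (\<epsilon> i) * \<Psi> n (Q i)))\<^sup>2" for n
      unfolding \<Psi>G using r by (simp add: norm_mult power_mult_distrib)
    then have "N * (\<Sum>n\<in>E. (cmod (\<Psi> n G))\<^sup>2)
        = (r\<^sup>2 * N) * (\<Sum>n\<in>E. (cmod (\<Sum>i\<in>E. of_real (\<epsilon> i) * \<Psi> n (Q i)))\<^sup>2)"
      by (simp add: sum_distrib_left mult_ac)
    then show ?thesis using r by simp
  qed
  also have "\<dots> \<le> N * (K * D)\<^sup>2" using l2_bound[OF cG E(1)] N by (intro mult_left_mono) auto
  finally have avg: "(\<Sum>n\<in>E. (cmod (\<Psi> n (Q n)))\<^sup>2) \<le> N * (K * D)\<^sup>2" .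
  have "\<exists>n\<in>E. (cmod (\<Psi> n (Q n)))\<^sup>2 \<le> (K * D)\<^sup>2"
  proof (rule ccontr)
    assume "\<not> ?thesis"
    then have "(\<Sum>n\<in>E. (K * D)\<^sup>2) < (\<Sum>n\<in>E. (cmod (\<Psi> n (Q n)))\<^sup>2)"
      by (intro sum_strict_mono E) auto
    then show False using avg by (simp add: N_def)
  qed
  then obtain n where "n \<in> E" and n: "(cmod (\<Psi> n (Q n)))\<^sup>2 \<le> (K * D)\<^sup>2" by blast
  from n have "cmod (\<Psi> n (Q n)) \<le> K * D" by (rule power2_le_imp_le) (use K_nonneg D0 in simp)
  then show ?thesis using \<open>n \<in> E\<close> unfolding PQ t_def N_def by blast
qed

text \<open>
  The coefficient of \<open>ln N\<close> in the diagonal bound.  This is the strict cosingularity of the inclusion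
  of \<open>Z\<^sup>(\<^sup>k\<^sup>-\<^sup>1\<^sup>)\<close> in \<open>Z\<^sup>(\<^sup>k\<^sup>)\<close>, for disjointly supported sequences.
\<close>

lemma shifted_blocks_tend_to_0:
  assumes Y: "\<And>i. calderon (Y i) D" and supp: "\<And>i j. j \<notin> A i \<Longrightarrow> Y i j = (\<lambda>z. 0)"
    and disj: "disjoint_family A" and k: "k > 1"
  shows "(\<lambda>n. \<Psi> n (\<lambda>m z. local_coord k z * Y n m z)) \<longlonglongrightarrow> 0"
proof -
  let ?c = "\<lambda>n j. \<Psi> n (\<lambda>m z. local_coord k z ^ j * Y n m z)"
  have D0: "0 \<le> D" using calderon_nonneg[OF Y] by blast
  define B where "B = K * (real k ^ k * D)"
  have "(\<lambda>n. ?c n 1) \<longlonglongrightarrow> 0"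
  proof (rule coefficients_tend_to_0[where k = k and B = B])
    fix n j assume "j < k"
    have "cmod (?c n j) \<le> K * (real k ^ j * D)"
      by (intro bound calderon_mult multiplier_power multiplier_local_coord Y)
    also have "\<dots> \<le> B"
      unfolding B_def using \<open>j < k\<close> k D0
      by (intro mult_left_mono mult_right_mono power_increasing K_nonneg) auto
    finally show "cmod (?c n j) \<le> B" .
  next
    fix N :: nat assume "N > 0"
    have "1 \<le> real k ^ k" using k by (intro one_le_power) auto
    then have KB: "K * D \<le> B"
      unfolding B_def using D0 mult_right_mono[of 1 "real k ^ k" D] by (intro mult_left_mono K_nonneg) auto
    show "\<forall>\<^sub>F n in sequentially. cmod (\<Sum>j<k. (- of_real (ln (real N))) ^ j / fact j * ?c n j) \<le> B"
    proof (rule eventually_if_hits_all_large_sets)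
      fix E :: "nat set" assume E: "finite E" "card E = N"
      then have "E \<noteq> {}" using \<open>N > 0\<close> by auto
      from diagonal_average_bound[OF Y supp disj E(1) this] KB
      show "\<exists>n\<in>E. cmod (\<Sum>j<k. (- of_real (ln (real N))) ^ j / fact j * ?c n j) \<le> B"
        unfolding E(2) by (meson order_trans)
    qed
  qed (use k in auto)
  then show ?thesis by simp
qed

end


section \<open>Values of sequences with an upper 2-estimate\<close>

lemma Re_mult_cnj_self: "Re (z * cnj z) = (cmod z)\<^sup>2"
  by (simp flip: complex_norm_square)

text \<open>
  The dual use of the logarithm.  A signed sum of the \<open>H i\<close> has norm of order \<open>N\<^bsup>1/2\<^esup>\<close>.  It is paired
  with the signed block sum of the extremal families \<open>L i\<close> of the conjugate values of \<open>H i\<close> on \<open>A i\<close>.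
  In the first Taylor coefficient of this pairing the derivative of \<open>N\<^bsup>-z\<^esup>\<close> contributes \<open>ln N\<close> times the
  sum of the squared values on the blocks, while all else on the diagonal is bounded.
\<close>

lemma sign_average_bound:
  fixes H :: "nat \<Rightarrow> nat \<Rightarrow> complex \<Rightarrow> complex"
  assumes H: "\<And>i. calderon (H i) C"
    and upper: "\<And>\<epsilon> :: nat \<Rightarrow> real. (\<And>i. \<epsilon> i = 1 \<or> \<epsilon> i = -1) \<Longrightarrow>
      \<exists>G. calderon G (K' * sqrt (card E)) \<and>
        (\<forall>j. G j (1/2) = (\<Sum>i\<in>E. of_real (\<epsilon> i) * H i j (1/2)) \<and>
             deriv (G j) (1/2) = (\<Sum>i\<in>E. of_real (\<epsilon> i) * deriv (H i j) (1/2)))"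
    and A: "\<And>i. finite (A i)" "disjoint_family A" and E: "finite E" "E \<noteq> {}"
  shows "\<exists>i\<in>E. ln (card E) * (\<Sum>j\<in>A i. (cmod (H i j (1/2)))\<^sup>2) \<le> 2 * (C + K') * (C + 1)"
proof -
  \<comment> \<open>The summand \<open>1\<close> makes the scale of the extremal families positive when \<open>C = 0\<close>.\<close>
  define C' where "C' = C + 1"
  have C0: "0 \<le> C" using calderon_nonneg[OF H] by blast
  have C': "C' > 0" "C \<le> C'" using C0 by (auto simp: C'_def)
  define N where "N = real (card E)"
  have N: "N \<ge> 1" using E by (simp add: N_def Suc_le_eq card_gt_0_iff)
  define t where "t = ln N"
  define r where "r = 1 / sqrt N"
  have r: "r > 0" using N by (simp add: r_def)
  define u where "u i j = (if j \<in> A i then cnj (H i j (1/2)) else 0)" for i j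
  define L where "L i = extremal C' (u i)" for i
  have L: "calderon (L i) C'" for i
    unfolding L_def
  proof (rule calderon_extremal[OF C'(1)])
    fix B :: "nat set" assume B: "finite B"
    have "(\<Sum>j\<in>B. (cmod (u i j))\<^sup>2) \<le> (\<Sum>j\<in>B. (cmod (H i j (1/2)))\<^sup>2)"
      by (intro sum_mono) (simp add: u_def)
    also have "\<dots> \<le> C\<^sup>2" by (rule calderon_value_l2[OF H B])
    also have "\<dots> \<le> C'\<^sup>2" using C0 C' by (intro power_mono) auto
    finally show "(\<Sum>j\<in>B. (cmod (u i j))\<^sup>2) \<le> C'\<^sup>2" .
  qed
  have L_half: "L i j (1/2) = u i j" for i j by (simp add: L_def)
  have L_supp: "j \<notin> A i \<Longrightarrow> L i j = (\<lambda>z. 0)" for i j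
    by (simp add: L_def u_def extremal_eq_0)
  define U where "U = (\<Union>i\<in>E. A i)"
  have U: "finite U" using E A by (auto simp: U_def)
  \<comment> \<open>\<open>X i i'\<close> is, up to the factor \<open>N\<^bsup>-1/2\<^esup>\<close>, the contribution of \<open>H i\<close> and the \<open>i'\<close>-th block.\<close>
  define X where "X i i' = (\<Sum>j\<in>U. deriv (H i j) (1/2) * u i' j
      - H i j (1/2) * (deriv (L i' j) (1/2) - of_real t * u i' j))" for i i'
  obtain \<epsilon> :: "nat \<Rightarrow> real" where \<epsilon>: "\<And>i. \<epsilon> i = 1 \<or> \<epsilon> i = -1"
    "(\<Sum>i\<in>E. Re (X i i)) \<le> (\<Sum>i\<in>E. \<Sum>i'\<in>E. \<epsilon> i * \<epsilon> i' * Re (X i i'))"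
    using exists_signs[OF E(1), of "\<lambda>i i'. Re (X i i')"] by blast
  obtain G where G: "calderon G (K' * sqrt N)"
    "\<And>j. G j (1/2) = (\<Sum>i\<in>E. of_real (\<epsilon> i) * H i j (1/2))"
    "\<And>j. deriv (G j) (1/2) = (\<Sum>i\<in>E. of_real (\<epsilon> i) * deriv (H i j) (1/2))"
    using upper[of \<epsilon>, OF \<epsilon>(1)] by (auto simp: N_def)
  define M where "M j z = (\<Sum>i\<in>E. of_real (\<epsilon> i) * (exp (- of_real t * z) * L i j z))" for j z
  have "cmod (of_real (\<epsilon> i)) \<le> 1" for i using \<epsilon>(1)[of i] by auto
  from calderon_block_sum[OF L L_supp A(2) E this]
  have M: "calderon M C'" by (simp add: M_def[abs_def] t_def N_def)
  have er: "exp (- complex_of_real t * (1/2)) = of_real r"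
  proof -
    have "exp (- complex_of_real t * (1/2)) = complex_of_real (exp (- ln (sqrt N)))"
      using N by (simp add: t_def ln_sqrt flip: exp_of_real)
    also have "\<dots> = of_real r" using N by (simp add: r_def exp_minus inverse_eq_divide)
    finally show ?thesis .
  qed
  have M_half: "M j (1/2) = of_real r * (\<Sum>i\<in>E. of_real (\<epsilon> i) * u i j)" for j
    unfolding M_def er L_half sum_distrib_left by (intro sum.cong refl) (simp add: mult_ac)
  have M_deriv: "deriv (M j) (1/2) = of_real r * (\<Sum>i\<in>E. of_real (\<epsilon> i) *
      (deriv (L i j) (1/2) - of_real t * u i j))" for j
  proof (rule DERIV_imp_deriv)
    have "(L i j has_field_derivative deriv (L i j) (1/2)) (at (1/2))" for i
      by (rule holomorphic_derivI[OF calderonD(2)[OF L] open_strip half_in_strip])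
    moreover have "((\<lambda>z. exp (- of_real t * z)) has_field_derivative
        - of_real t * exp (- complex_of_real t * (1/2))) (at (1/2))"
      by (auto intro!: derivative_eq_intros)
    then have "((\<lambda>z. exp (- of_real t * z)) has_field_derivative
        - of_real t * complex_of_real r) (at (1/2))"
      unfolding er .
    ultimately have "(M j has_field_derivative (\<Sum>i\<in>E. of_real (\<epsilon> i) *
        (- of_real t * of_real r * L i j (1/2) + deriv (L i j) (1/2) * exp (- of_real t * (1/2))))) (at (1/2))"
      unfolding M_def[abs_def] by (intro DERIV_sum DERIV_cmult DERIV_mult)
    also have "(\<Sum>i\<in>E. of_real (\<epsilon> i) *
        (- of_real t * of_real r * L i j (1/2) + deriv (L i j) (1/2) * exp (- of_real t * (1/2))))
      = of_real r * (\<Sum>i\<in>E. of_real (\<epsilon> i) * (deriv (L i j) (1/2) - of_real t * u i j))"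
      unfolding er L_half sum_distrib_left by (intro sum.cong refl) (simp add: algebra_simps)
    finally show "(M j has_field_derivative of_real r * (\<Sum>i\<in>E. of_real (\<epsilon> i) *
      (deriv (L i j) (1/2) - of_real t * u i j))) (at (1/2))" .
  qed
  have "(\<Sum>j\<in>U. deriv (G j) (1/2) * M j (1/2) - G j (1/2) * deriv (M j) (1/2))
      = (\<Sum>j\<in>U. of_real r * (\<Sum>i\<in>E. \<Sum>i'\<in>E. of_real (\<epsilon> i) * of_real (\<epsilon> i') *
         (deriv (H i j) (1/2) * u i' j - H i j (1/2) * (deriv (L i' j) (1/2) - of_real t * u i' j))))"
  proof (rule sum.cong[OF refl])
    fix j
    have *: "(\<Sum>i\<in>E. of_real (\<epsilon> i) * a i) * (of_real r * (\<Sum>i\<in>E. of_real (\<epsilon> i) * b i))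
        = of_real r * (\<Sum>i\<in>E. \<Sum>i'\<in>E. of_real (\<epsilon> i) * of_real (\<epsilon> i') * (a i * b i'))"
      for a b :: "nat \<Rightarrow> complex"
    proof -
      have "(\<Sum>i\<in>E. of_real (\<epsilon> i) * a i) * (of_real r * (\<Sum>i\<in>E. of_real (\<epsilon> i) * b i))
          = of_real r * ((\<Sum>i\<in>E. of_real (\<epsilon> i) * a i) * (\<Sum>i\<in>E. of_real (\<epsilon> i) * b i))"
        by (simp add: mult_ac)
      also have "\<dots> = of_real r * (\<Sum>i\<in>E. \<Sum>i'\<in>E. of_real (\<epsilon> i) * of_real (\<epsilon> i') * (a i * b i'))"
        unfolding sum_product by (simp add: mult_ac)
      finally show ?thesis .
    qed
    show "deriv (G j) (1/2) * M j (1/2) - G j (1/2) * deriv (M j) (1/2)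
      = of_real r * (\<Sum>i\<in>E. \<Sum>i'\<in>E. of_real (\<epsilon> i) * of_real (\<epsilon> i') *
         (deriv (H i j) (1/2) * u i' j - H i j (1/2) * (deriv (L i' j) (1/2) - of_real t * u i' j)))"
      unfolding G M_half M_deriv * by (simp only: right_diff_distrib sum_subtractf)
  qed
  also have "\<dots> = of_real r * (\<Sum>i\<in>E. \<Sum>i'\<in>E. of_real (\<epsilon> i) * of_real (\<epsilon> i') * X i i')"
    unfolding X_def sum_distrib_left
    by (subst sum.swap, rule sum.cong[OF refl], rule sum.swap)
  finally have eq: "(\<Sum>j\<in>U. deriv (G j) (1/2) * M j (1/2) - G j (1/2) * deriv (M j) (1/2))
      = of_real r * (\<Sum>i\<in>E. \<Sum>i'\<in>E. of_real (\<epsilon> i) * of_real (\<epsilon> i') * X i i')" .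
  have "r * cmod (\<Sum>i\<in>E. \<Sum>i'\<in>E. of_real (\<epsilon> i) * of_real (\<epsilon> i') * X i i') \<le> 2 * (K' * sqrt N * C')"
    using pairing_deriv_bound[OF G(1) M U] r unfolding eq by (simp add: norm_mult)
  then have "cmod (\<Sum>i\<in>E. \<Sum>i'\<in>E. of_real (\<epsilon> i) * of_real (\<epsilon> i') * X i i')
      \<le> sqrt N * (2 * (K' * sqrt N * C'))"
    using N by (simp add: r_def field_simps)
  also have "\<dots> = N * (2 * K' * C')" using N by simp
  finally have up: "cmod (\<Sum>i\<in>E. \<Sum>i'\<in>E. of_real (\<epsilon> i) * of_real (\<epsilon> i') * X i i') \<le> N * (2 * K' * C')" .
  have "(\<Sum>i\<in>E. \<Sum>i'\<in>E. \<epsilon> i * \<epsilon> i' * Re (X i i'))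
      = Re (\<Sum>i\<in>E. \<Sum>i'\<in>E. of_real (\<epsilon> i) * of_real (\<epsilon> i') * X i i')"
    unfolding Re_sum by (intro sum.cong refl) simp
  then have upper_diag: "(\<Sum>i\<in>E. Re (X i i)) \<le> N * (2 * K' * C')"
    using \<epsilon>(2) up complex_Re_le_cmod order_trans by (metis (no_types, lifting))
  define s where "s i = (\<Sum>j\<in>A i. (cmod (H i j (1/2)))\<^sup>2)" for i
  have diag: "t * s i - 2 * C * C' \<le> Re (X i i)" if i: "i \<in> E" for i
  proof -
    define Z where "Z = (\<Sum>j\<in>U. deriv (H i j) (1/2) * L i j (1/2) - H i j (1/2) * deriv (L i j) (1/2))"
    have "cmod Z \<le> 2 * (C * C')" unfolding Z_def by (rule pairing_deriv_bound[OF H L U])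
    moreover have "- cmod Z \<le> Re Z" using abs_Re_le_cmod[of Z] by linarith
    moreover have "X i i = Z + of_real t * (\<Sum>j\<in>U. H i j (1/2) * u i j)"
      unfolding X_def Z_def L_half sum_distrib_left sum.distrib[symmetric]
      by (intro sum.cong refl) (simp add: algebra_simps)
    moreover have "Re (\<Sum>j\<in>U. H i j (1/2) * u i j) = s i"
    proof -
      have "(\<Sum>j\<in>U. H i j (1/2) * u i j) = (\<Sum>j\<in>A i. H i j (1/2) * cnj (H i j (1/2)))"
        using U i by (intro sum.mono_neutral_cong_right) (auto simp: u_def U_def)
      then show ?thesis by (simp only: Re_sum Re_mult_cnj_self s_def)
    qed
    ultimately show ?thesis by simp
  qed
  have "\<exists>i\<in>E. t * s i \<le> 2 * (C + K') * C'"
  proof (rule ccontr)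
    assume "\<not> ?thesis"
    then have "2 * (C + K') * C' < t * s i" if "i \<in> E" for i using that by force
    then have "2 * K' * C' < Re (X i i)" if "i \<in> E" for i
      using diag[OF that] that by (fastforce simp: algebra_simps)
    then have "(\<Sum>i\<in>E. 2 * K' * C') < (\<Sum>i\<in>E. Re (X i i))"
      by (intro sum_strict_mono E) auto
    then show False using upper_diag by (simp add: N_def)
  qed
  then show ?thesis by (simp add: s_def t_def N_def C'_def)
qed

text \<open>
  Strict singularity of the quotient map of \<open>Z\<^sup>(\<^sup>k\<^sup>)\<close> onto \<open>l\<^sub>2\<close>: the hypothesis \<open>upper\<close> says that the
  \<open>H i\<close> satisfy an upper \<open>2\<close>-estimate modulo \<open>(z - 1/2)\<^sup>2\<close>.
\<close>

lemma block_values_tend_to_0: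
  fixes H :: "nat \<Rightarrow> nat \<Rightarrow> complex \<Rightarrow> complex"
  assumes H: "\<And>i. calderon (H i) C"
    and upper: "\<And>E (\<epsilon> :: nat \<Rightarrow> real). finite E \<Longrightarrow> (\<And>i. \<epsilon> i = 1 \<or> \<epsilon> i = -1) \<Longrightarrow>
      \<exists>G. calderon G (K' * sqrt (card E)) \<and>
        (\<forall>j. G j (1/2) = (\<Sum>i\<in>E. of_real (\<epsilon> i) * H i j (1/2)) \<and>
             deriv (G j) (1/2) = (\<Sum>i\<in>E. of_real (\<epsilon> i) * deriv (H i j) (1/2)))"
    and A: "\<And>i. finite (A i)" "disjoint_family A"
  shows "(\<lambda>n. \<Sum>j\<in>A n. (cmod (H n j (1/2)))\<^sup>2) \<longlonglongrightarrow> 0"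
proof (rule tendstoI)
  fix e :: real assume "e > 0"
  let ?s = "\<lambda>n. \<Sum>j\<in>A n. (cmod (H n j (1/2)))\<^sup>2"
  define B where "B = 2 * (C + K') * (C + 1)"
  obtain N :: nat where N: "N > 0" "max 1 (B / e + 1) \<le> ln (real N)" using exists_large_ln by blast
  have "\<forall>\<^sub>F n in sequentially. ln (real N) * ?s n \<le> B"
  proof (rule eventually_if_hits_all_large_sets)
    fix E :: "nat set" assume E: "finite E" "card E = N"
    then have "E \<noteq> {}" using N(1) by auto
    from sign_average_bound[OF H upper[OF E(1)] A E(1) this]
    show "\<exists>n\<in>E. ln (real N) * ?s n \<le> B" unfolding E(2) B_def by blast
  qed
  then show "\<forall>\<^sub>F n in sequentially. dist (?s n) 0 < e"
  proof eventually_elim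
    case (elim n)
    have "B < ln (real N) * e"
      using N(2) \<open>e > 0\<close> by (simp add: pos_divide_less_eq[symmetric])
    then have "ln (real N) * ?s n < ln (real N) * e" using elim by linarith
    then have "?s n < e" using N(2) by simp
    moreover have "0 \<le> ?s n" by (simp add: sum_nonneg)
    ultimately show ?case by simp
  qed
qed


section \<open>The gliding hump\<close>

context hilbert_coordinates
begin

text \<open>
  The value of the \<open>n\<close>-th block at \<open>1/2\<close> tends to \<open>0\<close> in \<open>l\<^sub>2\<close>, hence so does the norm of its
  extremal lift.  The rest of the block is divisible by the local coordinate, and there
  \<open>shifted_blocks_tend_to_0\<close> applies.
\<close>

lemma blocks_tend_to_0:
  assumes k: "k > 1" and H: "\<And>i. calderon (H i) C"
    and upper: "\<And>E (\<epsilon> :: nat \<Rightarrow> real). finite E \<Longrightarrow> (\<And>i. \<epsilon> i = 1 \<or> \<epsilon> i = -1) \<Longrightarrow>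
      \<exists>G. calderon G (K' * sqrt (card E)) \<and>
        (\<forall>j. G j (1/2) = (\<Sum>i\<in>E. of_real (\<epsilon> i) * H i j (1/2)) \<and>
             deriv (G j) (1/2) = (\<Sum>i\<in>E. of_real (\<epsilon> i) * deriv (H i j) (1/2)))"
    and A: "\<And>i. finite (A i)" "disjoint_family A"
  shows "(\<lambda>n. \<Psi> n (restr (A n) (H n))) \<longlonglongrightarrow> 0"
proof -
  have C0: "0 \<le> C" using calderon_nonneg[OF H] by blast
  define F where "F n = restr (A n) (H n)" for n
  have F: "calderon (F n) C" for n unfolding F_def by (rule calderon_restr[OF H])
  define s where "s n = (\<Sum>j\<in>A n. (cmod (H n j (1/2)))\<^sup>2)" for n
  have s0: "0 \<le> s n" for n by (simp add: s_def sum_nonneg)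
  have s_le: "sqrt (s n) \<le> C" for n
    using calderon_value_l2[OF H A(1)] C0 by (intro real_le_lsqrt) (auto simp: s_def)
  have s_lim: "s \<longlonglongrightarrow> 0"
    unfolding s_def[abs_def] by (rule block_values_tend_to_0[OF H upper A])
  \<comment> \<open>A positive scale that dominates the value and still tends to \<open>0\<close>.\<close>
  define c where "c n = sqrt (s n) + inverse (real (Suc n))" for n
  have c_pos: "c n > 0" for n using s0[of n] by (simp add: c_def add_nonneg_pos)
  have c_le: "c n \<le> C + 1" for n
    using s_le[of n] by (simp add: c_def add_mono inverse_le_1_iff del: of_nat_Suc)
  have c_lim: "c \<longlonglongrightarrow> sqrt 0 + 0"
    unfolding c_def[abs_def] by (intro tendsto_add tendsto_real_sqrt s_lim LIMSEQ_inverse_real_of_nat)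
  have F_l2: "(\<Sum>j\<in>B. (cmod (F n j (1/2)))\<^sup>2) \<le> (c n)\<^sup>2" if B: "finite B" for n B
  proof -
    have "(\<Sum>j\<in>B. (cmod (F n j (1/2)))\<^sup>2) = (\<Sum>j\<in>B \<inter> A n. (cmod (H n j (1/2)))\<^sup>2)"
      using B by (intro sum.mono_neutral_cong_right) (auto simp: F_def restr_def)
    also have "\<dots> \<le> s n" unfolding s_def using A(1) by (intro sum_mono2) auto
    also have "\<dots> = (sqrt (s n))\<^sup>2" using s0 by simp
    also have "\<dots> \<le> (c n)\<^sup>2" using s0 by (intro power_mono) (auto simp: c_def)
    finally show ?thesis .
  qed
  have "\<exists>G. calderon G (2 * (C + c n)) \<and> (\<forall>j z. z \<in> cstrip \<longrightarrow>
      F n j z = extremal (c n) (\<lambda>j. F n j (1/2)) j z + (z - 1/2) * G j z)" for n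
    using split_off_value[OF F c_pos F_l2, of n] by metis
  then obtain G where G: "\<And>n. calderon (G n) (2 * (C + c n))"
    "\<And>n j z. z \<in> cstrip \<Longrightarrow>
      F n j z = extremal (c n) (\<lambda>j. F n j (1/2)) j z + (z - 1/2) * G n j z" by metis
  define L where "L n = extremal (c n) (\<lambda>j. F n j (1/2))" for n
  have L: "calderon (L n) (c n)" for n unfolding L_def by (rule calderon_extremal[OF c_pos F_l2])
  \<comment> \<open>Off \<open>A n\<close>, both \<open>F n\<close> and its extremal lift are zero; restricting makes the support exact.\<close>
  define Y where "Y n = restr (A n) (G n)" for n
  have Y: "calderon (Y n) (2 * (2 * C + 1))" for n
    unfolding Y_def by (rule calderon_mono[OF calderon_restr[OF G(1)]]) (use c_le[of n] in simp)
  have Y_supp: "Y n j = (\<lambda>z. 0)" if "j \<notin> A n" for n j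
    using that by (simp add: Y_def restr_out)
  have gY: "calderon (\<lambda>j z. local_coord k z * Y n j z) (real k * (2 * (2 * C + 1)))" for n
    by (rule calderon_mult[OF multiplier_local_coord Y])
  have "\<Psi> n (F n) = \<Psi> n (L n) + \<Psi> n (\<lambda>j z. local_coord k z * Y n j z)" for n
  proof -
    have "congruent_mod k (F n) (\<lambda>j z. L n j z + local_coord k z * Y n j z)"
      unfolding congruent_mod_def
    proof
      fix j
      have "vanishes k (\<lambda>z. Y n j z * ((z - 1/2) - local_coord k z))"
        by (intro vanishes_mult_hol vanishes_mono[OF vanishes_local_coord_diff] calderonD(2)[OF Y]) simp
      then show "vanishes k (\<lambda>z. F n j z - (L n j z + local_coord k z * Y n j z))"
      proof (rule vanishes_cong)
        fix z assume "z \<in> strip"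
        then have z: "z \<in> cstrip" using strip_subset_cstrip by blast
        have "F n j z = L n j z + (z - 1/2) * Y n j z"
        proof (cases "j \<in> A n")
          case True
          then show ?thesis using G(2)[OF z, of n j] by (simp add: L_def Y_def restr_def)
        next
          case False
          then have "F n j = (\<lambda>z. 0)" by (simp add: F_def restr_out)
          then show ?thesis using Y_supp[OF False] by (simp add: L_def extremal_eq_0)
        qed
        then show "Y n j z * ((z - 1/2) - local_coord k z) = F n j z - (L n j z + local_coord k z * Y n j z)"
          by (simp add: algebra_simps)
      qed
    qed
    from cong[OF F calderon_add[OF L gY] this] show ?thesis by (simp add: add[OF L gY])
  qed
  moreover have "(\<lambda>n. \<Psi> n (L n)) \<longlonglongrightarrow> 0"
  proof (rule Lim_null_comparison)
    show "\<forall>\<^sub>F n in sequentially. norm (\<Psi> n (L n)) \<le> K * c n" using bound[OF L] by simp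
    show "(\<lambda>n. K * c n) \<longlonglongrightarrow> 0" using tendsto_mult_left[OF c_lim, of K] by simp
  qed
  moreover have "(\<lambda>n. \<Psi> n (\<lambda>j z. local_coord k z * Y n j z)) \<longlonglongrightarrow> 0"
    by (rule shifted_blocks_tend_to_0[OF Y Y_supp A(2) k])
  ultimately have "(\<lambda>n. \<Psi> n (F n)) \<longlonglongrightarrow> 0" using tendsto_add by fastforce
  then show ?thesis by (simp add: F_def)
qed

text \<open>
  Given the left end \<open>m\<close> of a block, a large \<open>n\<close> makes the part of \<open>H n\<close> before \<open>m\<close> negligible for
  \<open>\<Psi> n\<close>, and then a large \<open>m'\<close> does the same for the part from \<open>m'\<close> on.  Indices \<open>n\<close> outside the
  subsequence get the empty block, which keeps the indexing of the other lemmas.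
\<close>

lemma gliding_hump:
  assumes H: "\<And>i. calderon (H i) C" and one: "\<And>n. \<Psi> n (H n) = 1"
  obtains A where "\<And>n. finite (A n)" "disjoint_family A"
    "\<not> (\<lambda>n. \<Psi> n (restr (A n) (H n))) \<longlonglongrightarrow> 0"
proof -
  define good where "good x = (case x of (n, m, m') \<Rightarrow> m \<le> (m'::nat) \<and>
     cmod (\<Psi> n (restr {..<m} (H n))) < 1/4 \<and> cmod (\<Psi> n (restr {m'..} (H n))) < 1/4)" for x
  define succ where "succ x y = (case (x, y) of ((n, m, m'), (n', l, l')) \<Rightarrow> n < n' \<and> l = (m'::nat))"
    for x y :: "nat \<times> nat \<times> nat"
  have step: "\<exists>n m'. n0 < n \<and> good (n, m, m')" for n0 m
  proof -
    have "\<forall>\<^sub>F n in sequentially. dist (\<Psi> n (restr {..<m} (H n))) 0 < 1/4"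
      by (rule tendstoD[OF head_tendsto_0[OF H]]) simp
    moreover have "\<forall>\<^sub>F n in sequentially. n0 < n" by (rule eventually_gt_at_top)
    ultimately have "\<forall>\<^sub>F n in sequentially. cmod (\<Psi> n (restr {..<m} (H n))) < 1/4 \<and> n0 < n"
      by eventually_elim simp
    then obtain n where n: "cmod (\<Psi> n (restr {..<m} (H n))) < 1/4" "n0 < n"
      using eventually_happens trivial_limit_sequentially by blast
    have "\<forall>\<^sub>F m' in sequentially. dist (\<Psi> n (restr {m'..} (H n))) 0 < 1/4"
      by (rule tendstoD[OF tail_tendsto_0[OF H]]) simp
    moreover have "\<forall>\<^sub>F m' in sequentially. m \<le> m'" by (rule eventually_ge_at_top)
    ultimately have "\<forall>\<^sub>F m' in sequentially. cmod (\<Psi> n (restr {m'..} (H n))) < 1/4 \<and> m \<le> m'"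
      by eventually_elim simp
    then obtain m' where "cmod (\<Psi> n (restr {m'..} (H n))) < 1/4" "m \<le> m'"
      using eventually_happens trivial_limit_sequentially by blast
    then show ?thesis using n by (auto simp: good_def)
  qed
  obtain f where f: "\<And>i. good (f i)" "\<And>i. succ (f i) (f (Suc i))"
  proof (rule dependent_nat_choice[of "\<lambda>_ x. good x" "\<lambda>_. succ", THEN exE])
    show "\<exists>x. good x" using step[of 0 0] by blast
    show "\<exists>y. good y \<and> succ x y" if "good x" for x i
    proof -
      obtain n m m' where x: "x = (n, m, m')" by (cases x) auto
      show ?thesis using step[of n m'] by (auto simp: x succ_def)
    qed
  qed blast
  define n where "n i = fst (f i)" for i
  define m where "m i = fst (snd (f i))" for i
  have sm: "snd (snd (f i)) = m (Suc i)" "n i < n (Suc i)" for i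
    using f(2)[of i] by (auto simp: succ_def m_def n_def split: prod.splits)
  have fi: "f i = (n i, m i, m (Suc i))" for i
    using sm(1)[of i] by (simp add: n_def m_def prod_eq_iff)
  have gm: "m i \<le> m (Suc i)" "cmod (\<Psi> (n i) (restr {..<m i} (H (n i)))) < 1/4"
    "cmod (\<Psi> (n i) (restr {m (Suc i)..} (H (n i)))) < 1/4" for i
    using f(1)[of i] by (auto simp: good_def fi)
  have n_mono: "strict_mono n" by (rule strict_monoI_Suc) (rule sm(2))
  have m_mono: "mono m" by (rule incseq_SucI) (rule gm(1))
  define A where "A p = (\<Union>i\<in>{i. n i = p}. {m i..<m (Suc i)})" for p
  have A_n: "A (n i) = {m i..<m (Suc i)}" for i
    using strict_mono_eq[OF n_mono] by (auto simp: A_def)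
  have fin: "finite (A p)" for p
  proof (cases "\<exists>i. p = n i")
    case True
    then show ?thesis using A_n by auto
  next
    case False
    then have "A p = {}" by (auto simp: A_def)
    then show ?thesis by simp
  qed
  have disj: "disjoint_family A"
    unfolding disjoint_family_on_def
  proof (intro ballI impI)
    fix p q :: nat assume "p \<noteq> q"
    have "\<not> (x \<in> A p \<and> x \<in> A q)" for x
    proof
      assume "x \<in> A p \<and> x \<in> A q"
      then obtain i i' where i: "n i = p" "m i \<le> x" "x < m (Suc i)"
        "n i' = q" "m i' \<le> x" "x < m (Suc i')" by (auto simp: A_def)
      have "i \<noteq> i'" using i \<open>p \<noteq> q\<close> by auto
      then consider "Suc i \<le> i'" | "Suc i' \<le> i" by linarith
      then show False
      proof cases
        case 1
        then have "m (Suc i) \<le> m i'" by (rule monoD[OF m_mono])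
        then show False using i by linarith
      next
        case 2
        then have "m (Suc i') \<le> m i" by (rule monoD[OF m_mono])
        then show False using i by linarith
      qed
    qed
    then show "A p \<inter> A q = {}" by blast
  qed
  have big: "1/2 < cmod (\<Psi> (n i) (restr (A (n i)) (H (n i))))" for i
  proof -
    let ?H = "H (n i)" and ?h = "restr {..<m i}" and ?t = "restr {m (Suc i)..}" and ?b = "restr (A (n i))"
    have "?H = (\<lambda>j z. ?h ?H j z + (?b ?H j z + ?t ?H j z))"
      using gm(1)[of i] by (auto simp: fun_eq_iff restr_def A_n)
    then have "\<Psi> (n i) ?H = \<Psi> (n i) (\<lambda>j z. ?h ?H j z + (?b ?H j z + ?t ?H j z))" by simp
    also have "\<dots> = \<Psi> (n i) (?h ?H) + (\<Psi> (n i) (?b ?H) + \<Psi> (n i) (?t ?H))"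
      by (subst add[OF calderon_restr[OF H] calderon_add[OF calderon_restr[OF H] calderon_restr[OF H]]],
          subst add[OF calderon_restr[OF H] calderon_restr[OF H]]) (rule refl)
    finally have "1 = \<Psi> (n i) (?h ?H) + (\<Psi> (n i) (?b ?H) + \<Psi> (n i) (?t ?H))"
      by (simp only: one)
    then have "1 \<le> cmod (\<Psi> (n i) (?h ?H)) + (cmod (\<Psi> (n i) (?b ?H)) + cmod (\<Psi> (n i) (?t ?H)))"
      by (metis norm_one norm_triangle_ineq norm_triangle_mono order_refl)
    then show ?thesis using gm(2,3)[of i] by linarith
  qed
  have "\<not> (\<lambda>p. \<Psi> p (restr (A p) (H p))) \<longlonglongrightarrow> 0"
  proof
    assume "(\<lambda>p. \<Psi> p (restr (A p) (H p))) \<longlonglongrightarrow> 0"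
    from LIMSEQ_subseq_LIMSEQ[OF this n_mono]
    have "\<forall>\<^sub>F i in sequentially. dist (\<Psi> (n i) (restr (A (n i)) (H (n i)))) 0 < 1/2"
      unfolding o_def by (rule tendstoD) simp
    then obtain i where "dist (\<Psi> (n i) (restr (A (n i)) (H (n i)))) 0 < 1/2"
      using eventually_happens trivial_limit_sequentially by blast
    then show False using big[of i] by simp
  qed
  then show thesis by (rule that[OF fin disj])
qed

lemma no_dual_hilbert_basis:
  assumes k: "k > 1" and H: "\<And>i. calderon (H i) C" and one: "\<And>n. \<Psi> n (H n) = 1"
    and upper: "\<And>E (\<epsilon> :: nat \<Rightarrow> real). finite E \<Longrightarrow> (\<And>i. \<epsilon> i = 1 \<or> \<epsilon> i = -1) \<Longrightarrow>
      \<exists>G. calderon G (K' * sqrt (card E)) \<and>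
        (\<forall>j. G j (1/2) = (\<Sum>i\<in>E. of_real (\<epsilon> i) * H i j (1/2)) \<and>
             deriv (G j) (1/2) = (\<Sum>i\<in>E. of_real (\<epsilon> i) * deriv (H i j) (1/2)))"
  shows False
proof -
  obtain A where A: "\<And>n. finite (A n)" "disjoint_family A"
    "\<not> (\<lambda>n. \<Psi> n (restr (A n) (H n))) \<longlonglongrightarrow> 0"
    using gliding_hump[OF H one] by metis
  show False using blocks_tend_to_0[OF k H upper A(1,2)] A(3) by simp
qed

end


section \<open>Analytic functions with values in bounded sequences\<close>

lemma norm_apply_linf: "cmod (apply_bcontfun x j) \<le> norm (x :: linf)"
  by (rule norm_bounded)

lemma bounded_linear_apply: "bounded_linear (\<lambda>x :: linf. apply_bcontfun x j)"
  by (rule bounded_linear_intro[of _ 1])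
     (auto simp: plus_bcontfun.rep_eq scaleR_bcontfun.rep_eq norm_apply_linf)

lemma norm_linf_le: "(\<And>j. cmod (apply_bcontfun x j) \<le> b) \<Longrightarrow> norm (x :: linf) \<le> b"
  by (rule norm_bound)

lemma apply_Bcontfun:
  fixes f :: "nat \<Rightarrow> complex"
  assumes "\<And>j. cmod (f j) \<le> b"
  shows "apply_bcontfun (Bcontfun f) j = f j"
proof -
  have "f \<in> bcontfun" by (rule bcontfun_normI[of _ b]) (use assms in auto)
  then show ?thesis by (simp add: Bcontfun_inverse)
qed

lemma bounded_linear_cscale_left: "bounded_linear (\<lambda>h. cscale h D)"
proof (rule bounded_linear_intro[of _ "norm D"])
  show "cscale (x + y) D = cscale x D + cscale y D" for x y
    by (rule bcontfun_eqI) (simp add: plus_bcontfun.rep_eq distrib_right)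
  show "cscale (r *\<^sub>R x) D = r *\<^sub>R cscale x D" for r x
    by (rule bcontfun_eqI) (simp add: scaleR_bcontfun.rep_eq)
  show "norm (cscale x D) \<le> norm x * norm D" for x
    by (rule norm_linf_le) (simp add: norm_mult mult_left_mono norm_apply_linf)
qed

lemma has_cderiv_coordinate:
  assumes "has_cderiv F D z"
  shows "((\<lambda>z. apply_bcontfun (F z) j) has_field_derivative apply_bcontfun D j) (at z)"
proof -
  have "((\<lambda>z. apply_bcontfun (F z) j) has_derivative (\<lambda>h. apply_bcontfun (cscale h D) j)) (at z)"
    by (rule bounded_linear.has_derivative[OF bounded_linear_apply])
       (use assms in \<open>simp add: has_cderiv_def\<close>)
  then show ?thesis
    unfolding has_field_derivative_def apply_cscale by (simp add: mult.commute[of _ "apply_bcontfun D j"])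
qed

text \<open>
  Uniform bounds on the coordinates give, by Cauchy's inequality, uniform bounds on their second
  derivatives; so the Taylor remainder of order two is uniform in the coordinate, which is
  differentiability in the sup norm.
\<close>

lemma has_cderiv_from_coordinates:
  assumes r: "r > 0" and bdd: "\<And>y. y \<in> ball z r \<Longrightarrow> norm (F y) \<le> B"
    and hol: "\<And>j. f j holomorphic_on ball z r"
    and coord: "\<And>y j. y \<in> ball z r \<Longrightarrow> apply_bcontfun (F y) j = f j y"
  shows "\<exists>D. has_cderiv F D z"
proof -
  define R where "R = r / 4"
  have R: "R > 0" using r by (simp add: R_def)
  have fB: "cmod (f j y) \<le> B" if "y \<in> ball z r" for j y
    using bdd[OF that] norm_apply_linf[of "F y" j] coord[OF that, of j] by simp
  have cauchy: "cmod ((deriv ^^ n) (f j) y) \<le> fact n * B / R ^ n" if y: "y \<in> ball z (2 * R)" for n j y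
  proof (rule Cauchy_inequality[OF _ _ R])
    have sub: "cball y R \<subseteq> ball z r"
    proof
      fix x assume "x \<in> cball y R"
      then have "dist z x < 2 * R + R" using y dist_triangle[of z x y] by simp
      then show "x \<in> ball z r" using r by (simp add: R_def)
    qed
    then show "f j holomorphic_on ball y R"
      by (intro holomorphic_on_subset[OF hol]) (use ball_subset_cball in blast)
    show "continuous_on (cball y R) (f j)"
      by (intro holomorphic_on_imp_continuous_on holomorphic_on_subset[OF hol] sub)
    show "cmod (f j x) \<le> B" if "norm (y - x) = R" for x
      using that sub by (intro fB) (auto simp: dist_norm)
  qed
  define D where "D = Bcontfun (\<lambda>j. deriv (f j) z)"
  have D: "apply_bcontfun D j = deriv (f j) z" for j
    unfolding D_def using cauchy[of z 1] R by (intro apply_Bcontfun[of _ "B / R"]) simp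
  have err: "norm (F (z + h) - F z - cscale h D) \<le> (2 * B / R\<^sup>2) * (cmod h)\<^sup>2" if h: "cmod h < 2 * R" for h
  proof (rule norm_linf_le)
    fix j
    have zh: "z + h \<in> ball z (2 * R)" "z \<in> ball z (2 * R)" using h R by (auto simp: dist_norm)
    have sub: "ball z (2 * R) \<subseteq> ball z r" using r by (auto simp: R_def)
    have "cmod ((deriv ^^ 0) (f j) (z + h) - (\<Sum>i\<le>1. (deriv ^^ i) (f j) z * (z + h - z) ^ i / fact i))
        \<le> (2 * B / R\<^sup>2) * cmod (z + h - z) ^ (Suc 1) / fact 1"
    proof (rule complex_Taylor)
      show "convex (ball z (2 * R))" by simp
      show "z \<in> ball z (2 * R)" "z + h \<in> ball z (2 * R)" using zh by auto
      show "((deriv ^^ i) (f j) has_field_derivative (deriv ^^ Suc i) (f j) x)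
          (at x within ball z (2 * R))" if "x \<in> ball z (2 * R)" for i x
      proof -
        have "(deriv ^^ i) (f j) holomorphic_on ball z (2 * R)"
          by (intro holomorphic_higher_deriv holomorphic_on_subset[OF hol] sub) simp
        from holomorphic_derivI[OF this _ that] show ?thesis
          by (simp add: has_field_derivative_at_within)
      qed
      show "cmod ((deriv ^^ Suc 1) (f j) x) \<le> 2 * B / R\<^sup>2" if "x \<in> ball z (2 * R)" for x
        using cauchy[OF that, of 2 j] by (simp add: numeral_2_eq_2)
    qed
    then have "cmod (f j (z + h) - f j z - h * deriv (f j) z) \<le> (2 * B / R\<^sup>2) * (cmod h)\<^sup>2"
      by (simp add: algebra_simps numeral_2_eq_2)
    moreover have "apply_bcontfun (F (z + h)) j = f j (z + h)" "apply_bcontfun (F z) j = f j z"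
      using zh sub by (intro coord; blast)+
    ultimately show "cmod (apply_bcontfun (F (z + h) - F z - cscale h D) j) \<le> (2 * B / R\<^sup>2) * (cmod h)\<^sup>2"
      by (simp only: minus_bcontfun.rep_eq D apply_cscale)
  qed
  have "(\<lambda>h. norm (F (z + h) - F z - cscale h D) / norm h) \<midarrow>0\<rightarrow> 0"
  proof (rule Lim_null_comparison)
    show "\<forall>\<^sub>F h in at 0. norm (norm (F (z + h) - F z - cscale h D) / norm h) \<le> (2 * B / R\<^sup>2) * cmod h"
      unfolding eventually_at
    proof (intro exI[of _ "2 * R"] conjI ballI impI)
      fix h :: complex assume h: "h \<noteq> 0 \<and> dist h 0 < 2 * R"
      then have "norm (F (z + h) - F z - cscale h D) \<le> (2 * B / R\<^sup>2) * (cmod h)\<^sup>2"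
        using err[of h] by simp
      then show "norm (norm (F (z + h) - F z - cscale h D) / norm h) \<le> (2 * B / R\<^sup>2) * cmod h"
        using h by (simp add: pos_divide_le_eq power2_eq_square mult.assoc)
    qed (use R in simp)
    have "((\<lambda>h. (2 * B / R\<^sup>2) * cmod h) \<longlongrightarrow> (2 * B / R\<^sup>2) * cmod 0) (at 0)"
      by (intro tendsto_intros)
    then show "((\<lambda>h. (2 * B / R\<^sup>2) * cmod h) \<longlongrightarrow> 0) (at (0 :: complex))" by simp
  qed
  then have "has_cderiv F D z"
    unfolding has_cderiv_def has_derivative_at using bounded_linear_cscale_left by blast
  then show ?thesis ..
qed

lemma cderiv_has_cderiv: "\<exists>D. has_cderiv F D z \<Longrightarrow> has_cderiv F (cderiv F z) z"
  unfolding cderiv_def by (rule someI_ex)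

lemma analytic_linf_coordinate_holomorphic:
  assumes "analytic_linf F strip"
  shows "(\<lambda>z. apply_bcontfun (F z) j) holomorphic_on strip"
  using assms has_cderiv_coordinate open_strip unfolding analytic_linf_def
  by (subst holomorphic_on_open) blast+

lemma cderiv_coordinate:
  assumes "analytic_linf F strip" "z \<in> strip"
  shows "apply_bcontfun (cderiv F z) j = deriv (\<lambda>z. apply_bcontfun (F z) j) z"
  using has_cderiv_coordinate[OF cderiv_has_cderiv, of F z j] assms
  by (auto simp: analytic_linf_def dest: DERIV_imp_deriv)

text \<open>
  Differentiability implies local boundedness, and this passes to the coordinate derivatives on a
  smaller disc.
\<close>

lemma analytic_linf_cderiv:
  assumes F: "analytic_linf F strip"
  shows "analytic_linf (cderiv F) strip"
  unfolding analytic_linf_def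
proof
  fix z assume z: "z \<in> strip"
  let ?f = "\<lambda>j z. apply_bcontfun (F z) j"
  have "isCont F z"
    using F z has_derivative_continuous unfolding analytic_linf_def has_cderiv_def by blast
  then obtain d where d: "d > 0" "\<And>y. dist y z < d \<Longrightarrow> dist (F y) (F z) < 1"
    unfolding continuous_at_eps_delta by (metis zero_less_one)
  obtain e where e: "e > 0" "ball z e \<subseteq> strip" using open_strip z open_contains_ball by blast
  define r where "r = min d e / 2"
  have r: "r > 0" "2 * r \<le> d" "2 * r \<le> e" using d(1) e(1) by (auto simp: r_def)
  define B where "B = norm (F z) + 1"
  have B: "cmod (?f j y) \<le> B" if "y \<in> ball z (2 * r)" for j y
  proof -
    have "dist (F y) (F z) < 1" using that r by (intro d(2)) (simp add: dist_commute)
    then have "norm (F y) \<le> B" unfolding B_def dist_norm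
      using norm_triangle_ineq2[of "F y" "F z"] by linarith
    then show ?thesis using norm_apply_linf[of "F y" j] by linarith
  qed
  have sub: "ball z r \<subseteq> strip" using e(2) r by (auto simp: subset_iff)
  show "\<exists>D. has_cderiv (cderiv F) D z"
  proof (rule has_cderiv_from_coordinates[OF r(1), where f = "\<lambda>j. deriv (?f j)" and B = "B / (r / 2)"])
    show "deriv (?f j) holomorphic_on ball z r" for j
      by (intro holomorphic_deriv holomorphic_on_subset[OF analytic_linf_coordinate_holomorphic[OF F] sub]) simp
    fix y assume y: "y \<in> ball z r"
    show c: "apply_bcontfun (cderiv F y) j = deriv (?f j) y" for j
      by (rule cderiv_coordinate[OF F]) (use y sub in blast)
    have cb: "cball y (r / 2) \<subseteq> ball z (2 * r)" "cball y (r / 2) \<subseteq> strip"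
    proof -
      show "cball y (r / 2) \<subseteq> ball z (2 * r)"
      proof
        fix x assume "x \<in> cball y (r / 2)"
        then show "x \<in> ball z (2 * r)" using y dist_triangle[of z x y] r(1) by simp
      qed
      also have "\<dots> \<subseteq> strip" using e(2) r by (auto simp: subset_iff)
      finally show "cball y (r / 2) \<subseteq> strip" .
    qed
    show "norm (cderiv F y) \<le> B / (r / 2)"
    proof (rule norm_linf_le)
      fix j
      have "norm ((deriv ^^ 1) (?f j) y) \<le> fact 1 * B / (r / 2) ^ 1"
      proof (rule Cauchy_inequality)
        show "?f j holomorphic_on ball y (r / 2)"
          using cb(2) ball_subset_cball
          by (intro holomorphic_on_subset[OF analytic_linf_coordinate_holomorphic[OF F]]) blast
        show "continuous_on (cball y (r / 2)) (?f j)"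
          by (intro holomorphic_on_imp_continuous_on
              holomorphic_on_subset[OF analytic_linf_coordinate_holomorphic[OF F]] cb(2))
        show "norm (?f j x) \<le> B" if "norm (y - x) = r / 2" for x
          using that cb(1) by (intro B) (auto simp: dist_norm)
      qed (use r in simp)
      then show "cmod (apply_bcontfun (cderiv F y) j) \<le> B / (r / 2)" by (simp add: c)
    qed
  qed
qed

lemma higher_cderiv:
  assumes F: "analytic_linf F strip"
  shows "analytic_linf ((cderiv ^^ i) F) strip \<and>
    (\<forall>z\<in>strip. \<forall>j. apply_bcontfun ((cderiv ^^ i) F z) j = (deriv ^^ i) (\<lambda>z. apply_bcontfun (F z) j) z)"
proof (induction i)
  case 0
  then show ?case using F by simp
next
  case (Suc i)
  then have IH: "analytic_linf ((cderiv ^^ i) F) strip"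
    "\<And>z j. z \<in> strip \<Longrightarrow>
      apply_bcontfun ((cderiv ^^ i) F z) j = (deriv ^^ i) (\<lambda>z. apply_bcontfun (F z) j) z" by auto
  have "apply_bcontfun (cderiv ((cderiv ^^ i) F) z) j = deriv ((deriv ^^ i) (\<lambda>z. apply_bcontfun (F z) j)) z"
    if z: "z \<in> strip" for z j
    unfolding cderiv_coordinate[OF IH(1) z]
  proof (rule deriv_cong_ev)
    show "\<forall>\<^sub>F x in nhds z. apply_bcontfun ((cderiv ^^ i) F x) j = (deriv ^^ i) (\<lambda>z. apply_bcontfun (F z) j) x"
      using open_strip z IH(2) by (auto simp: eventually_nhds)
  qed simp
  then show ?case using analytic_linf_cderiv[OF IH(1)] by simp
qed


section \<open>The Calderon space and its coordinate form\<close>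

text \<open>
  The value \<open>0\<close> off the closed strip avoids applying \<open>Bcontfun\<close> to unbounded sequences.
\<close>

definition to_linf :: "(nat \<Rightarrow> complex \<Rightarrow> complex) \<Rightarrow> complex \<Rightarrow> linf" where
  "to_linf F z = (if z \<in> cstrip then Bcontfun (\<lambda>j. F j z) else 0)"

lemma apply_to_linf:
  assumes "calderon F C" "z \<in> cstrip"
  shows "apply_bcontfun (to_linf F z) j = F j z"
  using apply_Bcontfun[OF calderonD(4)[OF assms]] assms(2) by (simp add: to_linf_def)

lemma norm_to_linf_le:
  assumes "calderon F C" "z \<in> cstrip"
  shows "norm (to_linf F z) \<le> C"
  by (rule norm_linf_le) (simp add: apply_to_linf[OF assms] calderonD(4)[OF assms])

lemma l1_summable:
  assumes "y \<in> l1" shows "summable (\<lambda>n. cmod (apply_bcontfun y n))"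
proof (rule summable_suminf_not_top)
  show "(\<Sum>n. ennreal (cmod (apply_bcontfun y n))) \<noteq> top"
    using assms by (simp add: l1_def l1_norm_def)
qed simp

lemma continuous_map_weak_starI:
  assumes "\<And>y. y \<in> l1 \<Longrightarrow> continuous_on S (\<lambda>z. pairing (F z) y)"
  shows "continuous_map (top_of_set S) weak_star_topology F"
  unfolding weak_star_topology_def continuous_on_generated_topo_iff
proof (intro conjI allI impI)
  fix U assume "U \<in> {{x. pairing x y \<in> U} |y U. y \<in> l1 \<and> open U}"
  then obtain y V where U: "U = {x. pairing x y \<in> V}" and y: "y \<in> l1" and V: "open V" by blast
  have "openin (top_of_set S) (S \<inter> (\<lambda>z. pairing (F z) y) -` V)"
    by (rule continuous_openin_preimage_gen[OF assms[OF y] V])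
  also have "S \<inter> (\<lambda>z. pairing (F z) y) -` V = F -` U \<inter> topspace (top_of_set S)"
    by (auto simp: U)
  finally show "openin (top_of_set S) (F -` U \<inter> topspace (top_of_set S))" .
next
  have "(0 :: linf) \<in> l1" by (simp add: l1_def l1_norm_def zero_bcontfun.rep_eq)
  then have "{x. pairing x 0 \<in> UNIV} \<in> {{x. pairing x y \<in> U} |y U. y \<in> l1 \<and> open U}" by blast
  then show "F ` topspace (top_of_set S) \<subseteq> \<Union> {{x. pairing x y \<in> U} |y U. y \<in> l1 \<and> open U}"
    by blast
qed

text \<open>
  Weak-star continuity is the continuity of \<open>\<Sum>j. F j z * y j\<close> for \<open>y\<close> in \<open>l\<^sub>1\<close>, a uniform limit by the
  Weierstrass test.
\<close>

lemma to_linf_in_F_space: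
  assumes F: "calderon F C"
  shows "to_linf F \<in> F_space" "F_norm (to_linf F) \<le> ennreal C"
proof -
  note F' = calderonD[OF F]
  have C0: "0 \<le> C" by (rule calderon_nonneg[OF F])
  show norm: "F_norm (to_linf F) \<le> ennreal C"
    unfolding F_norm_def
  proof (rule SUP_least)
    fix t :: real
    have "l1_norm (to_linf F (1 + \<i> * of_real t)) \<le> ennreal C"
      unfolding l1_norm_def
    proof (rule suminf_le_const[OF summableI])
      fix n
      have "(\<Sum>j<n. ennreal (cmod (apply_bcontfun (to_linf F (1 + \<i> * of_real t)) j)))
          = ennreal (\<Sum>j<n. cmod (F j (1 + \<i> * of_real t)))"
        by (simp add: apply_to_linf[OF F])
      also have "\<dots> \<le> ennreal C" by (intro ennreal_leI F'(5)) simp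
      finally show "(\<Sum>j<n. ennreal (cmod (apply_bcontfun (to_linf F (1 + \<i> * of_real t)) j))) \<le> ennreal C" .
    qed
    then show "max (ennreal (norm (to_linf F (\<i> * of_real t)))) (l1_norm (to_linf F (1 + \<i> * of_real t)))
        \<le> ennreal C"
      using norm_to_linf_le[OF F] by (simp add: ennreal_leI)
  qed
  have "analytic_linf (to_linf F) strip"
    unfolding analytic_linf_def
  proof
    fix z assume "z \<in> strip"
    then obtain r where r: "r > 0" "ball z r \<subseteq> strip" using open_strip open_contains_ball by blast
    show "\<exists>D. has_cderiv (to_linf F) D z"
    proof (rule has_cderiv_from_coordinates[OF r(1), where f = F and B = C])
      show "F j holomorphic_on ball z r" for j by (rule holomorphic_on_subset[OF F'(2) r(2)])
      fix y assume "y \<in> ball z r"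
      then have "y \<in> cstrip" using r(2) strip_subset_cstrip by blast
      then show "norm (to_linf F y) \<le> C" "apply_bcontfun (to_linf F y) j = F j y" for j
        using norm_to_linf_le[OF F] apply_to_linf[OF F] by auto
    qed
  qed
  moreover have "bounded (to_linf F ` strip)"
    unfolding bounded_iff using norm_to_linf_le[OF F] strip_subset_cstrip by (intro exI[of _ C]) auto
  moreover have "continuous_map (top_of_set (closure strip)) weak_star_topology (to_linf F)"
    unfolding closure_strip
  proof (rule continuous_map_weak_starI)
    fix y assume y: "y \<in> l1"
    have "uniform_limit cstrip (\<lambda>n z. \<Sum>j<n. F j z * apply_bcontfun y j)
        (\<lambda>z. \<Sum>j. F j z * apply_bcontfun y j) sequentially"
    proof (rule Weierstrass_m_test)
      show "summable (\<lambda>j. C * cmod (apply_bcontfun y j))"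
        by (intro summable_mult l1_summable y)
      show "norm (F j z * apply_bcontfun y j) \<le> C * cmod (apply_bcontfun y j)" if "z \<in> cstrip" for j z
        unfolding norm_mult by (intro mult_right_mono F'(4) that) simp
    qed
    then have "continuous_on cstrip (\<lambda>z. \<Sum>j. F j z * apply_bcontfun y j)"
      by (rule uniform_limit_theorem[rotated])
         (auto intro!: always_eventually continuous_intros F'(3))
    then show "continuous_on cstrip (\<lambda>z. pairing (to_linf F z) y)"
      by (rule continuous_on_eq) (simp add: pairing_def apply_to_linf[OF F])
  qed
  moreover have "F_norm (to_linf F) < \<infinity>"
    using norm by (auto intro: le_less_trans)
  ultimately show "to_linf F \<in> F_space" by (simp add: F_space_def)
qed

definition std_unit :: "nat \<Rightarrow> linf" where
  "std_unit n = Bcontfun (\<lambda>j. if j = n then 1 else 0)"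

lemma apply_std_unit [simp]: "apply_bcontfun (std_unit n) j = (if j = n then 1 else 0)"
  unfolding std_unit_def by (rule apply_Bcontfun[of _ 1]) auto

lemma pairing_std_unit: "pairing x (std_unit n) = apply_bcontfun x n"
proof -
  have "(\<Sum>j. apply_bcontfun x j * apply_bcontfun (std_unit n) j)
      = (\<Sum>j\<in>{n}. apply_bcontfun x j * apply_bcontfun (std_unit n) j)"
    by (rule suminf_finite) auto
  then show ?thesis by (simp add: pairing_def)
qed

lemma std_unit_in_l1: "std_unit n \<in> l1"
proof -
  have "l1_norm (std_unit n) = (\<Sum>j\<in>{n}. ennreal (cmod (apply_bcontfun (std_unit n) j)))"
    unfolding l1_norm_def by (rule suminf_finite) auto
  then show ?thesis by (simp add: l1_def)
qed

text \<open>
  Pairing with the unit vectors extracts the coordinates, which are therefore continuous on the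
  closed strip; the maximum principle then applies to each of them.
\<close>

lemma F_space_imp_calderon:
  assumes f: "f \<in> F_space"
  shows "calderon (\<lambda>j z. apply_bcontfun (f z) j) (enn2real (F_norm f))"
proof -
  define C where "C = enn2real (F_norm f)"
  have C: "F_norm f = ennreal C" using f by (simp add: F_space_def C_def less_top)
  have C0: "0 \<le> C" by (simp add: C_def)
  have an: "analytic_linf f strip" using f by (simp add: F_space_def)
  have cont: "continuous_on cstrip (\<lambda>z. apply_bcontfun (f z) j)" for j
    unfolding continuous_openin_preimage_eq
  proof (intro allI impI)
    fix V :: "complex set" assume V: "open V"
    have cm: "continuous_map (top_of_set cstrip) weak_star_topology f"
      using f by (simp add: F_space_def closure_strip)
    have "openin weak_star_topology {x. pairing x (std_unit j) \<in> V}"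
      unfolding weak_star_topology_def
      by (rule topology_generated_by_Basis) (use V std_unit_in_l1 in blast)
    from openin_continuous_map_preimage[OF cm this]
    have "openin (top_of_set cstrip) {z \<in> cstrip. apply_bcontfun (f z) j \<in> V}"
      by (simp add: pairing_std_unit)
    then show "openin (top_of_set cstrip) (cstrip \<inter> (\<lambda>z. apply_bcontfun (f z) j) -` V)"
      by (simp add: vimage_def Int_def)
  qed
  obtain B where B: "\<And>z. z \<in> strip \<Longrightarrow> norm (f z) \<le> B"
    using f by (auto simp: F_space_def bounded_iff)
  have edge: "ennreal (norm (f (\<i> * of_real t))) \<le> ennreal C"
    "l1_norm (f (1 + \<i> * of_real t)) \<le> ennreal C" for t
  proof -
    have "max (ennreal (norm (f (\<i> * of_real t)))) (l1_norm (f (1 + \<i> * of_real t))) \<le> ennreal C"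
      unfolding C[symmetric] F_norm_def by (rule SUP_upper) simp
    then show "ennreal (norm (f (\<i> * of_real t))) \<le> ennreal C"
      "l1_norm (f (1 + \<i> * of_real t)) \<le> ennreal C" by auto
  qed
  have "calderon (\<lambda>j z. apply_bcontfun (f z) j) C"
  proof (rule calderonI[OF analytic_linf_coordinate_holomorphic[OF an] cont])
    show "cmod (apply_bcontfun (f z) j) \<le> B" if "z \<in> cstrip" for j z
    proof (rule continuous_on_closure_norm_le[of strip "\<lambda>z. apply_bcontfun (f z) j" B])
      show "\<forall>y\<in>strip. cmod (apply_bcontfun (f y) j) \<le> B"
        using B norm_apply_linf order_trans by blast
    qed (use cont that in \<open>auto simp: closure_strip\<close>)
    show "cmod (apply_bcontfun (f (\<i> * of_real t)) j) \<le> C" for j t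
      using edge(1)[of t] norm_apply_linf[of "f (\<i> * of_real t)" j] C0 by (simp add: ennreal_le_iff)
    fix A :: "nat set" and t assume A: "finite A"
    have "ennreal (\<Sum>j\<in>A. cmod (apply_bcontfun (f (1 + \<i> * of_real t)) j))
        = (\<Sum>j\<in>A. ennreal (cmod (apply_bcontfun (f (1 + \<i> * of_real t)) j)))"
      by simp
    also have "\<dots> \<le> l1_norm (f (1 + \<i> * of_real t))"
      unfolding l1_norm_def by (rule sum_le_suminf) (use A in auto)
    also have "\<dots> \<le> ennreal C" by (rule edge(2))
    finally show "(\<Sum>j\<in>A. cmod (apply_bcontfun (f (1 + \<i> * of_real t)) j)) \<le> C"
      using C0 by (simp add: ennreal_le_iff)
  qed
  then show ?thesis by (simp add: C_def)
qed


section \<open>Taylor tuples\<close>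

definition taylor_tuple :: "nat \<Rightarrow> (nat \<Rightarrow> complex \<Rightarrow> complex) \<Rightarrow> nat \<Rightarrow> linf" where
  "taylor_tuple k F i = (if i < k then (1 / fact i) *\<^sub>R (cderiv ^^ i) (to_linf F) (1/2) else 0)"

lemma F_space_deriv_coordinate:
  assumes "f \<in> F_space" "\<And>z j. z \<in> cstrip \<Longrightarrow> apply_bcontfun (f z) j = F j z"
  shows "apply_bcontfun ((cderiv ^^ i) f (1/2)) j = (deriv ^^ i) (F j) (1/2)"
proof -
  have "analytic_linf f strip" using assms(1) by (simp add: F_space_def)
  have ev: "\<forall>\<^sub>F z in nhds (1/2). apply_bcontfun (f z) j = F j z"
    using eventually_nhds_in_open[OF open_strip half_in_strip]
    by eventually_elim (rule assms(2)[OF subsetD[OF strip_subset_cstrip]])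
  from conjunct2[OF higher_cderiv[OF \<open>analytic_linf f strip\<close>, of i], THEN bspec, OF half_in_strip]
  have "apply_bcontfun ((cderiv ^^ i) f (1/2)) j = (deriv ^^ i) (\<lambda>z. apply_bcontfun (f z) j) (1/2)"
    by (rule spec)
  also have "\<dots> = (deriv ^^ i) (F j) (1/2)"
    by (rule higher_deriv_cong_ev[OF ev refl])
  finally show ?thesis .
qed

lemma apply_taylor_tuple:
  assumes "calderon F C"
  shows "apply_bcontfun (taylor_tuple k F i) j = (if i < k then (deriv ^^ i) (F j) (1/2) / fact i else 0)"
  using F_space_deriv_coordinate[OF to_linf_in_F_space(1)[OF assms] apply_to_linf[OF assms], of i j]
  by (simp add: taylor_tuple_def scaleR_bcontfun.rep_eq zero_bcontfun.rep_eq scaleR_conv_of_real)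

lemma to_linf_represents_taylor_tuple:
  "calderon F C \<Longrightarrow> to_linf F \<in> Z_representatives k (taylor_tuple k F)"
  using to_linf_in_F_space(1) by (auto simp: Z_representatives_def taylor_tuple_def)

lemma taylor_tuple_in_Z:
  assumes "calderon F C"
  shows "taylor_tuple k F \<in> cn_carrier (Z_space k)" "cn_norm (Z_space k) (taylor_tuple k F) \<le> C"
proof -
  note rep = to_linf_represents_taylor_tuple[OF assms, of k]
  show "taylor_tuple k F \<in> cn_carrier (Z_space k)"
    using rep by (auto simp: Z_space_def taylor_tuple_def)
  have "(INF f\<in>Z_representatives k (taylor_tuple k F). F_norm f) \<le> ennreal C"
    by (rule order_trans[OF INF_lower[OF rep, of F_norm] to_linf_in_F_space(2)[OF assms]])
  then have "enn2real (INF f\<in>Z_representatives k (taylor_tuple k F). F_norm f) \<le> enn2real (ennreal C)"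
    by (rule enn2real_mono) simp
  then show "cn_norm (Z_space k) (taylor_tuple k F) \<le> C"
    using calderon_nonneg[OF assms] by (simp add: Z_space_def)
qed

text \<open>
  The norm is an infimum, hence the \<open>\<delta>\<close>.
\<close>

lemma taylor_tuple_surj:
  assumes x: "x \<in> cn_carrier (Z_space k)" and "\<delta> > 0"
  obtains F where "calderon F (cn_norm (Z_space k) x + \<delta>)" "taylor_tuple k F = x"
proof -
  define I where "I = (INF f\<in>Z_representatives k x. F_norm f)"
  obtain f0 where f0: "f0 \<in> Z_representatives k x" using x by (auto simp: Z_space_def)
  then have "F_norm f0 < top" by (simp add: Z_representatives_def F_space_def)
  moreover have "I \<le> F_norm f0" unfolding I_def by (rule INF_lower[OF f0])
  ultimately have "I < top" by (rule le_less_trans[rotated])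
  then have I: "I = ennreal (enn2real I)" by simp
  have "I < ennreal (enn2real I + \<delta>)"
    by (subst (1) I, rule ennreal_lessI) (use \<open>\<delta> > 0\<close> enn2real_nonneg[of I] in linarith)+
  then obtain f where f: "f \<in> Z_representatives k x" "F_norm f < ennreal (enn2real I + \<delta>)"
    unfolding I_def INF_less_iff by blast
  then have fF: "f \<in> F_space" by (simp add: Z_representatives_def)
  define F where "F j z = apply_bcontfun (f z) j" for j z
  have "enn2real (F_norm f) \<le> enn2real (ennreal (enn2real I + \<delta>))"
    by (rule enn2real_mono) (use f(2) in auto)
  also have "\<dots> = enn2real I + \<delta>"
    by (rule enn2real_ennreal) (use \<open>\<delta> > 0\<close> enn2real_nonneg[of I] in linarith)
  finally have "calderon F (enn2real I + \<delta>)"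
    using calderon_mono[OF F_space_imp_calderon[OF fF]] by (simp add: F_def[abs_def])
  then have F: "calderon F (cn_norm (Z_space k) x + \<delta>)" by (simp add: Z_space_def I_def)
  have "taylor_tuple k F i = x i" for i
  proof (cases "i < k")
    case True
    show ?thesis
    proof (rule bcontfun_eqI)
      fix j
      have "x i = (1 / fact i) *\<^sub>R (cderiv ^^ i) f (1/2)" using f(1) True by (simp add: Z_representatives_def)
      then have "apply_bcontfun (x i) j = (deriv ^^ i) (F j) (1/2) / fact i"
        using F_space_deriv_coordinate[OF fF, of F i j]
        by (simp add: F_def scaleR_bcontfun.rep_eq scaleR_conv_of_real)
      then show "apply_bcontfun (taylor_tuple k F i) j = apply_bcontfun (x i) j"
        using True by (simp add: apply_taylor_tuple[OF F])
    qed
  next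
    case False
    then show ?thesis using x by (simp add: taylor_tuple_def Z_space_def)
  qed
  then show thesis using that[OF F] by blast
qed

lemma taylor_tuple_add:
  assumes F: "calderon F C" and G: "calderon G D"
  shows "taylor_tuple k (\<lambda>j z. F j z + G j z) = cn_add (Z_space k) (taylor_tuple k F) (taylor_tuple k G)"
proof
  fix i
  show "taylor_tuple k (\<lambda>j z. F j z + G j z) i = cn_add (Z_space k) (taylor_tuple k F) (taylor_tuple k G) i"
  proof (rule bcontfun_eqI)
    fix j
    have "(deriv ^^ i) (\<lambda>z. F j z + G j z) (1/2) = (deriv ^^ i) (F j) (1/2) + (deriv ^^ i) (G j) (1/2)"
      by (rule higher_deriv_add[OF calderonD(2)[OF F] calderonD(2)[OF G] open_strip half_in_strip])
    then show "apply_bcontfun (taylor_tuple k (\<lambda>j z. F j z + G j z) i) j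
        = apply_bcontfun (cn_add (Z_space k) (taylor_tuple k F) (taylor_tuple k G) i) j"
      by (simp add: Z_space_def apply_taylor_tuple[OF F] apply_taylor_tuple[OF G] apply_taylor_tuple[OF calderon_add[OF F G]]
          plus_bcontfun.rep_eq add_divide_distrib)
  qed
qed

lemma taylor_tuple_cmult:
  assumes F: "calderon F C"
  shows "taylor_tuple k (\<lambda>j z. c * F j z) = cn_scale (Z_space k) c (taylor_tuple k F)"
proof
  fix i
  show "taylor_tuple k (\<lambda>j z. c * F j z) i = cn_scale (Z_space k) c (taylor_tuple k F) i"
  proof (rule bcontfun_eqI)
    fix j
    have "(deriv ^^ i) (\<lambda>z. c * F j z) (1/2) = c * (deriv ^^ i) (F j) (1/2)"
      by (rule higher_deriv_cmult[OF calderonD(2)[OF F] half_in_strip open_strip])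
    then show "apply_bcontfun (taylor_tuple k (\<lambda>j z. c * F j z) i) j
        = apply_bcontfun (cn_scale (Z_space k) c (taylor_tuple k F) i) j"
      by (simp add: Z_space_def apply_taylor_tuple[OF F] apply_taylor_tuple[OF calderon_cmult[OF F]])
  qed
qed

lemma taylor_tuple_cong:
  assumes F: "calderon F C" and G: "calderon G D" and "congruent_mod k F G"
  shows "taylor_tuple k F = taylor_tuple k G"
proof
  fix i
  show "taylor_tuple k F i = taylor_tuple k G i"
  proof (rule bcontfun_eqI)
    fix j
    have "(deriv ^^ i) (F j) (1/2) = (deriv ^^ i) (G j) (1/2)" if "i < k"
    proof -
      have "(deriv ^^ i) (\<lambda>z. F j z - G j z) (1/2) = 0"
        by (rule vanishes_higher_deriv[OF _ that]) (use assms(3) in \<open>simp add: congruent_mod_def\<close>)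
      moreover have "(deriv ^^ i) (\<lambda>z. F j z - G j z) (1/2)
          = (deriv ^^ i) (F j) (1/2) - (deriv ^^ i) (G j) (1/2)"
        by (rule higher_deriv_diff[OF calderonD(2)[OF F] calderonD(2)[OF G] open_strip half_in_strip])
      ultimately show ?thesis by simp
    qed
    then show "apply_bcontfun (taylor_tuple k F i) j = apply_bcontfun (taylor_tuple k G i) j"
      by (simp add: apply_taylor_tuple[OF F] apply_taylor_tuple[OF G])
  qed
qed

lemma cn_norm_Z_nonneg: "0 \<le> cn_norm (Z_space k) x"
  by (simp add: Z_space_def)


section \<open>Complemented copies of l2\<close>

lemma bounded_clinear_mapE:
  assumes "bounded_clinear_map X Y T" and "\<And>x. x \<in> cn_carrier X \<Longrightarrow> 0 \<le> cn_norm X x"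
  obtains K where "0 \<le> K" "\<And>x. x \<in> cn_carrier X \<Longrightarrow> cn_norm Y (T x) \<le> K * cn_norm X x"
proof -
  obtain K where K: "\<And>x. x \<in> cn_carrier X \<Longrightarrow> cn_norm Y (T x) \<le> K * cn_norm X x"
    using assms(1) unfolding bounded_clinear_map_def by blast
  show thesis
  proof (rule that[of "\<bar>K\<bar>"])
    fix x assume x: "x \<in> cn_carrier X"
    show "cn_norm Y (T x) \<le> \<bar>K\<bar> * cn_norm X x"
      using K[OF x] mult_right_mono[OF abs_ge_self[of K] assms(2)[OF x]] by linarith
  qed simp
qed

lemma bounded_clinear_mapD:
  assumes "bounded_clinear_map X Y T"
  shows "x \<in> cn_carrier X \<Longrightarrow> T x \<in> cn_carrier Y"
    "x \<in> cn_carrier X \<Longrightarrow> y \<in> cn_carrier X \<Longrightarrow> T (cn_add X x y) = cn_add Y (T x) (T y)"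
    "x \<in> cn_carrier X \<Longrightarrow> T (cn_scale X c x) = cn_scale Y c (T x)"
  using assms by (auto simp: bounded_clinear_map_def)

definition sign_vector :: "nat set \<Rightarrow> (nat \<Rightarrow> real) \<Rightarrow> linf" where
  "sign_vector E \<epsilon> = (\<Sum>i\<in>E. cscale (of_real (\<epsilon> i)) (std_unit i))"

lemma apply_sign_vector:
  assumes "finite E"
  shows "apply_bcontfun (sign_vector E \<epsilon>) j = (if j \<in> E then of_real (\<epsilon> j) else 0)"
proof -
  have "apply_bcontfun (sign_vector E \<epsilon>) j = (\<Sum>i\<in>E. of_real (\<epsilon> i) * (if j = i then 1 else 0))"
    unfolding sign_vector_def
    using assms by (induction E) (auto simp: plus_bcontfun.rep_eq zero_bcontfun.rep_eq)
  also have "\<dots> = (if j \<in> E then of_real (\<epsilon> j) else 0)"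
    using assms by (simp add: if_distrib sum.delta cong: if_cong)
  finally show ?thesis .
qed

lemma sign_vector_in_ell2:
  assumes E: "finite E" and \<epsilon>: "\<And>i. \<epsilon> i = 1 \<or> \<epsilon> i = -1"
  shows "sign_vector E \<epsilon> \<in> cn_carrier ell2" "cn_norm ell2 (sign_vector E \<epsilon>) = sqrt (card E)"
proof -
  have sq: "(cmod (apply_bcontfun (sign_vector E \<epsilon>) j))\<^sup>2 = (if j \<in> E then 1 else 0)" for j
    using \<epsilon>[of j] by (auto simp: apply_sign_vector[OF E])
  show "sign_vector E \<epsilon> \<in> cn_carrier ell2"
    using summable_finite[OF E, of "\<lambda>j. (if j \<in> E then 1 else (0::real))"] by (simp add: ell2_def sq)
  have "(\<Sum>j. (if j \<in> E then 1 else (0::real))) = (\<Sum>j\<in>E. if j \<in> E then 1 else 0)"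
    by (rule suminf_finite[OF E]) auto
  then show "cn_norm ell2 (sign_vector E \<epsilon>) = sqrt (card E)"
    by (simp add: ell2_def sq)
qed

lemma cn_norm_ell2_nonneg: "x \<in> cn_carrier ell2 \<Longrightarrow> 0 \<le> cn_norm ell2 x"
  by (simp add: ell2_def suminf_nonneg)

theorem proposition6:
  fixes k :: nat
  assumes "k > 1"
  shows "\<not> (\<exists>M. complemented_subspace M (Z_space k) \<and>
                isomorphic_normed (subspace_of M (Z_space k)) ell2)"
proof
  assume "\<exists>M. complemented_subspace M (Z_space k) \<and>
                isomorphic_normed (subspace_of M (Z_space k)) ell2"
  then obtain M P T S where P: "bounded_clinear_map (Z_space k) (Z_space k) P"
    and P_idem: "\<And>x. x \<in> cn_carrier (Z_space k) \<Longrightarrow> P (P x) = P x"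
    and M: "P ` cn_carrier (Z_space k) = M"
    and T: "bounded_clinear_map (subspace_of M (Z_space k)) ell2 T"
    and S: "bounded_clinear_map ell2 (subspace_of M (Z_space k)) S"
    and TS: "\<And>y. y \<in> cn_carrier ell2 \<Longrightarrow> T (S y) = y"
    unfolding complemented_subspace_def isomorphic_normed_def by blast
  let ?Z = "Z_space k"
  have sub [simp]: "cn_carrier (subspace_of M ?Z) = M" "cn_norm (subspace_of M ?Z) = cn_norm ?Z"
    "cn_add (subspace_of M ?Z) = cn_add ?Z" "cn_scale (subspace_of M ?Z) = cn_scale ?Z"
    by (simp_all add: subspace_of_def)
  note PD = bounded_clinear_mapD[OF P] and TD = bounded_clinear_mapD[OF T, unfolded sub]
    and SD = bounded_clinear_mapD[OF S, unfolded sub]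
  have PM: "P x \<in> M" if "x \<in> cn_carrier ?Z" for x using M that by blast
  have M_sub: "M \<subseteq> cn_carrier ?Z" using M PD(1) by blast
  have P_fix: "P x = x" if "x \<in> M" for x using M P_idem that by blast
  obtain KP where KP: "0 \<le> KP" "\<And>x. x \<in> cn_carrier ?Z \<Longrightarrow> cn_norm ?Z (P x) \<le> KP * cn_norm ?Z x"
    using bounded_clinear_mapE[OF P cn_norm_Z_nonneg] by blast
  obtain KT where KT: "0 \<le> KT" "\<And>x. x \<in> M \<Longrightarrow> cn_norm ell2 (T x) \<le> KT * cn_norm ?Z x"
    using bounded_clinear_mapE[OF T] cn_norm_Z_nonneg by auto
  obtain KS where KS: "0 \<le> KS" "\<And>y. y \<in> cn_carrier ell2 \<Longrightarrow> cn_norm ?Z (S y) \<le> KS * cn_norm ell2 y"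
    using bounded_clinear_mapE[OF S cn_norm_ell2_nonneg] by auto
  \<comment> \<open>The coordinates of the projection onto \<open>M\<close>, read in \<open>l\<^sub>2\<close>.\<close>
  define \<Psi> where "\<Psi> n F = apply_bcontfun (T (P (taylor_tuple k F))) n" for n F
  interpret hilbert_coordinates k \<Psi> "KT * KP"
  proof
    fix F G C D n assume F: "calderon F C" and G: "calderon G D"
    note tF = taylor_tuple_in_Z(1)[OF F] and tG = taylor_tuple_in_Z(1)[OF G]
    show "\<Psi> n (\<lambda>j z. F j z + G j z) = \<Psi> n F + \<Psi> n G"
      unfolding \<Psi>_def taylor_tuple_add[OF F G] PD(2)[OF tF tG] TD(2)[OF PM[OF tF] PM[OF tG]]
      by (simp add: ell2_def plus_bcontfun.rep_eq)
    show "\<Psi> n F = \<Psi> n G" if "congruent_mod k F G"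
      unfolding \<Psi>_def taylor_tuple_cong[OF F G that] ..
  next
    fix F C c n assume F: "calderon F C"
    note tF = taylor_tuple_in_Z(1)[OF F]
    show "\<Psi> n (\<lambda>j z. c * F j z) = c * \<Psi> n F"
      unfolding \<Psi>_def taylor_tuple_cmult[OF F] PD(3)[OF tF] TD(3)[OF PM[OF tF]]
      by (simp add: ell2_def)
  next
    fix F C and E :: "nat set" assume F: "calderon F C" and E: "finite E"
    note tF = taylor_tuple_in_Z[OF F, where k = k]
    define y where "y = T (P (taylor_tuple k F))"
    have y: "y \<in> cn_carrier ell2" unfolding y_def by (rule TD(1)[OF PM[OF tF(1)]])
    have "(\<Sum>n\<in>E. (cmod (\<Psi> n F))\<^sup>2) \<le> (\<Sum>n. (cmod (apply_bcontfun y n))\<^sup>2)"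
      unfolding \<Psi>_def y_def[symmetric] using y E by (intro sum_le_suminf) (auto simp: ell2_def)
    also have "\<dots> = (cn_norm ell2 y)\<^sup>2" using y by (simp add: ell2_def suminf_nonneg)
    also have "\<dots> \<le> (KT * KP * C)\<^sup>2"
    proof (rule power_mono[OF _ cn_norm_ell2_nonneg[OF y]])
      have "cn_norm ell2 y \<le> KT * cn_norm ?Z (P (taylor_tuple k F))"
        unfolding y_def by (rule KT(2)[OF PM[OF tF(1)]])
      also have "\<dots> \<le> KT * (KP * C)"
        using KP(2)[OF tF(1)] mult_left_mono[OF tF(2) KP(1)] by (intro mult_left_mono KT) linarith
      finally show "cn_norm ell2 y \<le> KT * KP * C" by (simp add: mult.assoc)
    qed
    finally show "(\<Sum>n\<in>E. (cmod (\<Psi> n F))\<^sup>2) \<le> (KT * KP * C)\<^sup>2" .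
  qed (simp add: KT KP)
  \<comment> \<open>The images of the unit vectors of \<open>l\<^sub>2\<close> in \<open>M\<close> form the sequence dual to the coordinates.\<close>
  define e where "e i = sign_vector {i} (\<lambda>_. 1)" for i
  have e: "e i \<in> cn_carrier ell2" "cn_norm ell2 (e i) = 1" for i
    unfolding e_def using sign_vector_in_ell2[of "{i}" "\<lambda>_. 1"] by auto
  have Se: "S (e i) \<in> M" for i by (rule SD(1)[OF e(1)])
  have "\<exists>F. calderon F (KS + 1) \<and> taylor_tuple k F = S (e i)" for i
  proof -
    obtain F where F: "calderon F (cn_norm ?Z (S (e i)) + 1)" "taylor_tuple k F = S (e i)"
      using taylor_tuple_surj[of "S (e i)" k 1] Se M_sub by auto
    have "cn_norm ?Z (S (e i)) \<le> KS" using KS(2)[OF e(1), of i] by (simp add: e(2))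
    then show ?thesis using calderon_mono[OF F(1), of "KS + 1"] F(2) by auto
  qed
  then obtain H where H: "\<And>i. calderon (H i) (KS + 1)" "\<And>i. taylor_tuple k (H i) = S (e i)" by metis
  have one: "\<Psi> n (H n) = 1" for n
    unfolding \<Psi>_def H(2) P_fix[OF Se] TS[OF e(1)] by (simp add: e_def apply_sign_vector)
  have S_lin: "apply_bcontfun (S (sign_vector E \<epsilon>) i) j
      = (\<Sum>p\<in>E. of_real (\<epsilon> p) * apply_bcontfun (S (e p) i) j)"
    if "finite E" "\<And>p. \<epsilon> p = 1 \<or> \<epsilon> p = -1" for E \<epsilon> i j
    using that(1)
  proof (induction E)
    case empty
    have "sign_vector {} \<epsilon> = cn_scale ell2 0 (e 0)"
      by (rule bcontfun_eqI) (simp add: apply_sign_vector ell2_def)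
    then show ?case by (simp add: SD(3)[OF e(1)] Z_space_def)
  next
    case (insert p E)
    have es: "cn_scale ell2 (of_real (\<epsilon> p)) (e p) = sign_vector {p} \<epsilon>"
      by (rule bcontfun_eqI) (simp add: e_def apply_sign_vector ell2_def)
    have "sign_vector (insert p E) \<epsilon> = cn_add ell2 (sign_vector {p} \<epsilon>) (sign_vector E \<epsilon>)"
      using insert(1,2)
      by (intro bcontfun_eqI) (simp add: apply_sign_vector ell2_def plus_bcontfun.rep_eq)
    then have "S (sign_vector (insert p E) \<epsilon>) = cn_add ?Z (S (sign_vector {p} \<epsilon>)) (S (sign_vector E \<epsilon>))"
      using SD(2) sign_vector_in_ell2(1)[of _ \<epsilon>] insert(1) that(2) by simp
    moreover have "S (sign_vector {p} \<epsilon>) = cn_scale ?Z (of_real (\<epsilon> p)) (S (e p))"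
      unfolding es[symmetric] by (rule SD(3)[OF e(1)])
    ultimately show ?case
      using insert by (simp add: Z_space_def plus_bcontfun.rep_eq)
  qed
  have upper: "\<exists>G. calderon G ((KS + 1) * sqrt (card E)) \<and>
        (\<forall>j. G j (1/2) = (\<Sum>i\<in>E. of_real (\<epsilon> i) * H i j (1/2)) \<and>
             deriv (G j) (1/2) = (\<Sum>i\<in>E. of_real (\<epsilon> i) * deriv (H i j) (1/2)))"
    if E: "finite E" and \<epsilon>: "\<And>i. \<epsilon> i = 1 \<or> \<epsilon> i = -1" for E and \<epsilon> :: "nat \<Rightarrow> real"
  proof (cases "E = {}")
    case True
    then show ?thesis by (intro exI[of _ "\<lambda>j z. 0"]) simp
  next
    case False
    then have pos: "sqrt (card E) > 0" using E by (simp add: card_gt_0_iff)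
    define v where "v = sign_vector E \<epsilon>"
    have v: "v \<in> cn_carrier ell2" "cn_norm ell2 v = sqrt (card E)"
      unfolding v_def by (rule sign_vector_in_ell2[OF E \<epsilon>])+
    have "S v \<in> cn_carrier ?Z" using SD(1)[OF v(1)] M_sub by blast
    then obtain G where G: "calderon G (cn_norm ?Z (S v) + sqrt (card E))" "taylor_tuple k G = S v"
      using taylor_tuple_surj pos by metis
    have cG: "calderon G ((KS + 1) * sqrt (card E))"
      by (rule calderon_mono[OF G(1)]) (use KS(2)[OF v(1)] in \<open>simp add: v(2) algebra_simps\<close>)
    have eq: "(deriv ^^ i) (G j) (1/2) = (\<Sum>p\<in>E. of_real (\<epsilon> p) * (deriv ^^ i) (H p j) (1/2))"
      if "i < 2" for i j
    proof -
      have i: "i < k" "fact i = (1::complex)" using that \<open>k > 1\<close> by (auto simp: less_2_cases_iff)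
      have "(deriv ^^ i) (G j) (1/2) = apply_bcontfun (taylor_tuple k G i) j"
        using i by (simp add: apply_taylor_tuple[OF G(1)])
      also have "\<dots> = (\<Sum>p\<in>E. of_real (\<epsilon> p) * apply_bcontfun (taylor_tuple k (H p) i) j)"
        unfolding G(2) v_def H(2) by (rule S_lin[OF E \<epsilon>])
      also have "\<dots> = (\<Sum>p\<in>E. of_real (\<epsilon> p) * (deriv ^^ i) (H p j) (1/2))"
        using i by (simp add: apply_taylor_tuple[OF H(1)])
      finally show ?thesis .
    qed
    show ?thesis using cG eq[of 0] eq[of 1] by auto
  qed
  show False by (rule no_dual_hilbert_basis[OF \<open>k > 1\<close> H(1) one upper])
qed

end
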